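(* The universally quantified two-variable fragment of first-order logic ($\mathbf{UFO}^2$) with unary evidence and bounded-treewidth binary evidence is domain-liftable.
   Context: Work in function-free first-order logic. The universally quantified two-variable fragment ($\mathbf{UFO}^2$) consists of sentences using at most two logical variables and only universal quantifiers, i.e. of the form $\forall x \forall y\, \psi(x,y)$ with $\psi$ quantifier-free. Given a sentence $\Psi$, a finite domain $\Delta$ of size $n$, and weighting functions $w, \overline{w}$ mapping predicates to reals, the weighted first-order model count $\mathrm{WFOMC}(\Psi,\Delta,w,\overline{w})$ is the sum over all models $\mu$ of $\Psi$ over $\Delta$ of $\prod_{l\in\mu \text{ positive}} w(\mathrm{pred}(l))\cdot\prod_{l\in\mu\text{ negative}}\overline{w}(\mathrm{pred}(l))$ (weights are symmetric: they depend only on the predicate). Evidence is a set of ground literals fixing truth values of ground atoms (open-world), or for a set of predicates $\mathcal{P}'$ a set of ground atoms that are true with all other ground atoms of $\mathcal{P}'$ false (closed-world); open-world evidence can be converted to closed-world form. Unary evidence consists of ground literals containing a single domain element (e.g. $R(1)$ or $R(1,1)$); binary evidence consists of ground literals containing two distinct elements. The Gaifman graph of closed-world binary evidence $\mathcal{E}$ over $\Delta$ is the undirected graph on $\Delta$ with an edge between $a$ and $b$ iff $\mathcal{E}$ contains $P(a,b)$ or $P(b,a)$ for some predicate $P$. Binary evidence is bounded-treewidth if this Gaifman graph has treewidth at most a fixed constant $k$. A fragment with a class of evidence is domain-liftable if the WFOMC of $\Psi\wedge\mathcal{E}$ (for every sentence $\Psi$ in the fragment and every evidence $\mathcal{E}$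 in the class) can be computed in time polynomial in the domain size $n$, with the sentence and weighting functions regarded as fixed (data complexity). *)

theory Defs
  imports "HOL-Computational_Algebra.Polynomial"
begin

section \<open>Function-free first-order logic\<close>

text \<open>A vocabulary is the list of arities of its predicates; the predicates are the indices into
  that list. Arities are arbitrary, including 0.\<close>

type_synonym vocab = "nat list"

datatype fm =
    Atom nat "nat list"
  | Eq nat nat
  | Neg fm
  | Conj fm fm
  | Forall nat fm

fun wf_fm :: "vocab \<Rightarrow> fm \<Rightarrow> bool" where
  "wf_fm V (Atom p xs) \<longleftrightarrow> p < length V \<and> length xs = V ! p"
| "wf_fm V (Eq x y) \<longleftrightarrow> True"
| "wf_fm V (Neg f) \<longleftrightarrow> wf_fm V f"
| "wf_fm V (Conj f g) \<longleftrightarrow> wf_fm V f \<and> wf_fm V g"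
| "wf_fm V (Forall x f) \<longleftrightarrow> wf_fm V f"

fun quantifier_free :: "fm \<Rightarrow> bool" where
  "quantifier_free (Atom p xs) \<longleftrightarrow> True"
| "quantifier_free (Eq x y) \<longleftrightarrow> True"
| "quantifier_free (Neg f) \<longleftrightarrow> quantifier_free f"
| "quantifier_free (Conj f g) \<longleftrightarrow> quantifier_free f \<and> quantifier_free g"
| "quantifier_free (Forall x f) \<longleftrightarrow> False"

fun free_vars :: "fm \<Rightarrow> nat set" where
  "free_vars (Atom p xs) = set xs"
| "free_vars (Eq x y) = {x, y}"
| "free_vars (Neg f) = free_vars f"
| "free_vars (Conj f g) = free_vars f \<union> free_vars g"
| "free_vars (Forall x f) = free_vars f - {x}"

definition UFO2 :: "fm set" where
  "UFO2 = {Forall x (Forall y f) | x y f. x \<noteq> y \<and> quantifier_free f \<and> free_vars f \<subseteq> {x, y}}"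

text \<open>An interpretation over a domain is the set of its true ground atoms.\<close>

type_synonym 'd gatom = "nat \<times> 'd list"

definition ground_atoms :: "vocab \<Rightarrow> 'd set \<Rightarrow> 'd gatom set" where
  "ground_atoms V D = {(p, as). p < length V \<and> length as = V ! p \<and> set as \<subseteq> D}"

fun sat :: "'d set \<Rightarrow> 'd gatom set \<Rightarrow> (nat \<Rightarrow> 'd) \<Rightarrow> fm \<Rightarrow> bool" where
  "sat D \<mu> \<sigma> (Atom p xs) \<longleftrightarrow> (p, map \<sigma> xs) \<in> \<mu>"
| "sat D \<mu> \<sigma> (Eq x y) \<longleftrightarrow> \<sigma> x = \<sigma> y"
| "sat D \<mu> \<sigma> (Neg f) \<longleftrightarrow> \<not> sat D \<mu> \<sigma> f"
| "sat D \<mu> \<sigma> (Conj f g) \<longleftrightarrow> sat D \<mu> \<sigma> f \<and> sat D \<mu> \<sigma> g"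
| "sat D \<mu> \<sigma> (Forall x f) \<longleftrightarrow> (\<forall>a\<in>D. sat D \<mu> (\<sigma>(x := a)) f)"


section \<open>Evidence\<close>

text \<open>Open-world evidence is a set of ground literals, where \<open>(b, a)\<close> states that the atom \<open>a\<close> has
  truth value \<open>b\<close>. Closed-world evidence consists of a set of predicates and a set of ground atoms
  of these predicates that are true.

  The number \<open>m\<close> of distinct domain elements in each literal is 1 for unary and 2 for binary
  evidence. Closed-world evidence also fixes only ground atoms with \<open>m\<close> distinct elements: binary
  evidence on \<open>R\<close> says nothing about \<open>R(a,a)\<close>, which is subject to unary evidence.\<close>

datatype 'd evidence =
    Open_World "(bool \<times> 'd gatom) set"
  | Closed_World "nat set" "'d gatom set"

definition atoms_of_kind :: "vocab \<Rightarrow> 'd set \<Rightarrow> nat \<Rightarrow> 'd gatom set" where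
  "atoms_of_kind V D m = {a \<in> ground_atoms V D. card (set (snd a)) = m}"

fun evidence_of_kind :: "vocab \<Rightarrow> 'd set \<Rightarrow> nat \<Rightarrow> 'd evidence \<Rightarrow> bool" where
  "evidence_of_kind V D m (Open_World L) \<longleftrightarrow> snd ` L \<subseteq> atoms_of_kind V D m"
| "evidence_of_kind V D m (Closed_World P A) \<longleftrightarrow>
     P \<subseteq> {..<length V} \<and> A \<subseteq> {a \<in> atoms_of_kind V D m. fst a \<in> P}"

fun sat_evidence :: "vocab \<Rightarrow> 'd set \<Rightarrow> nat \<Rightarrow> 'd gatom set \<Rightarrow> 'd evidence \<Rightarrow> bool" where
  "sat_evidence V D m \<mu> (Open_World L) \<longleftrightarrow> (\<forall>(b, a)\<in>L. a \<in> \<mu> \<longleftrightarrow> b)"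
| "sat_evidence V D m \<mu> (Closed_World P A) \<longleftrightarrow>
     (\<forall>a\<in>atoms_of_kind V D m. fst a \<in> P \<longrightarrow> (a \<in> \<mu> \<longleftrightarrow> a \<in> A))"

abbreviation unary_evidence :: "vocab \<Rightarrow> 'd set \<Rightarrow> 'd evidence \<Rightarrow> bool" where
  "unary_evidence V D \<equiv> evidence_of_kind V D 1"

abbreviation binary_evidence :: "vocab \<Rightarrow> 'd set \<Rightarrow> 'd evidence \<Rightarrow> bool" where
  "binary_evidence V D \<equiv> evidence_of_kind V D 2"

text \<open>The closed-world form of open-world evidence \<open>L\<close> has two closed-world predicates for each
  predicate, holding of the arguments of its positive and of its negative literals in \<open>L\<close>. Hence
  all literals of \<open>L\<close>, of either sign, contribute edges.\<close>

fun evidence_atoms :: "'d evidence \<Rightarrow> 'd gatom set" where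
  "evidence_atoms (Open_World L) = snd ` L"
| "evidence_atoms (Closed_World P A) = A"

definition gaifman_edges :: "'d evidence \<Rightarrow> 'd set set" where
  "gaifman_edges E =
     {{a, b} | a b. a \<noteq> b \<and> (\<exists>(p, as)\<in>evidence_atoms E. a \<in> set as \<and> b \<in> set as)}"


section \<open>Weighted first-order model counting\<close>

definition interpretation_weight ::
    "vocab \<Rightarrow> 'd set \<Rightarrow> (nat \<Rightarrow> real) \<Rightarrow> (nat \<Rightarrow> real) \<Rightarrow> 'd gatom set \<Rightarrow> real" where
  "interpretation_weight V D w wbar \<mu> =
     (\<Prod>a\<in>\<mu>. w (fst a)) * (\<Prod>a\<in>ground_atoms V D - \<mu>. wbar (fst a))"

text \<open>The weighted model count of the conjunction of a sentence with unary and binary evidence.\<close>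

definition wfomc ::
    "vocab \<Rightarrow> 'd set \<Rightarrow> (nat \<Rightarrow> real) \<Rightarrow> (nat \<Rightarrow> real) \<Rightarrow> fm \<Rightarrow> 'd evidence \<times> 'd evidence \<Rightarrow> real"
where
  "wfomc V D w wbar f E =
     (\<Sum>\<mu> | \<mu> \<subseteq> ground_atoms V D \<and> (\<forall>\<sigma>. sat D \<mu> \<sigma> f)
          \<and> sat_evidence V D 1 \<mu> (fst E) \<and> sat_evidence V D 2 \<mu> (snd E).
        interpretation_weight V D w wbar \<mu>)"


section \<open>Treewidth\<close>

definition walk :: "'v set set \<Rightarrow> 'v list \<Rightarrow> bool" where
  "walk F p \<longleftrightarrow> p \<noteq> [] \<and> successively (\<lambda>u v. {u, v} \<in> F) p"

definition connected_on :: "'v set set \<Rightarrow> 'v set \<Rightarrow> bool" where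
  "connected_on F S \<longleftrightarrow>
     (\<forall>u\<in>S. \<forall>v\<in>S. \<exists>p. walk F p \<and> set p \<subseteq> S \<and> hd p = u \<and> last p = v)"

definition acyclic_graph :: "'v set set \<Rightarrow> bool" where
  "acyclic_graph F \<longleftrightarrow>
     \<not> (\<exists>p. walk F p \<and> distinct p \<and> length p \<ge> 3 \<and> {last p, hd p} \<in> F)"

definition finite_tree :: "'v set \<Rightarrow> 'v set set \<Rightarrow> bool" where
  "finite_tree I F \<longleftrightarrow> finite I \<and> I \<noteq> {} \<and> (\<forall>e\<in>F. e \<subseteq> I \<and> card e = 2)
     \<and> connected_on F I \<and> acyclic_graph F"

definition tree_decomposition ::
    "'v set \<Rightarrow> 'v set set \<Rightarrow> nat set \<Rightarrow> nat set set \<Rightarrow> (nat \<Rightarrow> 'v set) \<Rightarrow> bool" where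
  "tree_decomposition W G I F bag \<longleftrightarrow> finite_tree I F
     \<and> (\<Union>i\<in>I. bag i) = W
     \<and> (\<forall>e\<in>G. \<exists>i\<in>I. e \<subseteq> bag i)
     \<and> (\<forall>v\<in>W. connected_on F {i \<in> I. v \<in> bag i})"

text \<open>The treewidth of a finite graph \<open>(W, G)\<close>; for empty \<open>W\<close> the value is 0.\<close>

definition treewidth :: "'v set \<Rightarrow> 'v set set \<Rightarrow> nat" where
  "treewidth W G =
     (LEAST k. \<exists>I F bag. tree_decomposition W G I F bag \<and> k = Max ((\<lambda>i. card (bag i)) ` I) - 1)"


section \<open>Model of computation\<close>

text \<open>Programs are finite lists of first-order, call-by-value, mutually recursive functions on
  binary trees. Trees may be represented with sharing, so every constructor, selector, test and
  call takes constant time.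

  Leaves may also carry real numbers, which can be added, subtracted and multiplied. They cannot
  be tested, so control flow does not depend on them. A program has access to real constants
  only through 0, 1 and the given weights. With each real a size is stored, and an arithmetic
  operation costs the sum of the sizes of its operands: if the weights are fixed rationals, then
  a number of size \<open>s\<close> is a fraction whose numerator and denominator have \<open>O(s)\<close> bits. Hence
  polynomial cost means polynomial bit complexity for rational weights, and for all weights
  it bounds the number of arithmetic operations.\<close>

datatype val = Leaf | Node val val | Real nat real

datatype exp =
    EVar nat
  | ELeaf
  | ENode exp exp
  | ELeft exp
  | ERight exp
  | EIf exp exp exp
  | ELet exp exp
  | ECall nat "exp list"
  | EZero
  | EOne
  | EWeight nat
  | EWeight_bar nat
  | EAdd exp exp
  | ESub exp exp
  | EMul exp exp

type_synonym program = "exp list"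

text \<open>\<open>eval prg w wbar env e v t\<close>: in environment \<open>env\<close>, the expression \<open>e\<close> evaluates to \<open>v\<close> at cost
  \<open>t\<close>. Variables are de Bruijn indices; a called function sees exactly its arguments.\<close>

inductive
  eval :: "program \<Rightarrow> (nat \<Rightarrow> real) \<Rightarrow> (nat \<Rightarrow> real) \<Rightarrow> val list \<Rightarrow> exp \<Rightarrow> val \<Rightarrow> nat \<Rightarrow> bool" and
  evals :: "program \<Rightarrow> (nat \<Rightarrow> real) \<Rightarrow> (nat \<Rightarrow> real) \<Rightarrow> val list \<Rightarrow> exp list \<Rightarrow> val list \<Rightarrow> nat \<Rightarrow> bool"
  for prg w wbar
where
  eval_Var: "i < length env \<Longrightarrow> eval prg w wbar env (EVar i) (env ! i) 1"
| eval_Leaf: "eval prg w wbar env ELeaf Leaf 1"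
| eval_Node: "eval prg w wbar env e1 v1 t1 \<Longrightarrow> eval prg w wbar env e2 v2 t2 \<Longrightarrow>
    eval prg w wbar env (ENode e1 e2) (Node v1 v2) (t1 + t2 + 1)"
| eval_Left: "eval prg w wbar env e (Node v1 v2) t \<Longrightarrow> eval prg w wbar env (ELeft e) v1 (t + 1)"
| eval_Right: "eval prg w wbar env e (Node v1 v2) t \<Longrightarrow> eval prg w wbar env (ERight e) v2 (t + 1)"
| eval_If_Node: "eval prg w wbar env c (Node u1 u2) t1 \<Longrightarrow> eval prg w wbar env e1 v t2 \<Longrightarrow>
    eval prg w wbar env (EIf c e1 e2) v (t1 + t2 + 1)"
| eval_If_Leaf: "eval prg w wbar env c Leaf t1 \<Longrightarrow> eval prg w wbar env e2 v t2 \<Longrightarrow>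
    eval prg w wbar env (EIf c e1 e2) v (t1 + t2 + 1)"
| eval_Let: "eval prg w wbar env e1 v1 t1 \<Longrightarrow> eval prg w wbar (v1 # env) e2 v2 t2 \<Longrightarrow>
    eval prg w wbar env (ELet e1 e2) v2 (t1 + t2 + 1)"
| eval_Call: "f < length prg \<Longrightarrow> evals prg w wbar env es vs t1 \<Longrightarrow>
    eval prg w wbar vs (prg ! f) v t2 \<Longrightarrow> eval prg w wbar env (ECall f es) v (t1 + t2 + 1)"
| eval_Zero: "eval prg w wbar env EZero (Real 1 0) 1"
| eval_One: "eval prg w wbar env EOne (Real 1 1) 1"
| eval_Weight: "eval prg w wbar env (EWeight p) (Real 1 (w p)) 1"
| eval_Weight_bar: "eval prg w wbar env (EWeight_bar p) (Real 1 (wbar p)) 1"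
| eval_Add: "eval prg w wbar env e1 (Real s1 r1) t1 \<Longrightarrow> eval prg w wbar env e2 (Real s2 r2) t2 \<Longrightarrow>
    eval prg w wbar env (EAdd e1 e2) (Real (max s1 s2 + 1) (r1 + r2)) (t1 + t2 + s1 + s2)"
| eval_Sub: "eval prg w wbar env e1 (Real s1 r1) t1 \<Longrightarrow> eval prg w wbar env e2 (Real s2 r2) t2 \<Longrightarrow>
    eval prg w wbar env (ESub e1 e2) (Real (max s1 s2 + 1) (r1 - r2)) (t1 + t2 + s1 + s2)"
| eval_Mul: "eval prg w wbar env e1 (Real s1 r1) t1 \<Longrightarrow> eval prg w wbar env e2 (Real s2 r2) t2 \<Longrightarrow>
    eval prg w wbar env (EMul e1 e2) (Real (s1 + s2) (r1 * r2)) (t1 + t2 + s1 + s2)"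
| evals_Nil: "evals prg w wbar env [] [] 0"
| evals_Cons: "eval prg w wbar env e v t1 \<Longrightarrow> evals prg w wbar env es vs t2 \<Longrightarrow>
    evals prg w wbar env (e # es) (v # vs) (t1 + t2)"

inductive_cases eval_elims:
  "eval prg w wbar env (EVar i) v t"
  "eval prg w wbar env ELeaf v t"
  "eval prg w wbar env (ENode e1 e2) v t"
  "eval prg w wbar env (ELeft e) v t"
  "eval prg w wbar env (ERight e) v t"
  "eval prg w wbar env (EIf c e1 e2) v t"
  "eval prg w wbar env (ELet e1 e2) v t"
  "eval prg w wbar env (ECall f es) v t"
  "eval prg w wbar env EZero v t"
  "eval prg w wbar env EOne v t"
  "eval prg w wbar env (EWeight p) v t"
  "eval prg w wbar env (EWeight_bar p) v t"
  "eval prg w wbar env (EAdd e1 e2) v t"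
  "eval prg w wbar env (ESub e1 e2) v t"
  "eval prg w wbar env (EMul e1 e2) v t"

inductive_cases evals_elims:
  "evals prg w wbar env [] vs t"
  "evals prg w wbar env (e # es) vs t"

lemma eval_deterministic:
  "eval prg w wbar env e v t \<Longrightarrow> \<forall>v' t'. eval prg w wbar env e v' t' \<longrightarrow> v' = v \<and> t' = t"
  "evals prg w wbar env es vs t \<Longrightarrow> \<forall>vs' t'. evals prg w wbar env es vs' t' \<longrightarrow> vs' = vs \<and> t' = t"
  by (induction rule: eval_evals.inducts)
    (intro allI impI, (erule eval_elims | erule evals_elims);
      metis val.inject val.distinct One_nat_def add_Suc_right add_0_right)+

text \<open>Function 0 is the entry point.\<close>

definition outputs_in_time ::
    "program \<Rightarrow> (nat \<Rightarrow> real) \<Rightarrow> (nat \<Rightarrow> real) \<Rightarrow> val \<Rightarrow> real \<Rightarrow> nat \<Rightarrow> bool" where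
  "outputs_in_time prg w wbar inp r b \<longleftrightarrow>
     (\<exists>s t. eval prg w wbar [inp] (ECall 0 [EVar 0]) (Real s r) t \<and> t \<le> b)"

fun enc_nat :: "nat \<Rightarrow> val" where
  "enc_nat 0 = Leaf"
| "enc_nat (Suc n) = Node Leaf (enc_nat n)"

fun enc_bool :: "bool \<Rightarrow> val" where
  "enc_bool False = Leaf"
| "enc_bool True = Node Leaf Leaf"

fun enc_list :: "('a \<Rightarrow> val) \<Rightarrow> 'a list \<Rightarrow> val" where
  "enc_list enc [] = Leaf"
| "enc_list enc (x # xs) = Node (enc x) (enc_list enc xs)"

fun enc_pair :: "('a \<Rightarrow> val) \<Rightarrow> ('b \<Rightarrow> val) \<Rightarrow> 'a \<times> 'b \<Rightarrow> val" where
  "enc_pair enc1 enc2 (x, y) = Node (enc1 x) (enc2 y)"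

abbreviation enc_gatom :: "nat gatom \<Rightarrow> val" where
  "enc_gatom \<equiv> enc_pair enc_nat (enc_list enc_nat)"

text \<open>A set is presented to a program as any duplicate-free list of its elements.\<close>

definition encodes_set :: "('a \<Rightarrow> val) \<Rightarrow> val \<Rightarrow> 'a set \<Rightarrow> bool" where
  "encodes_set enc v A \<longleftrightarrow> (\<exists>xs. distinct xs \<and> set xs = A \<and> v = enc_list enc xs)"

inductive encodes_evidence :: "val \<Rightarrow> nat evidence \<Rightarrow> bool" where
  "encodes_set (enc_pair enc_bool enc_gatom) v L \<Longrightarrow>
    encodes_evidence (Node (enc_bool True) v) (Open_World L)"
| "encodes_set enc_nat v1 P \<Longrightarrow> encodes_set enc_gatom v2 A \<Longrightarrow>
    encodes_evidence (Node (enc_bool False) (Node v1 v2)) (Closed_World P A)"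

inductive encodes_input :: "val \<Rightarrow> nat \<Rightarrow> nat evidence \<times> nat evidence \<Rightarrow> bool" where
  "encodes_evidence v1 U \<Longrightarrow> encodes_evidence v2 B \<Longrightarrow>
    encodes_input (Node (enc_nat n) (Node v1 v2)) n (U, B)"


section \<open>Domain-liftability\<close>

text \<open>The domain of size \<open>n\<close> is \<open>{..<n}\<close>. A class of evidence gives the admissible pairs of unary
  and binary evidence for each vocabulary and domain size.\<close>

type_synonym evidence_class = "vocab \<Rightarrow> nat \<Rightarrow> (nat evidence \<times> nat evidence) set"

definition domain_liftable :: "fm set \<Rightarrow> evidence_class \<Rightarrow> bool" where
  "domain_liftable Frag C \<longleftrightarrow>
     (\<forall>V f w wbar. f \<in> Frag \<and> wf_fm V f \<longrightarrow>
       (\<exists>(prg :: program) (q :: nat poly). \<forall>n. \<forall>E\<in>C V n. \<forall>inp.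
          encodes_input inp n E \<longrightarrow>
          outputs_in_time prg w wbar inp (wfomc V {..<n} w wbar f E) (poly q n)))"

definition bounded_treewidth_evidence :: "nat \<Rightarrow> evidence_class" where
  "bounded_treewidth_evidence k V n =
     {(U, B). unary_evidence V {..<n} U \<and> binary_evidence V {..<n} B
        \<and> treewidth {..<n} (gaifman_edges B) \<le> k}"

end

theory Submission
  imports Defs
begin

text \<open>
  Fix the truth values of the nullary atoms and assign to every element its type, the set of atoms
  that hold of it alone. For a given type assignment the weight is a product of factors of single
  elements and of pairs, because the atoms on two given elements can be summed out; atoms on
  three or more elements are unconstrained and contribute \<open>w + wbar\<close> each. A pair that is not joined
  by the evidence has a factor that depends only on its two types. Hence two parts of the domain
  without edges between them interact only through the multisets of their types, and it suffices
  to compute, for each part, a table that maps every multiset of types (polynomially many) to the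
  total weight of the assignments that realise it.

  Bounded treewidth provides every set of \<open>c\<close> elements with a separator of at most \<open>k + 1\<close> elements
  that leaves components of size at most \<open>c / 2\<close>. The program finds one by trying all tuples, so
  it never needs a tree decomposition. It branches over the types of the separator and recurses
  into the components. Halving the size makes this recursion polynomial, although each level
  multiplies the number of calls by a constant.
\<close>

section \<open>The program\<close>

text \<open>Correctness of a table is stated by testing it with every function \<open>h\<close> on
  multisets of types (\<open>good\<close>). Merging tables, adding an element and collecting equal
  keys then become identities between sums, and no single entry is ever described. A table also
  carries the factors between its part and the separator elements typed so far, the context
  \<open>\<sigma>\<close>; combining two tables then only has to supply default factors.

  Besides the number of steps, the sizes of the reals must stay polynomial, since arithmetic is
  charged by size. An addition adds one to a size and a multiplication adds two sizes up, so sizes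
  are budgeted per element: each domain element is worth \<open>2 * G\<close>, one \<open>G\<close>
  for branching over its type and one for combining the table of the part that it separates with the
  tables of the sibling parts. That is why every separator tuple has to meet its part.

  The sentence is compiled into lists of literal sets with their weights. Evidence enters only when
  a factor is evaluated, by discarding the literal sets that it contradicts; so one program serves
  all evidence.\<close>

fun pure :: "val \<Rightarrow> bool" where
  "pure Leaf = True"
| "pure (Node u v) = (pure u \<and> pure v)"
| "pure (Real s r) = False"

fun vsize :: "val \<Rightarrow> nat" where
  "vsize (Node u v) = vsize u + vsize v + 1"
| "vsize _ = 1"

text \<open>The program compares keys and atoms structurally. Injectivity makes that comparison
  correct, and the absence of real leaves keeps it from getting stuck, since a conditional on a real
  leaf has no value.\<close>

definition faithful :: "('a \<Rightarrow> val) \<Rightarrow> bool" where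
  "faithful enc \<longleftrightarrow> inj enc \<and> (\<forall>x. pure (enc x))"

lemma faithfulD: "faithful enc \<Longrightarrow> enc x = enc y \<longleftrightarrow> x = y" "faithful enc \<Longrightarrow> pure (enc x)"
  by (auto simp: faithful_def inj_def)

lemma faithful_enc [simp, intro]:
  "faithful enc_nat" "faithful enc_bool"
  "faithful enc \<Longrightarrow> faithful (enc_list enc)"
  "faithful enc \<Longrightarrow> faithful enc' \<Longrightarrow> faithful (enc_pair enc enc')"
proof -
  have "enc_nat x = enc_nat y \<Longrightarrow> x = y" for x y
    by (induction x arbitrary: y; case_tac y; simp)
  moreover have "pure (enc_nat x)" for x by (induction x) auto
  ultimately show "faithful enc_nat" by (auto simp: faithful_def inj_def)
  show "faithful enc_bool"
  proof -
    have "enc_bool x = enc_bool y \<Longrightarrow> x = y" "pure (enc_bool x)" for x y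
      by (cases x; cases y; simp)+
    then show ?thesis by (auto simp: faithful_def inj_def)
  qed
  show "faithful (enc_list enc)" if *: "faithful enc"
  proof -
    have "enc_list enc x = enc_list enc y \<Longrightarrow> x = y" for x y
      by (induction x arbitrary: y; case_tac y; simp add: faithfulD[OF *])
    moreover have "pure (enc_list enc x)" for x by (induction x) (auto simp: faithfulD[OF *])
    ultimately show ?thesis by (auto simp: faithful_def inj_def)
  qed
  show "faithful (enc_pair enc enc')" if "faithful enc" "faithful enc'"
    using that by (auto simp: faithful_def inj_def)
qed

lemma vsize_enc_nat [simp]: "vsize (enc_nat i) = 2 * i + 1"
  by (induction i) auto
lemma vsize_enc_bool: "vsize (enc_bool b) \<le> 3"
  by (cases b) auto
lemma vsize_enc_list: "(\<And>x. x \<in> set xs \<Longrightarrow> vsize (enc x) \<le> K) \<Longrightarrow> vsize (enc_list enc xs) \<le> length xs * (K + 1) + 1"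
proof (induction xs)
  case (Cons x xs)
  have "vsize (enc x) \<le> K" "vsize (enc_list enc xs) \<le> length xs * (K + 1) + 1"
    using Cons by simp_all
  then show ?case by simp
qed auto

abbreviation (input) "ETrue \<equiv> ENode ELeaf ELeaf"
abbreviation (input) "ENot e \<equiv> EIf e ELeaf ETrue"

text \<open>
  The recursion passes around one value that holds the lists of unary and binary factors, the unary
  and binary evidence, the argument lists of the evidence atoms (as hyperedges), the domain size,
  the list of types and the separator size. The following projections read its components.
\<close>

abbreviation (input) "c_UL e \<equiv> ELeft e"
abbreviation (input) "c_BL e \<equiv> ELeft (ERight e)"
abbreviation (input) "c_U e \<equiv> ELeft (ERight (ERight e))"
abbreviation (input) "c_B e \<equiv> ELeft (ERight (ERight (ERight e)))"
abbreviation (input) "c_edges e \<equiv> ELeft (ERight (ERight (ERight (ERight e))))"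
abbreviation (input) "c_n e \<equiv> ELeft (ERight (ERight (ERight (ERight (ERight e)))))"
abbreviation (input) "c_types e \<equiv> ELeft (ERight (ERight (ERight (ERight (ERight (ERight e))))))"
abbreviation (input) "c_width e \<equiv> ERight (ERight (ERight (ERight (ERight (ERight (ERight e))))))"

text \<open>Function 0 is the only one that depends on the sentence.\<close>

abbreviation (input) "f_eq \<equiv> 1::nat"
abbreviation (input) "f_mem \<equiv> 2::nat"
abbreviation (input) "f_leq \<equiv> 3::nat"
abbreviation (input) "f_app \<equiv> 4::nat"
abbreviation (input) "f_inst \<equiv> 5::nat"
abbreviation (input) "f_ok \<equiv> 6::nat"
abbreviation (input) "f_check \<equiv> 7::nat"
abbreviation (input) "f_factor \<equiv> 8::nat"
abbreviation (input) "f_insort \<equiv> 9::nat"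
abbreviation (input) "f_merge \<equiv> 10::nat"
abbreviation (input) "f_add_entry \<equiv> 11::nat"
abbreviation (input) "f_cross1 \<equiv> 12::nat"
abbreviation (input) "f_cross \<equiv> 13::nat"
abbreviation (input) "f_comb1 \<equiv> 14::nat"
abbreviation (input) "f_comb \<equiv> 15::nat"
abbreviation (input) "f_link \<equiv> 16::nat"
abbreviation (input) "f_shift \<equiv> 17::nat"
abbreviation (input) "f_branch \<equiv> 18::nat"
abbreviation (input) "f_assign \<equiv> 19::nat"
abbreviation (input) "f_solve \<equiv> 20::nat"
abbreviation (input) "f_solve_all \<equiv> 21::nat"
abbreviation (input) "f_remove \<equiv> 22::nat"
abbreviation (input) "f_diff \<equiv> 23::nat"
abbreviation (input) "f_adj \<equiv> 24::nat"
abbreviation (input) "f_touches \<equiv> 25::nat"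
abbreviation (input) "f_gather \<equiv> 26::nat"
abbreviation (input) "f_rest \<equiv> 27::nat"
abbreviation (input) "f_parts \<equiv> 28::nat"
abbreviation (input) "f_cons_all \<equiv> 29::nat"
abbreviation (input) "f_outer \<equiv> 30::nat"
abbreviation (input) "f_tuples \<equiv> 31::nat"
abbreviation (input) "f_balanced \<equiv> 32::nat"
abbreviation (input) "f_find_separator \<equiv> 33::nat"
abbreviation (input) "f_range \<equiv> 34::nat"
abbreviation (input) "f_edges_open \<equiv> 35::nat"
abbreviation (input) "f_edges_closed \<equiv> 36::nat"
abbreviation (input) "f_sum_table \<equiv> 37::nat"
abbreviation (input) "f_sum_zero \<equiv> 38::nat"
abbreviation (input) "f_dedup \<equiv> 39::nat"
abbreviation (input) "f_power3 \<equiv> 40::nat"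
abbreviation (input) "f_prod3 \<equiv> 41::nat"

section \<open>Bodies of the library functions\<close>

definition body_eq :: exp where
  "body_eq =
   EIf (EVar 0)
     (EIf (EVar 1)
       (EIf (ECall f_eq [ELeft (EVar 0), ELeft (EVar 1)]) (ECall f_eq [ERight (EVar 0), ERight (EVar 1)]) ELeaf)
       ELeaf)
     (EIf (EVar 1) ELeaf ETrue)"

definition body_mem :: exp where
  "body_mem =
   EIf (EVar 1)
     (EIf (ECall f_eq [EVar 0, ELeft (EVar 1)]) ETrue (ECall f_mem [EVar 0, ERight (EVar 1)]))
     ELeaf"

text \<open>Only right spines are compared, so the same function serves for unary numbers, for
  lengths of lists, and for a number against a length.\<close>

definition body_leq :: exp where
  "body_leq =
   EIf (EVar 0) (EIf (EVar 1) (ECall f_leq [ERight (EVar 0), ERight (EVar 1)]) ELeaf) ETrue"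

definition body_app :: exp where
  "body_app =
   EIf (EVar 0) (ENode (ELeft (EVar 0)) (ECall f_app [ERight (EVar 0), EVar 1])) (EVar 1)"

definition body_inst :: exp where
  "body_inst =
   EIf (EVar 0)
     (ENode (EIf (ELeft (EVar 0)) (EVar 2) (EVar 1)) (ECall f_inst [ERight (EVar 0), EVar 1, EVar 2]))
     ELeaf"

definition body_ok :: exp where
  "body_ok =
   EIf (ELeft (EVar 0))
     (EIf (ECall f_mem [ENode (ENot (EVar 1)) (EVar 2), ERight (EVar 0)]) ELeaf ETrue)
     (EIf (ECall f_mem [ELeft (EVar 2), ELeft (ERight (EVar 0))])
       (EIf (ECall f_mem [EVar 2, ERight (ERight (EVar 0))]) (EVar 1) (ENot (EVar 1)))
       ETrue)"

definition body_check :: exp where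
  "body_check =
   EIf (EVar 0)
     (EIf (ECall f_ok [EVar 3, ELeft (ELeft (EVar 0)), ENode (ELeft (ERight (ELeft (EVar 0))))
          (ECall f_inst [ERight (ERight (ELeft (EVar 0))), EVar 1, EVar 2])])
       (ECall f_check [ERight (EVar 0), EVar 1, EVar 2, EVar 3])
       ELeaf)
     ETrue"

definition body_factor :: exp where
  "body_factor =
   EIf (EVar 0)
     (EIf (ECall f_eq [EVar 1, ELeft (ELeft (EVar 0))])
       (EIf (ECall f_check [ELeft (ERight (ELeft (EVar 0))), EVar 2, EVar 3, EVar 4])
         (EAdd (ERight (ERight (ELeft (EVar 0)))) (ECall f_factor [ERight (EVar 0), EVar 1, EVar 2, EVar 3, EVar 4]))
         (ECall f_factor [ERight (EVar 0), EVar 1, EVar 2, EVar 3, EVar 4]))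
       (ECall f_factor [ERight (EVar 0), EVar 1, EVar 2, EVar 3, EVar 4]))
     EZero"

definition body_insort :: exp where
  "body_insort =
   EIf (EVar 1)
     (EIf (ECall f_leq [EVar 0, ELeft (EVar 1)])
       (ENode (EVar 0) (EVar 1))
       (ENode (ELeft (EVar 1)) (ECall f_insort [EVar 0, ERight (EVar 1)])))
     (ENode (EVar 0) ELeaf)"

definition body_merge :: exp where
  "body_merge =
   EIf (EVar 0) (ECall f_insort [ELeft (EVar 0), ECall f_merge [ERight (EVar 0), EVar 1]]) (EVar 1)"

definition body_add_entry :: exp where
  "body_add_entry =
   EIf (EVar 2)
     (EIf (ECall f_eq [EVar 0, ELeft (ELeft (EVar 2))])
       (ENode (ENode (EVar 0) (EAdd (EVar 1) (ERight (ELeft (EVar 2))))) (ERight (EVar 2)))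
       (ENode (ELeft (EVar 2)) (ECall f_add_entry [EVar 0, EVar 1, ERight (EVar 2)])))
     (ENode (ENode (EVar 0) (EVar 1)) ELeaf)"

definition body_cross1 :: exp where
  "body_cross1 =
   EIf (EVar 1)
     (EMul (ECall f_factor [c_BL (EVar 2), ENode (EVar 0) (ELeft (EVar 1)), c_n (EVar 2), ENode ELeaf (c_n (EVar 2)), c_B (EVar 2)])
       (ECall f_cross1 [EVar 0, ERight (EVar 1), EVar 2]))
     EOne"

definition body_cross :: exp where
  "body_cross =
   EIf (EVar 0)
     (EMul (ECall f_cross1 [ELeft (EVar 0), EVar 1, EVar 2]) (ECall f_cross [ERight (EVar 0), EVar 1, EVar 2]))
     EOne"

definition body_comb1 :: exp where
  "body_comb1 =
   EIf (EVar 2)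
     (ECall f_add_entry [ECall f_merge [EVar 0, ELeft (ELeft (EVar 2))],
        EMul (EMul (EVar 1) (ERight (ELeft (EVar 2)))) (ECall f_cross [EVar 0, ELeft (ELeft (EVar 2)), EVar 4]),
        ECall f_comb1 [EVar 0, EVar 1, ERight (EVar 2), EVar 3, EVar 4]])
     (EVar 3)"

definition body_comb :: exp where
  "body_comb =
   EIf (EVar 0)
     (ECall f_comb1 [ELeft (ELeft (EVar 0)), ERight (ELeft (EVar 0)), EVar 1,
        ECall f_comb [ERight (EVar 0), EVar 1, EVar 2], EVar 2])
     ELeaf"

definition body_link :: exp where
  "body_link =
   EIf (EVar 2)
     (EMul (ECall f_factor [c_BL (EVar 3), ENode (EVar 1) (ERight (ELeft (EVar 2))), EVar 0, ELeft (ELeft (EVar 2)), c_B (EVar 3)])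
       (ECall f_link [EVar 0, EVar 1, ERight (EVar 2), EVar 3]))
     (ECall f_factor [c_UL (EVar 3), EVar 1, EVar 0, EVar 0, c_U (EVar 3)])"

definition body_shift :: exp where
  "body_shift =
   EIf (EVar 2)
     (ECall f_add_entry [ECall f_insort [EVar 0, ELeft (ELeft (EVar 2))],
        EMul (EVar 1) (ERight (ELeft (EVar 2))),
        ECall f_shift [EVar 0, EVar 1, ERight (EVar 2), EVar 3]])
     (EVar 3)"

definition body_branch :: exp where
  "body_branch =
   EIf (EVar 0)
     (ECall f_shift [ELeft (EVar 0), ECall f_link [EVar 1, ELeft (EVar 0), EVar 4, EVar 5],
        ECall f_assign [EVar 2, EVar 3, ENode (ENode (EVar 1) (ELeft (EVar 0))) (EVar 4), EVar 5],
        ECall f_branch [ERight (EVar 0), EVar 1, EVar 2, EVar 3, EVar 4, EVar 5]])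
     ELeaf"

text \<open>The separator is a tuple that may repeat elements; an entry that is typed already is
  skipped without branching. Once the tuple is used up, the components are computed from the
  elements still untyped.\<close>

definition body_assign :: exp where
  "body_assign =
   EIf (EVar 0)
     (EIf (ECall f_mem [ELeft (EVar 0), EVar 1])
       (ECall f_branch [c_types (EVar 3), ELeft (EVar 0), ERight (EVar 0), ECall f_remove [ELeft (EVar 0), EVar 1], EVar 2, EVar 3])
       (ECall f_assign [ERight (EVar 0), EVar 1, EVar 2, EVar 3]))
     (ECall f_solve_all [ECall f_parts [EVar 1, c_edges (EVar 3)], EVar 2, EVar 3])"

definition body_solve :: exp where
  "body_solve =
   EIf (EVar 0)
     (ECall f_assign [ECall f_find_separator [ECall f_tuples [c_width (EVar 2), EVar 0], EVar 0, c_edges (EVar 2)], EVar 0, EVar 1, EVar 2])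
     (ENode (ENode ELeaf EOne) ELeaf)"

definition body_solve_all :: exp where
  "body_solve_all =
   EIf (EVar 0)
     (ECall f_comb [ECall f_solve [ELeft (EVar 0), EVar 1, EVar 2], ECall f_solve_all [ERight (EVar 0), EVar 1, EVar 2], EVar 2])
     (ENode (ENode ELeaf EOne) ELeaf)"

definition body_remove :: exp where
  "body_remove =
   EIf (EVar 1)
     (EIf (ECall f_eq [EVar 0, ELeft (EVar 1)])
       (ECall f_remove [EVar 0, ERight (EVar 1)])
       (ENode (ELeft (EVar 1)) (ECall f_remove [EVar 0, ERight (EVar 1)])))
     ELeaf"

definition body_diff :: exp where
  "body_diff =
   EIf (EVar 0) (ECall f_remove [ELeft (EVar 0), ECall f_diff [ERight (EVar 0), EVar 1]]) (EVar 1)"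

definition body_adj :: exp where
  "body_adj =
   EIf (EVar 2)
     (EIf (ECall f_mem [EVar 0, ELeft (EVar 2)])
       (EIf (ECall f_mem [EVar 1, ELeft (EVar 2)]) ETrue (ECall f_adj [EVar 0, EVar 1, ERight (EVar 2)]))
       (ECall f_adj [EVar 0, EVar 1, ERight (EVar 2)]))
     ELeaf"

definition body_touches :: exp where
  "body_touches =
   EIf (EVar 1)
     (EIf (ECall f_adj [EVar 0, ELeft (EVar 1), EVar 2]) ETrue (ECall f_touches [EVar 0, ERight (EVar 1), EVar 2]))
     ELeaf"

definition body_gather :: exp where
  "body_gather =
   EIf (EVar 1)
     (EIf (ECall f_touches [EVar 0, ELeft (EVar 1), EVar 2])
       (ECall f_app [ELeft (EVar 1), ECall f_gather [EVar 0, ERight (EVar 1), EVar 2]])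
       (ECall f_gather [EVar 0, ERight (EVar 1), EVar 2]))
     (ENode (EVar 0) ELeaf)"

definition body_rest :: exp where
  "body_rest =
   EIf (EVar 1)
     (EIf (ECall f_touches [EVar 0, ELeft (EVar 1), EVar 2])
       (ECall f_rest [EVar 0, ERight (EVar 1), EVar 2])
       (ENode (ELeft (EVar 1)) (ECall f_rest [EVar 0, ERight (EVar 1), EVar 2])))
     ELeaf"

definition body_parts :: exp where
  "body_parts =
   EIf (EVar 0)
     (ELet (ECall f_parts [ERight (EVar 0), EVar 1])
       (ENode (ECall f_gather [ELeft (EVar 1), EVar 0, EVar 2]) (ECall f_rest [ELeft (EVar 1), EVar 0, EVar 2])))
     ELeaf"

definition body_cons_all :: exp where
  "body_cons_all =
   EIf (EVar 1)
     (ENode (ENode (EVar 0) (ELeft (EVar 1))) (ECall f_cons_all [EVar 0, ERight (EVar 1), EVar 2]))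
     (EVar 2)"

definition body_outer :: exp where
  "body_outer =
   EIf (EVar 0) (ECall f_cons_all [ELeft (EVar 0), EVar 1, ECall f_outer [ERight (EVar 0), EVar 1]]) ELeaf"

definition body_tuples :: exp where
  "body_tuples =
   EIf (EVar 0) (ECall f_outer [EVar 1, ECall f_tuples [ERight (EVar 0), EVar 1]]) (ENode ELeaf ELeaf)"

definition body_balanced :: exp where
  "body_balanced =
   EIf (EVar 0)
     (EIf (ECall f_leq [ECall f_app [ELeft (EVar 0), ELeft (EVar 0)], EVar 1])
       (ECall f_balanced [ERight (EVar 0), EVar 1])
       ELeaf)
     ETrue"

definition body_find_separator :: exp where
  "body_find_separator =
   EIf (EVar 0)
     (EIf (ECall f_balanced [ECall f_parts [ECall f_diff [ELeft (EVar 0), EVar 1], EVar 2], EVar 1])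
       (ELeft (EVar 0))
       (ECall f_find_separator [ERight (EVar 0), EVar 1, EVar 2]))
     ELeaf"

definition body_range :: exp where
  "body_range =
   EIf (EVar 0) (ENode (ERight (EVar 0)) (ECall f_range [ERight (EVar 0)])) ELeaf"

definition body_edges_open :: exp where
  "body_edges_open =
   EIf (EVar 0) (ENode (ERight (ERight (ELeft (EVar 0)))) (ECall f_edges_open [ERight (EVar 0)])) ELeaf"

definition body_edges_closed :: exp where
  "body_edges_closed =
   EIf (EVar 0) (ENode (ERight (ELeft (EVar 0))) (ECall f_edges_closed [ERight (EVar 0)])) ELeaf"

definition body_sum_table :: exp where
  "body_sum_table =
   EIf (EVar 0) (EAdd (ERight (ELeft (EVar 0))) (ECall f_sum_table [ERight (EVar 0)])) EZero"

text \<open>One run of the recursion for each set of true nullary atoms. The two factor lists of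
  that set are put in front of the part of the context that all runs share.\<close>

definition body_sum_zero :: exp where
  "body_sum_zero =
   EIf (EVar 0)
     (EAdd
       (EMul (ELeft (ELeft (EVar 0)))
         (ECall f_sum_table [ECall f_solve [EVar 2, ELeaf,
            ENode (ELeft (ERight (ELeft (EVar 0)))) (ENode (ERight (ERight (ELeft (EVar 0)))) (EVar 1))]]))
       (ECall f_sum_zero [ERight (EVar 0), EVar 1, EVar 2]))
     EZero"

definition body_dedup :: exp where
  "body_dedup =
   EIf (EVar 0)
     (EIf (ECall f_mem [ELeft (EVar 0), ERight (EVar 0)])
       (ECall f_dedup [ERight (EVar 0)])
       (ENode (ELeft (EVar 0)) (ECall f_dedup [ERight (EVar 0)])))
     ELeaf"

text \<open>One multiplication for each argument tuple with at least three distinct entries, so the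
  exponent itself is never computed. The tuples are polynomially many because arities are
  fixed.\<close>

definition body_power3 :: exp where
  "body_power3 =
   EIf (EVar 0)
     (EIf (ECall f_leq [ENode ELeaf (ENode ELeaf (ENode ELeaf ELeaf)), ECall f_dedup [ELeft (EVar 0)]])
       (EMul (EVar 1) (ECall f_power3 [ERight (EVar 0), EVar 1]))
       (ECall f_power3 [ERight (EVar 0), EVar 1]))
     EOne"

definition body_prod3 :: exp where
  "body_prod3 =
   EIf (EVar 0)
     (EMul (ECall f_power3 [ECall f_tuples [ELeft (ELeft (EVar 0)), EVar 1], ERight (ELeft (EVar 0))])
       (ECall f_prod3 [ERight (EVar 0), EVar 1]))
     EOne"

definition lib :: "exp list" where
  "lib = [
    body_eq, body_mem, body_leq, body_app, body_inst, body_ok, body_check, body_factor,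
    body_insort, body_merge, body_add_entry, body_cross1, body_cross, body_comb1, body_comb,
    body_link, body_shift, body_branch, body_assign, body_solve, body_solve_all, body_remove,
    body_diff, body_adj, body_touches, body_gather, body_rest, body_parts, body_cons_all,
    body_outer, body_tuples, body_balanced, body_find_separator, body_range, body_edges_open,
    body_edges_closed, body_sum_table, body_sum_zero, body_dedup, body_power3, body_prod3]"

section \<open>Evidence and factor lists as data\<close>

fun spine :: "val \<Rightarrow> nat" where
  "spine (Node u v) = Suc (spine v)"
| "spine _ = 0"

text \<open>A comparison of lengths tests the tails along a right spine, so the spine must not end
  in a real; what hangs off it is arbitrary.\<close>

fun ends :: "val \<Rightarrow> bool" where
  "ends (Node u v) = ends v"
| "ends Leaf = True"
| "ends (Real _ _) = False"

lemma ends_enc [simp]: "ends (enc_nat i)" "ends (enc_list enc xs)"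
  by (induction i, auto) (induction xs, auto)

lemma spine_enc [simp]: "spine (enc_nat i) = i" "spine (enc_list enc xs) = length xs"
  by (induction i, auto) (induction xs, auto)

definition pick :: "'d \<Rightarrow> 'd \<Rightarrow> bool \<Rightarrow> 'd" where
  "pick u v b = (if b then v else u)"

text \<open>For the running time only the lengths of the lists count, so distinctness is replaced by
  the bound \<open>l\<close>.\<close>

inductive enc_evidence :: "nat \<Rightarrow> val \<Rightarrow> nat evidence \<Rightarrow> bool" for l where
  "length xs \<le> l \<Longrightarrow> enc_evidence l (Node (enc_bool True) (enc_list (enc_pair enc_bool enc_gatom) xs)) (Open_World (set xs))"
| "length xs \<le> l \<Longrightarrow> length ys \<le> l \<Longrightarrow>
   enc_evidence l (Node (enc_bool False) (Node (enc_list enc_nat xs) (enc_list enc_gatom ys))) (Closed_World (set xs) (set ys))"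

text \<open>A literal passes unless the evidence contradicts it. If open-world evidence contradicts
  itself on an atom, both signs fail there, which gives the count 0 as it should.\<close>

fun evidence_ok :: "'d evidence \<Rightarrow> bool \<Rightarrow> 'd gatom \<Rightarrow> bool" where
  "evidence_ok (Open_World L) s \<alpha> \<longleftrightarrow> (\<not> s, \<alpha>) \<notin> L"
| "evidence_ok (Closed_World P A) s \<alpha> \<longleftrightarrow> (fst \<alpha> \<in> P \<longrightarrow> (\<alpha> \<in> A) = s)"

text \<open>Literals over the Booleans are templates: \<open>pick u v\<close> turns them into
  literals about \<open>u\<close> and \<open>v\<close>, with \<open>False\<close> standing for the
  first element.\<close>

type_synonym literal = "bool \<times> bool gatom"

abbreviation enc_literal :: "literal \<Rightarrow> val" where
  "enc_literal \<equiv> enc_pair enc_bool (enc_pair enc_nat (enc_list enc_bool))"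

definition consistent :: "'d evidence \<Rightarrow> 'd \<Rightarrow> 'd \<Rightarrow> literal list \<Rightarrow> bool" where
  "consistent E u v T \<longleftrightarrow> (\<forall>(s, p, bs)\<in>set T. evidence_ok E s (p, map (pick u v) bs))"

text \<open>Arithmetic is charged by the size of its operands, so sizes are tracked next to the values.\<close>

type_synonym sized_real = "nat \<times> real"

fun enc_real :: "sized_real \<Rightarrow> val" where
  "enc_real (s, r) = Real s r"

abbreviation enc_entry :: "('k \<Rightarrow> val) \<Rightarrow> 'k \<times> literal list \<times> sized_real \<Rightarrow> val" where
  "enc_entry enc \<equiv> enc_pair enc (enc_pair (enc_list enc_literal) enc_real)"

text \<open>An entry is one complete description of the atoms at hand, with its weight precomputed.
  The evidence merely selects entries, so the lists do not depend on it.\<close>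

definition factor_value :: "'d evidence \<Rightarrow> ('k \<times> literal list \<times> sized_real) list \<Rightarrow> 'k \<Rightarrow> 'd \<Rightarrow> 'd \<Rightarrow> real" where
  "factor_value E es key u v = (\<Sum>(k, T, x)\<leftarrow>es. if key = k \<and> consistent E u v T then snd x else 0)"

definition "c_mem l K = (l + 1) * (20 * K + 30)" for l K :: nat

definition "c_ok l K = 2 * c_mem l (K + 4) + 60" for l K :: nat

definition "c_factor l K \<rho> j = 20 * K + (K + 1) * (c_ok l K + 20 * K + 80) + 100 + 2 * \<rho> + j" for l K \<rho> j :: nat

declare One_nat_def [simp del]

lemma nth_Cons_1 [simp]: "(x # xs) ! 1 = xs ! 0"
  by (simp add: One_nat_def)

section \<open>Weakest preconditions that track value and cost\<close>

locale machine =
  fixes main :: exp and w wbar :: "nat \<Rightarrow> real"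
begin

definition prg where "prg = main # lib"

text \<open>Evaluation is deterministic, so this existential form is the weakest precondition for
  total correctness: it asserts that a value exists and that \<open>Q\<close> holds of it and of its
  cost.\<close>

definition wp :: "val list \<Rightarrow> exp \<Rightarrow> (val \<Rightarrow> nat \<Rightarrow> bool) \<Rightarrow> bool" where
  "wp env e Q \<longleftrightarrow> (\<exists>v t. eval prg w wbar env e v t \<and> Q v t)"

definition wps :: "val list \<Rightarrow> exp list \<Rightarrow> (val list \<Rightarrow> nat \<Rightarrow> bool) \<Rightarrow> bool" where
  "wps env es Q \<longleftrightarrow> (\<exists>vs t. evals prg w wbar env es vs t \<and> Q vs t)"

definition call :: "nat \<Rightarrow> val list \<Rightarrow> (val \<Rightarrow> nat \<Rightarrow> bool) \<Rightarrow> bool" where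
  "call f vs Q \<longleftrightarrow> f < length prg \<and> wp vs (prg ! f) Q"

definition computes :: "nat \<Rightarrow> val list \<Rightarrow> val \<Rightarrow> nat \<Rightarrow> bool" where
  "computes f vs v b \<longleftrightarrow> call f vs (\<lambda>v' t. v' = v \<and> t \<le> b)"

fun branch_on :: "val \<Rightarrow> bool \<Rightarrow> bool \<Rightarrow> bool" where
  "branch_on (Node _ _) P Q = P"
| "branch_on Leaf P Q = Q"
| "branch_on (Real _ _) P Q = False"

lemma branch_on_bool [simp]: "branch_on (enc_bool b) P Q = (if b then P else Q)"
  by (cases b) auto

fun on_node :: "val \<Rightarrow> (val \<Rightarrow> val \<Rightarrow> bool) \<Rightarrow> bool" where
  "on_node (Node u v) P = P u v"
| "on_node _ P = False"

fun on_reals :: "val \<Rightarrow> val \<Rightarrow> (nat \<Rightarrow> real \<Rightarrow> nat \<Rightarrow> real \<Rightarrow> bool) \<Rightarrow> bool" where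
  "on_reals (Real s r) (Real s' r') P = P s r s' r'"
| "on_reals _ _ P = False"

text \<open>Equivalences, so that simplification executes a body symbolically up to its calls; these
  are discharged by \<open>call_computes\<close> and its variants.\<close>

lemma wp_simps [simp]:
  "wp env (EVar i) Q \<longleftrightarrow> i < length env \<and> Q (env ! i) 1"
  "wp env ELeaf Q \<longleftrightarrow> Q Leaf 1"
  "wp env (ENode e1 e2) Q \<longleftrightarrow> wp env e1 (\<lambda>v1 t1. wp env e2 (\<lambda>v2 t2. Q (Node v1 v2) (t1 + t2 + 1)))"
  "wp env (ELeft e) Q \<longleftrightarrow> wp env e (\<lambda>v t. on_node v (\<lambda>v1 v2. Q v1 (t + 1)))"
  "wp env (ERight e) Q \<longleftrightarrow> wp env e (\<lambda>v t. on_node v (\<lambda>v1 v2. Q v2 (t + 1)))"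
  "wp env (EIf e e1 e2) Q \<longleftrightarrow> wp env e (\<lambda>v t. branch_on v
     (wp env e1 (\<lambda>v' t'. Q v' (t + t' + 1))) (wp env e2 (\<lambda>v' t'. Q v' (t + t' + 1))))"
  "wp env (ELet e1 e2) Q \<longleftrightarrow> wp env e1 (\<lambda>v t. wp (v # env) e2 (\<lambda>v' t'. Q v' (t + t' + 1)))"
  "wp env (ECall f es) Q \<longleftrightarrow> wps env es (\<lambda>vs t. call f vs (\<lambda>v t'. Q v (t + t' + 1)))"
  "wp env EZero Q \<longleftrightarrow> Q (Real 1 0) 1"
  "wp env EOne Q \<longleftrightarrow> Q (Real 1 1) 1"
  "wp env (EWeight p) Q \<longleftrightarrow> Q (Real 1 (w p)) 1"
  "wp env (EWeight_bar p) Q \<longleftrightarrow> Q (Real 1 (wbar p)) 1"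
  "wp env (EAdd e1 e2) Q \<longleftrightarrow> wp env e1 (\<lambda>v1 t1. wp env e2 (\<lambda>v2 t2. on_reals v1 v2
     (\<lambda>s1 r1 s2 r2. Q (Real (max s1 s2 + 1) (r1 + r2)) (t1 + t2 + s1 + s2))))"
  "wp env (EMul e1 e2) Q \<longleftrightarrow> wp env e1 (\<lambda>v1 t1. wp env e2 (\<lambda>v2 t2. on_reals v1 v2
     (\<lambda>s1 r1 s2 r2. Q (Real (s1 + s2) (r1 * r2)) (t1 + t2 + s1 + s2))))"
  "wps env [] R \<longleftrightarrow> R [] 0"
  "wps env (e # es) R \<longleftrightarrow> wp env e (\<lambda>v t. wps env es (\<lambda>vs t'. R (v # vs) (t + t')))"
proof -
  note d = wp_def wps_def call_def One_nat_def add_Suc_right add_0_right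
  note i = eval_evals.intros[unfolded One_nat_def add_Suc_right add_0_right]
  show "wp env (EVar i) Q \<longleftrightarrow> i < length env \<and> Q (env ! i) 1"
   "wp env ELeaf Q \<longleftrightarrow> Q Leaf 1"
   "wp env EZero Q \<longleftrightarrow> Q (Real 1 0) 1"
   "wp env EOne Q \<longleftrightarrow> Q (Real 1 1) 1"
   "wp env (EWeight p) Q \<longleftrightarrow> Q (Real 1 (w p)) 1"
   "wp env (EWeight_bar p) Q \<longleftrightarrow> Q (Real 1 (wbar p)) 1"
   "wps env [] R \<longleftrightarrow> R [] 0"
    unfolding d
    by (blast intro: i elim: eval_elims evals_elims)+
  show "wp env (ENode e1 e2) Q \<longleftrightarrow> wp env e1 (\<lambda>v1 t1. wp env e2 (\<lambda>v2 t2. Q (Node v1 v2) (t1 + t2 + 1)))"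
   "wp env (ELet e1 e2) Q \<longleftrightarrow> wp env e1 (\<lambda>v t. wp (v # env) e2 (\<lambda>v' t'. Q v' (t + t' + 1)))"
   "wps env (e # es) R \<longleftrightarrow> wp env e (\<lambda>v t. wps env es (\<lambda>vs t'. R (v # vs) (t + t')))"
    unfolding d by (blast intro: i elim: eval_elims evals_elims)+
  show "wp env (ECall f es) Q \<longleftrightarrow> wps env es (\<lambda>vs t. call f vs (\<lambda>v t'. Q v (t + t' + 1)))"
    unfolding d by (blast intro: i elim: eval_elims evals_elims)+
  have n: "on_node v P \<longleftrightarrow> (\<exists>a b. v = Node a b \<and> P a b)" for v P by (cases v) auto
  show "wp env (ELeft e) Q \<longleftrightarrow> wp env e (\<lambda>v t. on_node v (\<lambda>v1 v2. Q v1 (t + 1)))"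
    "wp env (ERight e) Q \<longleftrightarrow> wp env e (\<lambda>v t. on_node v (\<lambda>v1 v2. Q v2 (t + 1)))"
    unfolding d n by (blast intro: i elim: eval_elims evals_elims)+
  have b: "branch_on v P R \<longleftrightarrow> (\<exists>a b. v = Node a b) \<and> P \<or> v = Leaf \<and> R" for v P R
    by (cases v) auto
  show "wp env (EIf e e1 e2) Q \<longleftrightarrow> wp env e (\<lambda>v t. branch_on v
     (wp env e1 (\<lambda>v' t'. Q v' (t + t' + 1))) (wp env e2 (\<lambda>v' t'. Q v' (t + t' + 1))))"
    unfolding d b by (blast intro: i elim: eval_elims)+
  have r: "on_reals v v' P \<longleftrightarrow> (\<exists>s r s' r'. v = Real s r \<and> v' = Real s' r' \<and> P s r s' r')" for v v' P
    by (cases v; cases v') auto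
  show  "wp env (EAdd e1 e2) Q \<longleftrightarrow> wp env e1 (\<lambda>v1 t1. wp env e2 (\<lambda>v2 t2. on_reals v1 v2
     (\<lambda>s1 r1 s2 r2. Q (Real (max s1 s2 + 1) (r1 + r2)) (t1 + t2 + s1 + s2))))"
   "wp env (EMul e1 e2) Q \<longleftrightarrow> wp env e1 (\<lambda>v1 t1. wp env e2 (\<lambda>v2 t2. on_reals v1 v2
     (\<lambda>s1 r1 s2 r2. Q (Real (s1 + s2) (r1 * r2)) (t1 + t2 + s1 + s2))))"
    unfolding d r by (blast intro: i elim: eval_elims)+
qed

text \<open>How many summands survive the evidence, and with it the size of the result, is not known
  in advance. Hence the size is bounded and not fixed, while the real number is exact.\<close>

definition computes_real :: "nat \<Rightarrow> val list \<Rightarrow> real \<Rightarrow> nat \<Rightarrow> nat \<Rightarrow> bool" where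
  "computes_real f vs r s b \<longleftrightarrow> call f vs (\<lambda>v t. \<exists>s'\<le>s. v = Real s' r \<and> t \<le> b)"

lemma call_mono: "call f vs P \<Longrightarrow> (\<And>v t. P v t \<Longrightarrow> Q v t) \<Longrightarrow> call f vs Q"
  unfolding call_def wp_def by blast

lemma call_computes: "computes f vs v b \<Longrightarrow> (\<And>t. t \<le> b \<Longrightarrow> Q v t) \<Longrightarrow> call f vs Q"
  unfolding computes_def by (erule call_mono) auto

lemma call_computes_eq:
  "computes f vs' v b \<Longrightarrow> vs = vs' \<Longrightarrow> (\<And>t. t \<le> b \<Longrightarrow> Q v t) \<Longrightarrow> call f vs Q"
  by (simp add: call_computes)

lemma computes_mono: "computes f vs v b \<Longrightarrow> b \<le> b' \<Longrightarrow> computes f vs v b'"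
  unfolding computes_def by (erule call_mono) auto

lemma call_computes_real:
  "computes_real f vs r s b \<Longrightarrow> (\<And>s' t. s' \<le> s \<Longrightarrow> t \<le> b \<Longrightarrow> Q (Real s' r) t) \<Longrightarrow> call f vs Q"
  unfolding computes_real_def by (erule call_mono) auto

lemma call_computes_real_eq:
  "computes_real f vs' r s b \<Longrightarrow> vs = vs' \<Longrightarrow> (\<And>s' t. s' \<le> s \<Longrightarrow> t \<le> b \<Longrightarrow> Q (Real s' r) t) \<Longrightarrow> call f vs Q"
  by (simp add: call_computes_real)

lemma computes_real_mono:
  "computes_real f vs r s b \<Longrightarrow> s \<le> s' \<Longrightarrow> b \<le> b' \<Longrightarrow> computes_real f vs r s' b'"
  unfolding computes_real_def by (erule call_mono) auto

lemma call_fun: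
  "call f_eq vs Q \<longleftrightarrow> wp vs body_eq Q"
  "call f_mem vs Q \<longleftrightarrow> wp vs body_mem Q"
  "call f_leq vs Q \<longleftrightarrow> wp vs body_leq Q"
  "call f_app vs Q \<longleftrightarrow> wp vs body_app Q"
  "call f_inst vs Q \<longleftrightarrow> wp vs body_inst Q"
  "call f_ok vs Q \<longleftrightarrow> wp vs body_ok Q"
  "call f_check vs Q \<longleftrightarrow> wp vs body_check Q"
  "call f_factor vs Q \<longleftrightarrow> wp vs body_factor Q"
  "call f_insort vs Q \<longleftrightarrow> wp vs body_insort Q"
  "call f_merge vs Q \<longleftrightarrow> wp vs body_merge Q"
  "call f_add_entry vs Q \<longleftrightarrow> wp vs body_add_entry Q"
  "call f_cross1 vs Q \<longleftrightarrow> wp vs body_cross1 Q"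
  "call f_cross vs Q \<longleftrightarrow> wp vs body_cross Q"
  "call f_comb1 vs Q \<longleftrightarrow> wp vs body_comb1 Q"
  "call f_comb vs Q \<longleftrightarrow> wp vs body_comb Q"
  "call f_link vs Q \<longleftrightarrow> wp vs body_link Q"
  "call f_shift vs Q \<longleftrightarrow> wp vs body_shift Q"
  "call f_branch vs Q \<longleftrightarrow> wp vs body_branch Q"
  "call f_assign vs Q \<longleftrightarrow> wp vs body_assign Q"
  "call f_solve vs Q \<longleftrightarrow> wp vs body_solve Q"
  "call f_solve_all vs Q \<longleftrightarrow> wp vs body_solve_all Q"
  "call f_remove vs Q \<longleftrightarrow> wp vs body_remove Q"
  "call f_diff vs Q \<longleftrightarrow> wp vs body_diff Q"
  "call f_adj vs Q \<longleftrightarrow> wp vs body_adj Q"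
  "call f_touches vs Q \<longleftrightarrow> wp vs body_touches Q"
  "call f_gather vs Q \<longleftrightarrow> wp vs body_gather Q"
  "call f_rest vs Q \<longleftrightarrow> wp vs body_rest Q"
  "call f_parts vs Q \<longleftrightarrow> wp vs body_parts Q"
  "call f_cons_all vs Q \<longleftrightarrow> wp vs body_cons_all Q"
  "call f_outer vs Q \<longleftrightarrow> wp vs body_outer Q"
  "call f_tuples vs Q \<longleftrightarrow> wp vs body_tuples Q"
  "call f_balanced vs Q \<longleftrightarrow> wp vs body_balanced Q"
  "call f_find_separator vs Q \<longleftrightarrow> wp vs body_find_separator Q"
  "call f_range vs Q \<longleftrightarrow> wp vs body_range Q"
  "call f_edges_open vs Q \<longleftrightarrow> wp vs body_edges_open Q"
  "call f_edges_closed vs Q \<longleftrightarrow> wp vs body_edges_closed Q"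
  "call f_sum_table vs Q \<longleftrightarrow> wp vs body_sum_table Q"
  "call f_sum_zero vs Q \<longleftrightarrow> wp vs body_sum_zero Q"
  "call f_dedup vs Q \<longleftrightarrow> wp vs body_dedup Q"
  "call f_power3 vs Q \<longleftrightarrow> wp vs body_power3 Q"
  "call f_prod3 vs Q \<longleftrightarrow> wp vs body_prod3 Q"
  by (simp_all add: call_def prg_def lib_def)

text \<open>Both trees are descended in parallel, so the first argument alone pays. A short key can
  thus be compared with arbitrary data at bounded cost.\<close>

lemma computes_eq: "pure u \<Longrightarrow> pure v \<Longrightarrow> computes f_eq [u, v] (enc_bool (u = v)) (20 * vsize u)"
proof (induction u arbitrary: v)
  case Leaf
  then show ?case unfolding computes_def call_fun body_eq_def by (cases v) auto
next
  case (Node u1 u2)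
  show ?case
  proof (cases v)
    case (Node v1 v2)
    have 1: "computes f_eq [u1, v1] (enc_bool (u1 = v1)) (20 * vsize u1)"
      "computes f_eq [u2, v2] (enc_bool (u2 = v2)) (20 * vsize u2)"
      using Node.IH Node.prems Node by auto
    show ?thesis unfolding Node
      unfolding computes_def call_fun body_eq_def by (auto intro!: 1[THEN call_computes])
  qed (unfold computes_def call_fun body_eq_def, use Node.prems in auto)
qed auto

lemma computes_mem:
  assumes "faithful enc"
  shows "computes f_mem [enc x, enc_list enc xs] (enc_bool (x \<in> set xs)) ((length xs + 1) * (20 * vsize (enc x) + 30))"
proof (induction xs)
  case Nil
  show ?case unfolding computes_def call_fun body_mem_def by simp
next
  case (Cons y xs)
  note 1 = computes_eq[OF faithfulD(2)[OF assms] faithfulD(2)[OF assms], of x y]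
  show ?case
    unfolding computes_def call_fun body_mem_def by (auto simp: faithfulD[OF assms] intro!: 1[THEN call_computes] Cons[THEN call_computes])
qed

lemma computes_leq:
  "ends u \<Longrightarrow> ends v \<Longrightarrow> computes f_leq [u, v] (enc_bool (spine u \<le> spine v)) (20 * (spine u + 1))"
proof (induction u arbitrary: v)
  case Leaf
  then show ?case unfolding computes_def call_fun body_leq_def by auto
next
  case (Node u1 u2)
  show ?case
  proof (cases v)
    case (Node v1 v2)
    have 1: "computes f_leq [u2, v2] (enc_bool (spine u2 \<le> spine v2)) (20 * (spine u2 + 1))"
      using Node.IH Node.prems Node by auto
    show ?thesis unfolding Node computes_def call_fun body_leq_def
      by (auto intro!: 1[THEN call_computes])
  qed (unfold computes_def call_fun body_leq_def, use Node.prems in auto)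
qed auto

lemma computes_app:
  "computes f_app [enc_list enc xs, enc_list enc ys] (enc_list enc (xs @ ys)) (20 * (length xs + 1))"
proof (induction xs)
  case (Cons x xs)
  show ?case unfolding computes_def call_fun body_app_def
    by (auto intro!: Cons[THEN call_computes])
qed (unfold computes_def call_fun body_app_def, simp)

lemma computes_inst:
  "computes f_inst [enc_list enc_bool bs, enc_nat u, enc_nat v] (enc_list enc_nat (map (pick u v) bs)) (20 * (length bs + 1))"
proof (induction bs)
  case (Cons b bs)
  show ?case unfolding computes_def call_fun body_inst_def
    by (auto simp: pick_def intro!: Cons[THEN call_computes])
qed (unfold computes_def call_fun body_inst_def, simp)

lemma computes_ok:
  assumes "enc_evidence l v E" "vsize (enc_gatom \<alpha>) \<le> K"
  shows "computes f_ok [v, enc_bool s, enc_gatom \<alpha>] (enc_bool (evidence_ok E s \<alpha>)) (c_ok l K)"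
  using assms(1)
proof cases
  case (1 xs)
  have "computes f_mem [Node (enc_bool (\<not> s)) (enc_gatom \<alpha>), enc_list (enc_pair enc_bool enc_gatom) xs]
    (enc_bool ((\<not> s, \<alpha>) \<in> set xs)) ((length xs + 1) * (20 * vsize (enc_pair enc_bool enc_gatom (\<not> s, \<alpha>)) + 30))"
    using computes_mem[of "enc_pair enc_bool enc_gatom" "(\<not> s, \<alpha>)" xs] by simp
  moreover have "(length xs + 1) * (20 * vsize (enc_pair enc_bool enc_gatom (\<not> s, \<alpha>)) + 30) \<le> c_mem l (K + 4)"
    using assms(2) 1 vsize_enc_bool[of "\<not> s"] unfolding c_mem_def by (intro mult_le_mono) auto
  ultimately have m: "computes f_mem [Node (enc_bool (\<not> s)) (enc_gatom \<alpha>), enc_list (enc_pair enc_bool enc_gatom) xs]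
    (enc_bool ((\<not> s, \<alpha>) \<in> set xs)) (c_mem l (K + 4))"
    by (rule computes_mono)
  show ?thesis unfolding computes_def call_fun body_ok_def
    using 1 by (cases s) (auto simp: c_ok_def intro!: m[THEN call_computes_eq])
next
  case (2 xs ys)
  obtain p as where \<alpha>: "\<alpha> = (p, as)" by force
  have "computes f_mem [enc_nat p, enc_list enc_nat xs]
    (enc_bool (p \<in> set xs)) ((length xs + 1) * (20 * vsize (enc_nat p) + 30))"
    by (intro computes_mem) auto
  moreover have "(length xs + 1) * (20 * vsize (enc_nat p) + 30) \<le> c_mem l (K + 4)"
    using assms(2) 2 unfolding c_mem_def by (intro mult_le_mono) (auto simp: \<alpha>)
  ultimately have m1: "computes f_mem [enc_nat p, enc_list enc_nat xs]
    (enc_bool (p \<in> set xs)) (c_mem l (K + 4))"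
    by (rule computes_mono)
  have "computes f_mem [enc_gatom \<alpha>, enc_list enc_gatom ys]
    (enc_bool (\<alpha> \<in> set ys)) ((length ys + 1) * (20 * vsize (enc_gatom \<alpha>) + 30))"
    by (intro computes_mem) auto
  moreover have "(length ys + 1) * (20 * vsize (enc_gatom \<alpha>) + 30) \<le> c_mem l (K + 4)"
    using assms(2) 2 unfolding c_mem_def by (intro mult_le_mono) auto
  ultimately have m2: "computes f_mem [enc_gatom \<alpha>, enc_list enc_gatom ys]
    (enc_bool (\<alpha> \<in> set ys)) (c_mem l (K + 4))"
    by (rule computes_mono)
  show ?thesis unfolding computes_def call_fun body_ok_def
    using 2 by (cases s) (auto simp: c_ok_def \<alpha> intro!: m1[THEN call_computes] m2[unfolded \<alpha>, simplified, THEN call_computes])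
qed

lemma computes_check:
  assumes "enc_evidence l ev E"
    and "\<And>s p bs. (s, p, bs) \<in> set T \<Longrightarrow> vsize (enc_gatom (p, map (pick u v) bs)) \<le> K \<and> length bs \<le> K"
  shows "computes f_check [enc_list enc_literal T, enc_nat u, enc_nat v, ev]
    (enc_bool (consistent E u v T)) ((length T + 1) * (c_ok l K + 20 * K + 80))"
  using assms(2)
proof (induction T)
  case Nil
  then show ?case unfolding computes_def call_fun body_check_def by (auto simp: consistent_def)
next
  case (Cons x T)
  obtain s p bs where x: "x = (s, p, bs)" by (cases x) auto
  have K: "vsize (enc_gatom (p, map (pick u v) bs)) \<le> K" "length bs \<le> K"
    using Cons.prems x by auto
  have 1: "computes f_inst [enc_list enc_bool bs, enc_nat u, enc_nat v] (enc_list enc_nat (map (pick u v) bs)) (20 * (K + 1))"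
    using K by (intro computes_mono[OF computes_inst]) auto
  have 2: "computes f_ok [ev, enc_bool s, Node (enc_nat p) (enc_list enc_nat (map (pick u v) bs))]
     (enc_bool (evidence_ok E s (p, map (pick u v) bs))) (c_ok l K)"
    using computes_ok[OF assms(1) K(1), of s] by simp
  note IH = Cons.IH[OF Cons.prems]
  show ?case unfolding computes_def call_fun body_check_def
    by (auto simp: x consistent_def intro!: 1[THEN call_computes] 2[THEN call_computes] IH[THEN call_computes])
qed

lemma computes_factor:
  assumes "enc_evidence l ev E" "faithful enc" "vsize (enc key) \<le> K"
    and "\<And>k T s r. (k, T, s, r) \<in> set es \<Longrightarrow> s \<le> \<rho> \<and> length T \<le> K"
    and "\<And>k T x s p bs. (k, T, x) \<in> set es \<Longrightarrow> (s, p, bs) \<in> set T \<Longrightarrow>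
       vsize (enc_gatom (p, map (pick u v) bs)) \<le> K \<and> length bs \<le> K"
  shows "computes_real f_factor [enc_list (enc_entry enc) es, enc key, enc_nat u, enc_nat v, ev]
    (factor_value E es key u v) (\<rho> + length es + 1) ((length es + 1) * c_factor l K \<rho> (length es))"
proof -
  define C where "C = 20 * K + (K + 1) * (c_ok l K + 20 * K + 80) + 100 + 2 * \<rho> + length es"
  have "\<exists>s\<le>\<rho> + length es. True" by auto
  \<comment> \<open>Generalised to sublists: the cost per entry refers to the whole list, because
    the size of the running sum grows by one with each addition.\<close>
  have "set xs \<subseteq> set es \<Longrightarrow> length xs \<le> length es \<Longrightarrow>
    computes_real f_factor [enc_list (enc_entry enc) xs, enc key, enc_nat u, enc_nat v, ev]
    (factor_value E xs key u v) (\<rho> + length xs + 1) ((length xs + 1) * C)" for xs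
  proof (induction xs)
    case Nil
    then show ?case unfolding computes_real_def call_fun body_factor_def
      by (auto simp: factor_value_def C_def)
  next
    case (Cons x xs)
    obtain k T s r where x: "x = (k, T, s, r)" by (cases x) auto
    have T: "s \<le> \<rho>" "length T \<le> K"
      using Cons.prems assms(4)[of k T s r] by (auto simp: x)
    have "computes f_check [enc_list enc_literal T, enc_nat u, enc_nat v, ev]
        (enc_bool (consistent E u v T)) ((length T + 1) * (c_ok l K + 20 * K + 80))"
      using Cons.prems assms(5)[of k T "(s, r)"] by (intro computes_check[OF assms(1)]) (auto simp: x)
    then have 1: "computes f_check [enc_list enc_literal T, enc_nat u, enc_nat v, ev]
        (enc_bool (consistent E u v T)) ((K + 1) * (c_ok l K + 20 * K + 80))"
      by (rule computes_mono) (use T in simp)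
    have 2: "computes f_eq [enc key, enc k] (enc_bool (key = k)) (20 * K)"
      using computes_mono[OF computes_eq[of "enc key" "enc k"], of "20 * K"] assms(2,3)
      by (simp add: faithfulD)
    have IH: "computes_real f_factor [enc_list (enc_entry enc) xs, enc key, enc_nat u, enc_nat v, ev]
      (factor_value E xs key u v) (\<rho> + length xs + 1) ((length xs + 1) * C)"
      using Cons by auto
    show ?case unfolding computes_real_def call_fun body_factor_def
      using T Cons.prems
      by (auto simp: x factor_value_def C_def distrib_right intro!: 1[THEN call_computes] 2[THEN call_computes_eq] IH[unfolded factor_value_def, THEN call_computes_real_eq])
  qed
  from this[of es] show ?thesis by (simp add: C_def c_factor_def)
qed

end

section \<open>Components and tuples\<close>

definition touching :: "nat list list \<Rightarrow> nat \<Rightarrow> nat list \<Rightarrow> bool" where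
  "touching es v P \<longleftrightarrow> (\<exists>u\<in>set P. \<exists>e\<in>set es. v \<in> set e \<and> u \<in> set e)"

text \<open>Connected components, grown by inserting elements one at a time: the new element fuses
  the components that it touches. The hyperedges are the argument tuples of evidence atoms and act
  as cliques.\<close>

fun parts :: "nat list list \<Rightarrow> nat list \<Rightarrow> nat list list" where
  "parts es [] = []"
| "parts es (v # C) =
    (concat (filter (touching es v) (parts es C)) @ [v]) # filter (\<lambda>P. \<not> touching es v P) (parts es C)"

lemma mset_parts: "mset (concat (parts es C)) = mset C"
proof (induction C)
  case (Cons v C)
  have "mset (concat (filter Q Ps)) + mset (concat (filter (\<lambda>P. \<not> Q P) Ps)) = mset (concat Ps)" for Q and Ps :: "nat list list"
    by (induction Ps) auto
  then show ?case using Cons by (simp add: add.commute)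
qed auto

lemma sum_length_parts: "(\<Sum>P\<leftarrow>parts es C. length P) = length C"
  by (metis length_concat mset_eq_length mset_parts)

lemma parts_nonempty: "[] \<notin> set (parts es C)"
  by (induction C) auto

lemma length_parts: "length (parts es C) \<le> length C"
proof (induction C)
  case (Cons v C)
  then show ?case using length_filter_le[of "\<lambda>P. \<not> touching es v P" "parts es C"]
    by (simp del: length_filter_le)
qed auto

lemma length_part: "P \<in> set (parts es C) \<Longrightarrow> length P \<le> length C"
  using member_le_sum_list[of "length P" "map length (parts es C)"] by (simp add: sum_length_parts)

definition balanced :: "nat list list \<Rightarrow> nat list \<Rightarrow> bool" where
  "balanced Ps C \<longleftrightarrow> (\<forall>P\<in>set Ps. 2 * length P \<le> length C)"

definition remove_list :: "nat list \<Rightarrow> nat list \<Rightarrow> nat list" where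
  "remove_list X C = foldr removeAll X C"

lemma set_remove_list [simp]: "set (remove_list X C) = set C - set X"
  by (induction X) (auto simp: remove_list_def)

lemma distinct_remove_list [simp]: "distinct C \<Longrightarrow> distinct (remove_list X C)"
  by (induction X) (auto simp: remove_list_def distinct_removeAll)

lemma length_remove_list: "length (remove_list X C) \<le> length C"
proof (induction X)
  case (Cons x X)
  have "length (removeAll x (remove_list X C)) \<le> length (remove_list X C)"
    by (simp add: removeAll_filter_not_eq)
  then show ?case using Cons unfolding remove_list_def foldr.simps o_apply by (rule order_trans)
qed (simp add: remove_list_def)

fun tuples :: "nat \<Rightarrow> 'a list \<Rightarrow> 'a list list" where
  "tuples 0 C = [[]]"
| "tuples (Suc j) C = concat (map (\<lambda>x. map ((#) x) (tuples j C)) C)"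

lemma set_tuples: "set (tuples j C) = {xs. length xs = j \<and> set xs \<subseteq> set C}"
proof (induction j)
  case (Suc j)
  show ?case
    by (auto simp: Suc length_Suc_conv image_iff)
qed auto

lemma length_tuples [simp]: "length (tuples j C) = length C ^ j"
proof (induction j)
  case (Suc j)
  have "(\<Sum>x\<leftarrow>C. length (map ((#) x) (tuples j C))) = length C * length C ^ j"
    using Suc by (simp add: sum_list_triv)
  then show ?case by (simp add: length_concat comp_def)
qed auto

lemma distinct_tuples: "distinct C \<Longrightarrow> distinct (tuples j C)"
proof (induction j)
  case (Suc j)
  have "distinct (concat (map (\<lambda>x. map ((#) x) (tuples j C)) D))" if "distinct D" for D
    using that by (induction D) (auto simp: distinct_map Suc)
  then show ?case using Suc by simp
qed auto

section \<open>Running time of the graph functions\<close>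

context machine
begin

text \<open>Each budget is a bound on the number of iterations times the cost of one iteration.
  \<open>N\<close> bounds the lengths of lists and the numbers that occur; the numerals are
  generous.\<close>

definition "c_nat N = 20 * (2 * N + 1)" for N :: nat
definition "c_memn N = c_mem N (2 * N + 1)" for N :: nat
definition "c_remove N = (N + 1) * (c_nat N + 40)" for N :: nat
definition "c_diff N = (N + 1) * (c_remove N + 40)" for N :: nat
definition "c_adj N = (N + 1) * (2 * c_memn N + 50)" for N :: nat
definition "c_touches N = (N + 1) * (c_adj N + 50)" for N :: nat
definition "c_gather N = (N + 1) * (c_touches N + 20 * (N + 1) + 50)" for N :: nat
definition "c_parts N = (N + 1) * (2 * c_gather N + 60)" for N :: nat
definition "c_outer N L = (N + 1) * (20 * (L + 1) + 40)" for N L :: nat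
definition "c_tuples j N = (j + 1) * (c_outer N ((N + 1) ^ j) + 40)" for j N :: nat
definition "c_balanced N = (N + 1) * (20 * (N + 1) + 20 * (2 * N + 1) + 50)" for N :: nat
definition "c_findsep N L = (L + 1) * (c_diff N + c_parts N + c_balanced N + 60)" for N L :: nat
definition "c_dedup N = (N + 1) * (c_memn N + 40)" for N :: nat

lemma computes_eq_nat: "u \<le> N \<Longrightarrow> computes f_eq [enc_nat u, enc_nat v] (enc_bool (u = v)) (c_nat N)"
  using computes_mono[OF computes_eq[of "enc_nat u" "enc_nat v"], of "c_nat N"]
  by (simp add: faithfulD c_nat_def)

lemma computes_mem_nat:
  assumes "x \<le> N" "length xs \<le> N"
  shows "computes f_mem [enc_nat x, enc_list enc_nat xs] (enc_bool (x \<in> set xs)) (c_memn N)"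
  using assms by (intro computes_mono[OF computes_mem]) (auto simp: c_mem_def c_memn_def simp del: mult_Suc intro!: mult_le_mono)

lemma computes_remove:
  assumes "x \<le> N" "length xs \<le> N"
  shows "computes f_remove [enc_nat x, enc_list enc_nat xs] (enc_list enc_nat (removeAll x xs)) (c_remove N)"
proof -
  note 1 = computes_eq_nat[OF assms(1)]
  have "computes f_remove [enc_nat x, enc_list enc_nat xs] (enc_list enc_nat (removeAll x xs)) ((length xs + 1) * (c_nat N + 40))"
  proof (induction xs)
    case Nil
    show ?case unfolding computes_def call_fun body_remove_def by simp
  next
    case (Cons y xs)
    show ?case unfolding computes_def call_fun body_remove_def
      by (auto intro!: 1[of y, THEN call_computes_eq] Cons[THEN call_computes_eq])
  qed
  then show ?thesis by (rule computes_mono) (use assms in \<open>auto simp: c_remove_def intro!: mult_le_mono\<close>)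
qed

lemma computes_diff:
  assumes "length xs \<le> N" "length X \<le> N" "set X \<subseteq> {..N}"
  shows "computes f_diff [enc_list enc_nat X, enc_list enc_nat xs] (enc_list enc_nat (remove_list X xs)) (c_diff N)"
proof -
  have "computes f_diff [enc_list enc_nat X, enc_list enc_nat xs] (enc_list enc_nat (remove_list X xs)) ((length X + 1) * (c_remove N + 40))"
    using assms(3)
  proof (induction X)
    case Nil
    show ?case unfolding computes_def call_fun body_diff_def by (simp add: remove_list_def)
  next
    case (Cons y X)
    have 1: "computes f_remove [enc_nat y, enc_list enc_nat (remove_list X xs)] (enc_list enc_nat (removeAll y (remove_list X xs))) (c_remove N)"
      using Cons.prems assms(1) length_remove_list[of X xs] by (intro computes_remove) auto
    have 2: "computes f_diff [enc_list enc_nat X, enc_list enc_nat xs] (enc_list enc_nat (remove_list X xs)) ((length X + 1) * (c_remove N + 40))"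
      using Cons by simp
    show ?case unfolding computes_def call_fun body_diff_def
      by (auto simp: remove_list_def intro!: 1[unfolded remove_list_def, THEN call_computes] 2[unfolded remove_list_def, THEN call_computes])
  qed
  then show ?thesis by (rule computes_mono) (use assms in \<open>auto simp: c_diff_def intro!: mult_le_mono\<close>)
qed

lemma computes_adj:
  assumes "u \<le> N" "v \<le> N" "length es \<le> N" "\<And>e. e \<in> set es \<Longrightarrow> length e \<le> N"
  shows "computes f_adj [enc_nat u, enc_nat v, enc_list (enc_list enc_nat) es]
    (enc_bool (\<exists>e\<in>set es. u \<in> set e \<and> v \<in> set e)) (c_adj N)"
proof -
  have "computes f_adj [enc_nat u, enc_nat v, enc_list (enc_list enc_nat) es]
    (enc_bool (\<exists>e\<in>set es. u \<in> set e \<and> v \<in> set e)) ((length es + 1) * (2 * c_memn N + 50))"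
    using assms(4)
  proof (induction es)
    case Nil
    show ?case unfolding computes_def call_fun body_adj_def by simp
  next
    case (Cons e es)
    have 1: "computes f_mem [enc_nat u, enc_list enc_nat e] (enc_bool (u \<in> set e)) (c_memn N)"
     "computes f_mem [enc_nat v, enc_list enc_nat e] (enc_bool (v \<in> set e)) (c_memn N)"
      using Cons.prems assms by (intro computes_mem_nat; simp)+
    have IH: "computes f_adj [enc_nat u, enc_nat v, enc_list (enc_list enc_nat) es]
        (enc_bool (\<exists>e\<in>set es. u \<in> set e \<and> v \<in> set e)) ((length es + 1) * (2 * c_memn N + 50))"
      using Cons by simp
    show ?case unfolding computes_def call_fun body_adj_def
      by (auto intro!: 1[THEN call_computes] IH[THEN call_computes])
  qed
  then show ?thesis by (rule computes_mono) (use assms in \<open>auto simp: c_adj_def intro!: mult_le_mono\<close>)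
qed

lemma computes_touches:
  assumes "v \<le> N" "length P \<le> N" "set P \<subseteq> {..N}" "length es \<le> N" "\<And>e. e \<in> set es \<Longrightarrow> length e \<le> N"
  shows "computes f_touches [enc_nat v, enc_list enc_nat P, enc_list (enc_list enc_nat) es]
    (enc_bool (touching es v P)) (c_touches N)"
proof -
  have "computes f_touches [enc_nat v, enc_list enc_nat P, enc_list (enc_list enc_nat) es]
    (enc_bool (touching es v P)) ((length P + 1) * (c_adj N + 50))"
    using assms(3)
  proof (induction P)
    case Nil
    show ?case unfolding computes_def call_fun body_touches_def by (simp add: touching_def)
  next
    case (Cons u P)
    have 1: "computes f_adj [enc_nat v, enc_nat u, enc_list (enc_list enc_nat) es]
        (enc_bool (\<exists>e\<in>set es. v \<in> set e \<and> u \<in> set e)) (c_adj N)"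
      using Cons.prems assms by (intro computes_adj) auto
    have IH: "computes f_touches [enc_nat v, enc_list enc_nat P, enc_list (enc_list enc_nat) es]
        (enc_bool (touching es v P)) ((length P + 1) * (c_adj N + 50))"
      using Cons by simp
    define A where "A \<longleftrightarrow> (\<exists>e\<in>set es. v \<in> set e \<and> u \<in> set e)"
    have *: "touching es v (u # P) \<longleftrightarrow> A \<or> touching es v P"
      by (auto simp: touching_def A_def)
    show ?case unfolding computes_def call_fun body_touches_def *
      by (auto intro!: 1[folded A_def, THEN call_computes] IH[THEN call_computes])
  qed
  then show ?thesis by (rule computes_mono) (use assms in \<open>auto simp: c_touches_def intro!: mult_le_mono\<close>)
qed

lemma computes_gather_rest:
  assumes "v \<le> N" "length Ps \<le> N" "\<And>P. P \<in> set Ps \<Longrightarrow> length P \<le> N \<and> set P \<subseteq> {..N}"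
    "length es \<le> N" "\<And>e. e \<in> set es \<Longrightarrow> length e \<le> N"
  shows "computes f_gather [enc_nat v, enc_list (enc_list enc_nat) Ps, enc_list (enc_list enc_nat) es]
      (enc_list enc_nat (concat (filter (touching es v) Ps) @ [v])) (c_gather N)" (is ?G)
    and "computes f_rest [enc_nat v, enc_list (enc_list enc_nat) Ps, enc_list (enc_list enc_nat) es]
      (enc_list (enc_list enc_nat) (filter (\<lambda>P. \<not> touching es v P) Ps)) (c_gather N)" (is ?R)
proof -
  let ?b = "\<lambda>Ps. (length Ps + 1) * (c_touches N + 20 * (N + 1) + 50)"
  have G: "computes f_gather [enc_nat v, enc_list (enc_list enc_nat) Ps, enc_list (enc_list enc_nat) es]
      (enc_list enc_nat (concat (filter (touching es v) Ps) @ [v])) (?b Ps) \<and>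
    computes f_rest [enc_nat v, enc_list (enc_list enc_nat) Ps, enc_list (enc_list enc_nat) es]
      (enc_list (enc_list enc_nat) (filter (\<lambda>P. \<not> touching es v P) Ps)) (?b Ps)"
    using assms(3)
  proof (induction Ps)
    case Nil
    show ?case unfolding computes_def call_fun body_gather_def body_rest_def by simp
  next
    case (Cons P Ps)
    have P: "length P \<le> N" "set P \<subseteq> {..N}" using Cons.prems by auto
    have 1: "computes f_touches [enc_nat v, enc_list enc_nat P, enc_list (enc_list enc_nat) es]
        (enc_bool (touching es v P)) (c_touches N)"
      by (intro computes_touches assms P)
    have 2: "computes f_app [enc_list enc_nat P, enc_list enc_nat ys] (enc_list enc_nat (P @ ys)) (20 * (N + 1))" for ys
      using P by (intro computes_mono[OF computes_app]) auto
    have IH: "computes f_gather [enc_nat v, enc_list (enc_list enc_nat) Ps, enc_list (enc_list enc_nat) es]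
      (enc_list enc_nat (concat (filter (touching es v) Ps) @ [v])) (?b Ps)"
      "computes f_rest [enc_nat v, enc_list (enc_list enc_nat) Ps, enc_list (enc_list enc_nat) es]
      (enc_list (enc_list enc_nat) (filter (\<lambda>P. \<not> touching es v P) Ps)) (?b Ps)"
      using Cons by simp_all
    show ?case unfolding computes_def call_fun body_gather_def body_rest_def
      by (auto intro!: 1[THEN call_computes] 2[THEN call_computes] IH[THEN call_computes])
  qed
  show ?G ?R by (rule computes_mono[OF G[THEN conjunct1]] computes_mono[OF G[THEN conjunct2]],
      use assms in \<open>auto simp: c_gather_def intro!: mult_le_mono\<close>)+
qed

lemma computes_parts:
  assumes "length C \<le> N" "set C \<subseteq> {..N}" "length es \<le> N" "\<And>e. e \<in> set es \<Longrightarrow> length e \<le> N"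
  shows "computes f_parts [enc_list enc_nat C, enc_list (enc_list enc_nat) es]
      (enc_list (enc_list enc_nat) (parts es C)) (c_parts N)"
proof -
  have "computes f_parts [enc_list enc_nat C, enc_list (enc_list enc_nat) es]
      (enc_list (enc_list enc_nat) (parts es C)) ((length C + 1) * (2 * c_gather N + 60))"
    using assms(1,2)
  proof (induction C)
    case Nil
    show ?case unfolding computes_def call_fun body_parts_def by simp
  next
    case (Cons v C)
    have "set P \<subseteq> set C" if "P \<in> set (parts es C)" for P
      using that mset_parts[of es C] by (metis UN_upper set_concat set_mset_mset)
    then have P: "length P \<le> N \<and> set P \<subseteq> {..N}" if "P \<in> set (parts es C)" for P
      using that length_part[OF that] Cons.prems by fastforce
    have l: "length (parts es C) \<le> N" using length_parts[of es C] Cons.prems by simp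
    note 1 = computes_gather_rest[where v = v and Ps = "parts es C", OF _ l P assms(3,4)]
    have 1: "computes f_gather [enc_nat v, enc_list (enc_list enc_nat) (parts es C), enc_list (enc_list enc_nat) es]
      (enc_list enc_nat (concat (filter (touching es v) (parts es C)) @ [v])) (c_gather N)"
     "computes f_rest [enc_nat v, enc_list (enc_list enc_nat) (parts es C), enc_list (enc_list enc_nat) es]
      (enc_list (enc_list enc_nat) (filter (\<lambda>P. \<not> touching es v P) (parts es C))) (c_gather N)"
      using Cons.prems by (intro 1; simp)+
    have IH: "computes f_parts [enc_list enc_nat C, enc_list (enc_list enc_nat) es]
      (enc_list (enc_list enc_nat) (parts es C)) ((length C + 1) * (2 * c_gather N + 60))"
      using Cons by simp
    show ?case unfolding computes_def call_fun body_parts_def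
      by (auto intro!: 1[THEN call_computes] IH[THEN call_computes])
  qed
  then show ?thesis by (rule computes_mono) (use assms in \<open>auto simp: c_parts_def intro!: mult_le_mono\<close>)
qed

lemma computes_cons_all:
  "computes f_cons_all [enc x, enc_list (enc_list enc) Ls, enc_list (enc_list enc) acc]
    (enc_list (enc_list enc) (map ((#) x) Ls @ acc)) (20 * (length Ls + 1))"
proof (induction Ls)
  case Nil
  show ?case unfolding computes_def call_fun body_cons_all_def by simp
next
  case (Cons L Ls)
  show ?case unfolding computes_def call_fun body_cons_all_def
    by (auto intro!: Cons[THEN call_computes])
qed

lemma computes_outer:
  assumes "length C \<le> N"
  shows "computes f_outer [enc_list enc C, enc_list (enc_list enc) Ls]
    (enc_list (enc_list enc) (concat (map (\<lambda>x. map ((#) x) Ls) C))) (c_outer N (length Ls))"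
proof -
  have "computes f_outer [enc_list enc C, enc_list (enc_list enc) Ls]
    (enc_list (enc_list enc) (concat (map (\<lambda>x. map ((#) x) Ls) C))) ((length C + 1) * (20 * (length Ls + 1) + 40))"
  proof (induction C)
    case Nil
    show ?case unfolding computes_def call_fun body_outer_def by simp
  next
    case (Cons x C)
    show ?case unfolding computes_def call_fun body_outer_def
      by (auto intro!: Cons[THEN call_computes] computes_cons_all[THEN call_computes])
  qed
  then show ?thesis by (rule computes_mono) (use assms in \<open>auto simp: c_outer_def simp del: mult_Suc intro!: mult_le_mono\<close>)
qed

lemma computes_tuples:
  assumes "length C \<le> N"
  shows "computes f_tuples [enc_nat j, enc_list enc C] (enc_list (enc_list enc) (tuples j C)) (c_tuples j N)"
proof -
  \<comment> \<open>All intermediate lists are charged at the length of the longest one, hence the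
    exponent \<open>j\<close> instead of \<open>i\<close>.\<close>
  have "i \<le> j \<Longrightarrow> computes f_tuples [enc_nat i, enc_list enc C] (enc_list (enc_list enc) (tuples i C))
    ((i + 1) * (c_outer N ((N + 1) ^ j) + 40))" for i
  proof (induction i)
    case 0
    show ?case unfolding computes_def call_fun body_tuples_def by simp
  next
    case (Suc i)
    have "length C ^ i \<le> (N + 1) ^ i" using assms by (intro power_mono) auto
    also have "\<dots> \<le> (N + 1) ^ j" using Suc by (intro power_increasing) auto
    finally have "length (tuples i C) \<le> (N + 1) ^ j" by simp
    then have 1: "computes f_outer [enc_list enc C, enc_list (enc_list enc) (tuples i C)]
        (enc_list (enc_list enc) (concat (map (\<lambda>x. map ((#) x) (tuples i C)) C))) (c_outer N ((N + 1) ^ j))"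
      by (intro computes_mono[OF computes_outer[OF assms]]) (auto simp: c_outer_def simp del: mult_Suc intro!: mult_le_mono)
    have IH: "computes f_tuples [enc_nat i, enc_list enc C] (enc_list (enc_list enc) (tuples i C))
       ((i + 1) * (c_outer N ((N + 1) ^ j) + 40))"
      using Suc by simp
    show ?case unfolding computes_def call_fun body_tuples_def
      by (auto intro!: IH[THEN call_computes] 1[THEN call_computes])
  qed
  from this[of j] show ?thesis by (simp add: c_tuples_def)
qed

lemma computes_balanced:
  assumes "length Ps \<le> N" "\<And>P. P \<in> set Ps \<Longrightarrow> length P \<le> N"
  shows "computes f_balanced [enc_list (enc_list enc_nat) Ps, enc_list enc_nat C] (enc_bool (balanced Ps C)) (c_balanced N)"
proof -
  have "computes f_balanced [enc_list (enc_list enc_nat) Ps, enc_list enc_nat C] (enc_bool (balanced Ps C))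
     ((length Ps + 1) * (20 * (N + 1) + 20 * (2 * N + 1) + 50))"
    using assms(2)
  proof (induction Ps)
    case Nil
    show ?case unfolding computes_def call_fun body_balanced_def by (simp add: balanced_def)
  next
    case (Cons P Ps)
    have P: "length P \<le> N" using Cons.prems by auto
    have 1: "computes f_app [enc_list enc_nat P, enc_list enc_nat P] (enc_list enc_nat (P @ P)) (20 * (N + 1))"
      using P by (intro computes_mono[OF computes_app]) auto
    have 2: "computes f_leq [enc_list enc_nat (P @ P), enc_list enc_nat C] (enc_bool (2 * length P \<le> length C)) (20 * (2 * N + 1))"
      using P computes_mono[OF computes_leq[of "enc_list enc_nat (P @ P)" "enc_list enc_nat C"], of "20 * (2 * N + 1)"]
      by (simp add: mult_2)
    have IH: "computes f_balanced [enc_list (enc_list enc_nat) Ps, enc_list enc_nat C] (enc_bool (balanced Ps C))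
       ((length Ps + 1) * (20 * (N + 1) + 20 * (2 * N + 1) + 50))"
      using Cons by simp
    have *: "balanced (P # Ps) C \<longleftrightarrow> 2 * length P \<le> length C \<and> balanced Ps C"
      by (auto simp: balanced_def)
    show ?case unfolding computes_def call_fun body_balanced_def *
      by (auto intro!: IH[THEN call_computes] 1[THEN call_computes] 2[THEN call_computes])
  qed
  then show ?thesis by (rule computes_mono) (use assms in \<open>auto simp: c_balanced_def intro!: mult_le_mono\<close>)
qed

text \<open>The result is only known to be some balanced member of the list, which is all that the
  recursion uses.\<close>

lemma computes_find_separator:
  assumes "length C \<le> N" "set C \<subseteq> {..N}" "length es \<le> N" "\<And>e. e \<in> set es \<Longrightarrow> length e \<le> N"
    "\<And>X. X \<in> set Xs \<Longrightarrow> length X \<le> N \<and> set X \<subseteq> {..N}"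
    "\<exists>X\<in>set Xs. balanced (parts es (remove_list X C)) C"
  shows "\<exists>X\<in>set Xs. balanced (parts es (remove_list X C)) C \<and>
    computes f_find_separator [enc_list (enc_list enc_nat) Xs, enc_list enc_nat C, enc_list (enc_list enc_nat) es]
    (enc_list enc_nat X) (c_findsep N (length Xs))"
proof -
  let ?b = "\<lambda>L. (L + 1) * (c_diff N + c_parts N + c_balanced N + 60)"
  have "\<exists>X\<in>set Xs. balanced (parts es (remove_list X C)) C \<and>
    computes f_find_separator [enc_list (enc_list enc_nat) Xs, enc_list enc_nat C, enc_list (enc_list enc_nat) es]
    (enc_list enc_nat X) (?b (length Xs))"
    using assms(5,6)
  proof (induction Xs)
    case (Cons X Xs)
    let ?D = "remove_list X C"
    have D: "length ?D \<le> N" "set ?D \<subseteq> {..N}" using assms(1,2) length_remove_list[of X C] by auto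
    have P: "length P \<le> N" if "P \<in> set (parts es ?D)" for P
      using length_part[OF that] D by simp
    have 1: "computes f_diff [enc_list enc_nat X, enc_list enc_nat C] (enc_list enc_nat ?D) (c_diff N)"
      using Cons.prems(1)[of X] by (intro computes_diff[OF assms(1)]) auto
    have 2: "computes f_parts [enc_list enc_nat ?D, enc_list (enc_list enc_nat) es]
      (enc_list (enc_list enc_nat) (parts es ?D)) (c_parts N)"
      by (intro computes_parts assms D)
    have 3: "computes f_balanced [enc_list (enc_list enc_nat) (parts es ?D), enc_list enc_nat C] (enc_bool (balanced (parts es ?D) C)) (c_balanced N)"
      using P length_parts[of es ?D] D by (intro computes_balanced) auto
    show ?case
    proof (cases "balanced (parts es ?D) C")
      case True
      then show ?thesis
        unfolding computes_def call_fun body_find_separator_def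
        by (auto intro!: bexI[of _ X] 1[THEN call_computes] 2[THEN call_computes] 3[THEN call_computes])
    next
      case False
      then obtain Y where Y: "Y \<in> set Xs" "balanced (parts es (remove_list Y C)) C"
        and IH: "computes f_find_separator [enc_list (enc_list enc_nat) Xs, enc_list enc_nat C, enc_list (enc_list enc_nat) es]
           (enc_list enc_nat Y) (?b (length Xs))"
        using Cons by auto
      show ?thesis using Y False unfolding computes_def call_fun body_find_separator_def
        by (auto intro!: bexI[of _ Y] 1[THEN call_computes] 2[THEN call_computes] 3[THEN call_computes] IH[THEN call_computes])
    qed
  qed auto
  then show ?thesis by (simp add: c_findsep_def)
qed

lemma computes_range: "computes f_range [enc_nat n] (enc_list enc_nat (rev [0..<n])) (20 * (n + 1))"
proof (induction n)
  case 0
  show ?case unfolding computes_def call_fun body_range_def by simp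
next
  case (Suc n)
  show ?case unfolding computes_def call_fun body_range_def
    by (auto intro!: Suc[THEN call_computes])
qed

lemma computes_edges_open:
  "computes f_edges_open [enc_list (enc_pair enc_bool enc_gatom) xs] (enc_list (enc_list enc_nat) (map (snd \<circ> snd) xs)) (20 * (length xs + 1))"
proof (induction xs)
  case Nil
  show ?case unfolding computes_def call_fun body_edges_open_def by simp
next
  case (Cons x xs)
  then show ?case unfolding computes_def call_fun body_edges_open_def
    by (cases x) (auto intro!: Cons[THEN call_computes])
qed

lemma computes_edges_closed:
  "computes f_edges_closed [enc_list enc_gatom xs] (enc_list (enc_list enc_nat) (map snd xs)) (20 * (length xs + 1))"
proof (induction xs)
  case Nil
  show ?case unfolding computes_def call_fun body_edges_closed_def by simp
next
  case (Cons x xs)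
  then show ?case unfolding computes_def call_fun body_edges_closed_def
    by (cases x) (auto intro!: Cons[THEN call_computes])
qed

lemma computes_dedup:
  assumes "length xs \<le> N" "set xs \<subseteq> {..N}"
  shows "computes f_dedup [enc_list enc_nat xs] (enc_list enc_nat (remdups xs)) (c_dedup N)"
proof -
  have "computes f_dedup [enc_list enc_nat xs] (enc_list enc_nat (remdups xs)) ((length xs + 1) * (c_memn N + 40))"
    using assms
  proof (induction xs)
    case Nil
    show ?case unfolding computes_def call_fun body_dedup_def by simp
  next
    case (Cons x xs)
    have 1: "computes f_mem [enc_nat x, enc_list enc_nat xs] (enc_bool (x \<in> set xs)) (c_memn N)"
      using Cons.prems by (intro computes_mem_nat) auto
    have IH: "computes f_dedup [enc_list enc_nat xs] (enc_list enc_nat (remdups xs)) ((length xs + 1) * (c_memn N + 40))"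
      using Cons by simp
    show ?case unfolding computes_def call_fun body_dedup_def
      by (auto intro!: 1[THEN call_computes] IH[THEN call_computes])
  qed
  then show ?thesis by (rule computes_mono) (use assms in \<open>auto simp: c_dedup_def intro!: mult_le_mono\<close>)
qed

end

lemma prod_list_mset_cong: "mset xs = mset ys \<Longrightarrow> (\<Prod>x\<leftarrow>xs. f x) = (\<Prod>x\<leftarrow>ys. f x :: 'a :: comm_monoid_mult)"
  by (simp flip: prod_mset_prod_list)

section \<open>Weights of type assignments and tables\<close>

text \<open>\<open>\<omega> v a\<close> is the factor of \<open>v\<close> with type
  \<open>a\<close>, and \<open>R u v a b\<close> that of a pair with its types. Symmetry makes
  weights independent of the order of elements, which matters because splitting into components
  permutes them.\<close>

locale weighted_types =
  fixes m :: nat and \<omega> :: "nat \<Rightarrow> nat \<Rightarrow> real" and R :: "nat \<Rightarrow> nat \<Rightarrow> nat \<Rightarrow> nat \<Rightarrow> real"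
  assumes R_sym: "R u v a b = R v u b a"
begin

text \<open>An iterated sum along a list and not a sum over functions: the program also fixes the
  types of elements one after the other.\<close>

fun sum_types :: "nat list \<Rightarrow> ((nat \<times> nat) list \<Rightarrow> real) \<Rightarrow> real" where
  "sum_types [] g = g []"
| "sum_types (v # C) g = (\<Sum>a<m. sum_types C (\<lambda>s. g ((v, a) # s)))"

definition link :: "nat \<times> nat \<Rightarrow> (nat \<times> nat) list \<Rightarrow> real" where
  "link x \<sigma> = (\<Prod>y\<leftarrow>\<sigma>. R (fst x) (fst y) (snd x) (snd y))"

definition links :: "(nat \<times> nat) list \<Rightarrow> (nat \<times> nat) list \<Rightarrow> real" where
  "links s \<sigma> = (\<Prod>x\<leftarrow>s. link x \<sigma>)"

text \<open>Each pair is counted once, at the earlier of its two elements.\<close>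

fun weight :: "(nat \<times> nat) list \<Rightarrow> real" where
  "weight [] = 1"
| "weight (x # s) = \<omega> (fst x) (snd x) * link x s * weight s"

lemma link_simps [simp]: "link x [] = 1" "link x (y # \<sigma>) = R (fst x) (fst y) (snd x) (snd y) * link x \<sigma>"
  "link x (\<sigma> @ \<tau>) = link x \<sigma> * link x \<tau>"
  by (simp_all add: link_def)

lemma links_simps [simp]: "links [] \<sigma> = 1" "links (x # s) \<sigma> = link x \<sigma> * links s \<sigma>"
  "links (s @ t) \<sigma> = links s \<sigma> * links t \<sigma>"
  by (simp_all add: links_def)

lemma links_Nil2 [simp]: "links s [] = 1"
  by (induction s) auto

lemma links_Cons2: "links s (x # \<sigma>) = link x s * links s \<sigma>"
  by (induction s) (auto simp: R_sym[of "fst x"])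

lemma link_cong: "mset s = mset t \<Longrightarrow> link x s = link x t"
  unfolding link_def by (rule prod_list_mset_cong)

lemma links_cong: "mset s = mset t \<Longrightarrow> links s \<sigma> = links t \<sigma>"
  unfolding links_def by (rule prod_list_mset_cong)

lemma weight_append: "weight (s @ t) = weight s * weight t * links s t"
  by (induction s) auto

lemma weight_remove1: "x \<in> set s \<Longrightarrow> weight s = \<omega> (fst x) (snd x) * link x (remove1 x s) * weight (remove1 x s)"
proof (induction s)
  case (Cons y s)
  show ?case
  proof (cases "x = y")
    case False
    then have x: "x \<in> set s" using Cons by auto
    then have "link y s = R (fst y) (fst x) (snd y) (snd x) * link y (remove1 x s)"
      using link_cong[of s "x # remove1 x s" y] by simp
    then show ?thesis using False Cons x by (simp add: R_sym[of "fst y"])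
  qed auto
qed auto

lemma weight_cong: "mset s = mset t \<Longrightarrow> weight s = weight t"
proof (induction s arbitrary: t)
  case (Cons x s)
  then have x: "x \<in> set t" using mset_eq_setD[OF Cons.prems] by auto
  have 1: "mset s = mset (remove1 x t)"
    using Cons.prems[symmetric] by simp
  show ?case using weight_remove1[OF x] Cons.IH[OF 1] link_cong[OF 1] by simp
qed auto

lemma sum_types_cong:
  "(\<And>s. map fst s = C \<Longrightarrow> set (map snd s) \<subseteq> {..<m} \<Longrightarrow> g s = g' s) \<Longrightarrow> sum_types C g = sum_types C g'"
proof (induction C arbitrary: g g')
  case (Cons v C)
  show ?case unfolding sum_types.simps
    by (intro sum.cong refl Cons.IH Cons.prems) auto
qed auto

lemma sum_types_append: "sum_types (C @ D) g = sum_types C (\<lambda>s. sum_types D (\<lambda>t. g (s @ t)))"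
  by (induction C arbitrary: g) auto

lemma sum_types_mult: "sum_types C (\<lambda>s. c * g s) = c * sum_types C g"
  by (induction C arbitrary: g) (auto simp: sum_distrib_left)

lemma sum_types_sum: "sum_types C (\<lambda>s. \<Sum>a\<in>A. g a s) = (\<Sum>a\<in>A. sum_types C (g a))"
proof (induction C arbitrary: g)
  case (Cons v C)
  show ?case unfolding sum_types.simps Cons by (rule sum.swap)
qed auto

text \<open>If the summand ignores the order of the assignment, the sum over any one element can be
  exchanged with the earlier ones and so pulled to the front. Invariance under permutations follows
  from this.\<close>

lemma sum_types_remove1:
  assumes "v \<in> set C" "\<And>s t. mset s = mset t \<Longrightarrow> g s = g t"
  shows "sum_types C g = (\<Sum>a<m. sum_types (remove1 v C) (\<lambda>s. g ((v, a) # s)))"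
  using assms
proof (induction C arbitrary: g)
  case Nil
  show ?case using Nil(1) by simp
next
  case (Cons u C)
  show ?case
  proof (cases "u = v")
    case True
    then show ?thesis by simp
  next
    case False
    have IH: "sum_types C (\<lambda>s. g ((u, b) # s)) = (\<Sum>a<m. sum_types (remove1 v C) (\<lambda>s. g ((u, b) # (v, a) # s)))" for b
      using False Cons.prems(1) by (intro Cons.IH Cons.prems(2)) auto
    have "sum_types (u # C) g = (\<Sum>b<m. \<Sum>a<m. sum_types (remove1 v C) (\<lambda>s. g ((u, b) # (v, a) # s)))"
      by (simp only: sum_types.simps IH)
    also have "\<dots> = (\<Sum>a<m. \<Sum>b<m. sum_types (remove1 v C) (\<lambda>s. g ((v, a) # (u, b) # s)))"
      by (subst sum.swap) (intro sum.cong refl sum_types_cong Cons.prems(2), simp add: add_mset_commute)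
    also have "\<dots> = (\<Sum>a<m. sum_types (remove1 v (u # C)) (\<lambda>s. g ((v, a) # s)))"
      using False by simp
    finally show ?thesis .
  qed
qed

lemma sum_types_perm:
  assumes "mset C = mset D" "\<And>s t. mset s = mset t \<Longrightarrow> g s = g t"
  shows "sum_types C g = sum_types D g"
  using assms
proof (induction C arbitrary: D g)
  case Nil
  show ?case using Nil(1) by simp
next
  case (Cons v C)
  have v: "v \<in> set D" using mset_eq_setD[OF Cons.prems(1)] by auto
  have 1: "mset C = mset (remove1 v D)" using Cons.prems(1)[symmetric] by simp
  have "sum_types (v # C) g = (\<Sum>a<m. sum_types (remove1 v D) (\<lambda>s. g ((v, a) # s)))"
    unfolding sum_types.simps
    by (intro sum.cong refl Cons.IH 1 Cons.prems(2)) simp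
  then show ?case by (simp only: sum_types_remove1[OF v Cons.prems(2)])
qed

end

text \<open>The keys are sorted lists of types, representing multisets.\<close>

type_synonym table = "(nat list \<times> sized_real) list"

abbreviation enc_table :: "table \<Rightarrow> val" where
  "enc_table \<equiv> enc_list (enc_pair (enc_list enc_nat) enc_real)"

fun add_entry :: "nat list \<Rightarrow> sized_real \<Rightarrow> table \<Rightarrow> table" where
  "add_entry K x [] = [(K, x)]"
| "add_entry K x ((L, y) # tab) =
    (if K = L then (K, max (fst x) (fst y) + 1, snd x + snd y) # tab else (L, y) # add_entry K x tab)"

text \<open>Integration of a test function against the table. Specifications quantify over all
  \<open>h\<close>, which determines the table as a measure on multisets without a word about single
  entries.\<close>

definition table_sum :: "table \<Rightarrow> (nat list \<Rightarrow> real) \<Rightarrow> real" where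
  "table_sum tab h = (\<Sum>(K, x)\<leftarrow>tab. snd x * h K)"

lemma table_sum_simps [simp]: "table_sum [] h = 0" "table_sum ((K, x) # tab) h = snd x * h K + table_sum tab h"
  by (auto simp: table_sum_def)

lemma table_sum_add_entry: "table_sum (add_entry K x tab) h = snd x * h K + table_sum tab h"
  by (induction tab) (auto simp: algebra_simps)

definition key_ok :: "nat \<Rightarrow> nat \<Rightarrow> nat list \<Rightarrow> bool" where
  "key_ok m c K \<longleftrightarrow> sorted K \<and> length K = c \<and> set K \<subseteq> {..<m}"

text \<open>Distinctness of the keys is what keeps tables short, see \<open>length_table\<close>;
  \<open>S\<close> bounds the sizes of the stored reals.\<close>

definition table_ok :: "nat \<Rightarrow> nat \<Rightarrow> nat \<Rightarrow> table \<Rightarrow> bool" where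
  "table_ok m c S tab \<longleftrightarrow> distinct (map fst tab) \<and> (\<forall>(K, x)\<in>set tab. key_ok m c K \<and> fst x \<le> S)"

lemma table_ok_Nil [simp]: "table_ok m c S []"
  by (simp add: table_ok_def)

lemma table_ok_mono: "table_ok m c S tab \<Longrightarrow> S \<le> S' \<Longrightarrow> table_ok m c S' tab"
  unfolding table_ok_def by fastforce

lemma fst_add_entry: "fst ` set (add_entry K x tab) = insert K (fst ` set tab)"
proof (induction tab)
  case (Cons e tab)
  then show ?case by (cases e) auto
qed auto

text \<open>An addition exceeds the larger operand by one unit of size, and at most one stored real
  changes; hence \<open>Suc S\<close>.\<close>

lemma table_ok_add_entry:
  assumes "table_ok m c S tab" "key_ok m c K" "fst x \<le> S"
  shows "table_ok m c (Suc S) (add_entry K x tab)"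
  using assms(1)
proof (induction tab)
  case Nil
  then show ?case using assms by (auto simp: table_ok_def)
next
  case (Cons e tab)
  obtain L y where e: "e = (L, y)" by (cases e)
  have t: "table_ok m c S tab" using Cons.prems by (auto simp: table_ok_def)
  show ?case
  proof (cases "K = L")
    case True
    then show ?thesis using Cons.prems assms by (fastforce simp: e table_ok_def)
  next
    case False
    have "L \<notin> fst ` set (add_entry K x tab)"
      using Cons.prems False unfolding fst_add_entry by (auto simp: e table_ok_def)
    then show ?thesis using Cons.prems Cons.IH[OF t] False by (auto simp: e table_ok_def image_iff)
  qed
qed

lemma finite_keys: "finite {K. key_ok m c K}"
  by (rule finite_subset[of _ "{K. set K \<subseteq> {..<m} \<and> length K = c}"])
     (auto simp: key_ok_def intro!: finite_lists_length_eq)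

text \<open>A sorted key is determined by how often each of the \<open>m\<close> types occurs, that
  is, by \<open>m\<close> numbers between 0 and \<open>c\<close>.\<close>

lemma card_keys: "card {K. key_ok m c K} \<le> (c + 1) ^ m"
proof -
  let ?f = "\<lambda>K. map (count_list K) [0..<m]"
  have "inj_on ?f {K. key_ok m c K}"
  proof (rule inj_onI, clarify)
    fix K L assume K: "key_ok m c K" and L: "key_ok m c L" and "?f K = ?f L"
    then have *: "count_list K a = count_list L a" if "a < m" for a
      using that by auto
    have "a \<notin> set K" "a \<notin> set L" if "\<not> a < m" for a
      using K L that by (auto simp: key_ok_def)
    then have "count_list K a = count_list L a" for a
      using * by (cases "a < m") (simp_all add: count_notin)
    then have "mset K = mset L"
      by (intro multiset_eqI) (simp add: count_mset)
    then show "K = L" using K L by (metis key_ok_def properties_for_sort)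
  qed
  moreover have "?f ` {K. key_ok m c K} \<subseteq> {xs. set xs \<subseteq> {..c} \<and> length xs = m}"
    by (auto simp: key_ok_def count_le_length)
  ultimately have "card {K. key_ok m c K} \<le> card {xs. set xs \<subseteq> {..c} \<and> length xs = m}"
    by (intro card_inj_on_le) (auto intro!: finite_lists_length_eq)
  then show ?thesis by (simp add: card_lists_length_eq Suc_eq_plus1)
qed

lemma length_table:
  assumes "table_ok m c S tab"
  shows "length tab \<le> (c + 1) ^ m"
proof -
  have "length tab = card (fst ` set tab)"
    using distinct_card[of "map fst tab"] assms by (simp add: table_ok_def)
  also have "\<dots> \<le> card {K. key_ok m c K}"
    using assms by (intro card_mono finite_keys) (auto simp: table_ok_def)
  finally show ?thesis using card_keys[of m c] by linarith
qed

lemma key_ok_insort: "key_ok m c K \<Longrightarrow> a < m \<Longrightarrow> key_ok m (Suc c) (insort a K)"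
  by (auto simp: key_ok_def sorted_insort set_insort_key)

definition merge :: "nat list \<Rightarrow> nat list \<Rightarrow> nat list" where
  "merge K L = foldr insort K L"

lemma key_ok_merge: "set K \<subseteq> {..<m} \<Longrightarrow> key_ok m c' L \<Longrightarrow> key_ok m (length K + c') (merge K L)"
  by (induction K) (auto simp: merge_def key_ok_insort)

lemma mset_merge: "mset (merge K L) = mset K + mset L"
  by (induction K) (auto simp: merge_def)

lemma merge_sort: "merge (sort xs) (sort ys) = sort (xs @ ys)"
proof -
  have "sorted L \<Longrightarrow> sorted (foldr insort K L)" for K L :: "nat list"
    by (induction K) (auto simp: sorted_insort)
  then show ?thesis
    using mset_merge[of "sort xs" "sort ys"] by (intro properties_for_sort[symmetric]) (auto simp: merge_def)
qed

section \<open>Separation of the components and the halving estimate\<close>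

definition adjacent :: "nat list list \<Rightarrow> nat \<Rightarrow> nat \<Rightarrow> bool" where
  "adjacent es u v \<longleftrightarrow> (\<exists>e\<in>set es. u \<in> set e \<and> v \<in> set e)"

lemma touching_iff: "touching es v P \<longleftrightarrow> (\<exists>u\<in>set P. adjacent es v u)"
  by (auto simp: touching_def adjacent_def)

definition separate :: "nat list list \<Rightarrow> nat list \<Rightarrow> nat list \<Rightarrow> bool" where
  "separate es P Q \<longleftrightarrow> (\<forall>u\<in>set P. \<forall>v\<in>set Q. \<not> adjacent es u v)"

lemma separate_sym: "separate es P Q \<Longrightarrow> separate es Q P"
  unfolding separate_def adjacent_def by blast

lemma sorted_wrt_separate:
  "sorted_wrt (separate es) Ps \<Longrightarrow> P \<in> set Ps \<Longrightarrow> Q \<in> set Ps \<Longrightarrow> P = Q \<or> separate es P Q"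
proof (induction Ps)
  case (Cons S Ps)
  consider "P = S" "Q = S" | "P = S" "Q \<in> set Ps" | "P \<in> set Ps" "Q = S" | "P \<in> set Ps" "Q \<in> set Ps"
    using Cons.prems by auto
  then show ?case
    by cases (use Cons separate_sym[of es S P] in auto)
qed auto

text \<open>The components that are kept are not touched by the new element, and they were separate
  from the fused ones before.\<close>

lemma separate_parts: "sorted_wrt (separate es) (parts es C)"
proof (induction C)
  case (Cons v C)
  let ?P = "concat (filter (touching es v) (parts es C)) @ [v]"
  have "separate es ?P Q" if Q: "Q \<in> set (parts es C)" "\<not> touching es v Q" for Q
    unfolding separate_def
  proof (intro ballI)
    fix u u' assume u: "u \<in> set ?P" "u' \<in> set Q"
    show "\<not> adjacent es u u'"
    proof (cases "u = v")
      case True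
      then show ?thesis using Q u by (auto simp: touching_iff)
    next
      case False
      then obtain P where P: "P \<in> set (parts es C)" "touching es v P" "u \<in> set P" using u by auto
      then have "separate es P Q" using sorted_wrt_separate[OF Cons.IH] Q by blast
      then show ?thesis using P u by (simp add: separate_def)
    qed
  qed
  then show ?case using Cons by (simp add: sorted_wrt_filter)
qed auto

text \<open>Since \<open>x\<close> is at most \<open>c / 2\<close>, the factor \<open>x ^ d\<close>
  gains \<open>2 ^ d\<close> against \<open>c ^ d\<close>, which pays for the \<open>M\<close>
  repetitions. The strict inequality for the sum leaves room for the summand 1, the overhead of the
  call itself.\<close>

lemma sum_power_halves:
  fixes c d M :: nat
  assumes "\<And>x. x \<in> set xs \<Longrightarrow> 2 * x \<le> c" "sum_list xs < c" "M \<le> 2 ^ d"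
  shows "M * (\<Sum>x\<leftarrow>xs. x ^ (d + 1)) + 1 \<le> c ^ (d + 1)"
proof -
  have "2 ^ d * (\<Sum>x\<leftarrow>xs. x ^ (d + 1)) \<le> c ^ d * sum_list xs"
    using assms(1)
  proof (induction xs)
    case (Cons x xs)
    have "(2 * x) ^ d \<le> c ^ d" using Cons.prems by (intro power_mono) auto
    then have "(2 * x) ^ d * x \<le> c ^ d * x" by (rule mult_le_mono1)
    then have "2 ^ d * x ^ (d + 1) \<le> c ^ d * x"
      by (simp only: power_mult_distrib power_add power_one_right mult.assoc)
    then show ?case using Cons by (simp add: distrib_left)
  qed auto
  moreover have "M * (\<Sum>x\<leftarrow>xs. x ^ (d + 1)) \<le> 2 ^ d * (\<Sum>x\<leftarrow>xs. x ^ (d + 1))"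
    using assms(3) by (rule mult_le_mono1)
  moreover have "c ^ d * sum_list xs + 1 \<le> c ^ (d + 1)"
  proof -
    have "c ^ d * sum_list xs + c ^ d \<le> c ^ d * c"
      using assms(2) mult_le_mono2[of "sum_list xs + 1" c "c ^ d"] by (simp add: distrib_left)
    moreover have "1 \<le> c ^ d" using assms(2) by simp
    ultimately show ?thesis by (simp add: power_add mult.commute)
  qed
  ultimately show ?thesis by linarith
qed

section \<open>Running time of the table functions\<close>

context machine
begin

definition "c_insort m N = (N + 1) * (20 * (m + 1) + 40)" for m N :: nat
definition "c_merge m N = (N + 1) * (c_insort m N + 40)" for m N :: nat
definition "c_add m N L S = (L + 1) * (20 * (N * (2 * m + 2) + 1) + 60 + 2 * S)" for m N L S :: nat

lemma computes_insort:
  assumes "a < m" "length K \<le> N"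
  shows "computes f_insort [enc_nat a, enc_list enc_nat K] (enc_list enc_nat (insort a K)) (c_insort m N)"
proof -
  have 1: "computes f_leq [enc_nat a, enc_nat b] (enc_bool (a \<le> b)) (20 * (m + 1))" for b
    using computes_mono[OF computes_leq[of "enc_nat a" "enc_nat b"], of "20 * (m + 1)"] assms by simp
  have "computes f_insort [enc_nat a, enc_list enc_nat K] (enc_list enc_nat (insort a K)) ((length K + 1) * (20 * (m + 1) + 40))"
  proof (induction K)
    case Nil
    show ?case unfolding computes_def call_fun body_insort_def by simp
  next
    case (Cons y xs)
    show ?case unfolding computes_def call_fun body_insort_def
      by (auto intro!: 1[THEN call_computes] Cons[THEN call_computes])
  qed
  then show ?thesis by (rule computes_mono) (use assms in \<open>auto simp: c_insort_def intro!: mult_le_mono\<close>)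
qed

lemma computes_merge:
  assumes "set K \<subseteq> {..<m}" "length K + length L \<le> N"
  shows "computes f_merge [enc_list enc_nat K, enc_list enc_nat L] (enc_list enc_nat (merge K L)) (c_merge m N)"
proof -
  have "computes f_merge [enc_list enc_nat K, enc_list enc_nat L] (enc_list enc_nat (merge K L)) ((length K + 1) * (c_insort m N + 40))"
    using assms
  proof (induction K)
    case Nil
    show ?case unfolding computes_def call_fun body_merge_def by (simp add: merge_def)
  next
    case (Cons a K)
    have "length (merge K L) \<le> N"
      using Cons.prems mset_eq_length[of "merge K L" "K @ L"] by (simp add: mset_merge)
    then have 1: "computes f_insort [enc_nat a, enc_list enc_nat (merge K L)] (enc_list enc_nat (insort a (merge K L))) (c_insort m N)"
      using Cons.prems by (intro computes_insort) auto
    have IH: "computes f_merge [enc_list enc_nat K, enc_list enc_nat L] (enc_list enc_nat (merge K L)) ((length K + 1) * (c_insort m N + 40))"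
      using Cons by simp
    show ?case unfolding computes_def call_fun body_merge_def
      by (auto simp: merge_def intro!: 1[unfolded merge_def, THEN call_computes] IH[unfolded merge_def, THEN call_computes])
  qed
  then show ?thesis by (rule computes_mono) (use assms in \<open>auto simp: c_merge_def intro!: mult_le_mono\<close>)
qed

lemma computes_add_entry:
  assumes "table_ok m c S tab" "key_ok m c K" "s \<le> S" "c \<le> N" "length tab \<le> L"
  shows "computes f_add_entry [enc_list enc_nat K, Real s r, enc_table tab] (enc_table (add_entry K (s, r) tab)) (c_add m N L S)"
proof -
  have k: "vsize (enc_list enc_nat K) \<le> N * (2 * m + 2) + 1"
  proof -
    have "vsize (enc_list enc_nat K) \<le> length K * (2 * m + 1 + 1) + 1"
      using assms(2) by (intro vsize_enc_list) (auto simp: key_ok_def)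
    moreover have "length K * (2 * m + 1 + 1) \<le> N * (2 * m + 2)"
      using assms by (intro mult_le_mono) (auto simp: key_ok_def)
    ultimately show ?thesis by linarith
  qed
  have 1: "computes f_eq [enc_list enc_nat K, enc_list enc_nat M] (enc_bool (K = M)) (20 * (N * (2 * m + 2) + 1))" for M
    using computes_mono[OF computes_eq[of "enc_list enc_nat K" "enc_list enc_nat M"], of "20 * (N * (2 * m + 2) + 1)"] k
    by (simp add: faithfulD)
  have "computes f_add_entry [enc_list enc_nat K, Real s r, enc_table tab] (enc_table (add_entry K (s, r) tab))
    ((length tab + 1) * (20 * (N * (2 * m + 2) + 1) + 60 + 2 * S))"
    using assms(1)
  proof (induction tab)
    case Nil
    show ?case unfolding computes_def call_fun body_add_entry_def by simp
  next
    case (Cons e tab)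
    obtain M s' r' where e: "e = (M, s', r')" by (cases e)
    have s': "s' \<le> S" "table_ok m c S tab" using Cons.prems by (auto simp: e table_ok_def)
    show ?case using s' assms(3) unfolding computes_def call_fun body_add_entry_def
      by (auto simp: e intro!: 1[of M, THEN call_computes_eq] Cons.IH[OF s'(2), THEN call_computes])
  qed
  then show ?thesis by (rule computes_mono) (use assms in \<open>auto simp: c_add_def intro!: mult_le_mono\<close>)
qed

definition is_table :: "val \<Rightarrow> (table \<Rightarrow> bool) \<Rightarrow> bool" where
  "is_table v P \<longleftrightarrow> (\<exists>tab. v = enc_table tab \<and> P tab)"

definition computes_table :: "nat \<Rightarrow> val list \<Rightarrow> (table \<Rightarrow> bool) \<Rightarrow> nat \<Rightarrow> bool" where
  "computes_table f vs P b \<longleftrightarrow> call f vs (\<lambda>v t. is_table v P \<and> t \<le> b)"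

lemma is_table_enc: "P tab \<Longrightarrow> is_table (enc_table tab) P"
  by (auto simp: is_table_def)

lemma call_computes_table:
  "computes_table f vs P b \<Longrightarrow> (\<And>tab t. P tab \<Longrightarrow> t \<le> b \<Longrightarrow> Q (enc_table tab) t) \<Longrightarrow> call f vs Q"
  unfolding computes_table_def by (erule call_mono) (auto simp: is_table_def)

lemma computes_table_mono:
  "computes_table f vs P b \<Longrightarrow> (\<And>tab. P tab \<Longrightarrow> P' tab) \<Longrightarrow> b \<le> b' \<Longrightarrow> computes_table f vs P' b'"
  unfolding computes_table_def by (erule call_mono) (auto simp: is_table_def)

lemma computes_sum_table:
  assumes "table_ok m c S tab"
  shows "computes_real f_sum_table [enc_table tab] (table_sum tab (\<lambda>_. 1)) (S + length tab + 1)
    ((length tab + 1) * (2 * S + length tab + 60))"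
proof -
  have "length xs \<le> length tab \<Longrightarrow> set xs \<subseteq> set tab \<Longrightarrow>
     computes_real f_sum_table [enc_table xs] (table_sum xs (\<lambda>_. 1)) (S + length xs + 1)
      ((length xs + 1) * (2 * S + length tab + 60))" for xs
  proof (induction xs)
    case Nil
    show ?case unfolding computes_real_def call_fun body_sum_table_def by simp
  next
    case (Cons e xs)
    obtain M s r where e: "e = (M, s, r)" by (cases e)
    have s: "s \<le> S" using assms Cons.prems by (auto simp: e table_ok_def)
    have IH: "computes_real f_sum_table [enc_table xs] (table_sum xs (\<lambda>_. 1)) (S + length xs + 1)
      ((length xs + 1) * (2 * S + length tab + 60))"
      using Cons by simp
    show ?case using s Cons.prems unfolding computes_real_def call_fun body_sum_table_def
      by (auto simp: e intro!: IH[THEN call_computes_real])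
  qed
  from this[of tab] show ?thesis by simp
qed

end

section \<open>Budgets for table lengths, sizes of reals and running time\<close>

locale solver_costs =
  fixes m kk N \<rho> CF :: nat
begin

text \<open>\<open>Lt\<close> bounds the length of every table, by \<open>length_table\<close>.
  Next, \<open>s_cross\<close> bounds the size of a product of default factors, and
  \<open>s_link\<close> that of the factors of one element with the context.\<close>

definition "Lt = (N + 1) ^ m"
definition "s_cross = N * (N * \<rho> + 1) + 1"
definition "s_link = (N + 1) * \<rho>"
text \<open>Combining two tables raises sizes by at most \<open>s_cross + Lt * Lt\<close> beyond
  their sum, branching over one element by at most \<open>s_link + m * Lt\<close>, where each
  inserted entry accounts for one. The final 1 absorbs the constant term when two size bounds are
  added.\<close>

definition "G = s_cross + s_link + Lt * Lt + m * Lt + 1"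
definition "Smax = 2 * G * N + 1"

definition "c_cross1 = (N + 1) * (CF + \<rho> + N * \<rho> + 80)"
definition "c_cross = (N + 1) * (c_cross1 + 2 * s_cross + 80)"
definition "c_comb1 = (Lt + 1) * (machine.c_merge m N + c_cross + machine.c_add m N Lt Smax + 4 * Smax + 100)"
definition "c_comb = (Lt + 1) * (c_comb1 + 100)"
definition "c_link = (N + 1) * (CF + \<rho> + s_link + 80)"
definition "c_shift = (Lt + 1) * (machine.c_insort m N + machine.c_add m N Lt Smax + 2 * Smax + 100)"

definition "c_assign = machine.c_parts N + machine.c_memn N + machine.c_remove N + m * (c_link + c_shift + 100) + 100"
text \<open>
  The parts left by a balanced separator of \<open>c\<close> elements have total length at most \<open>c\<close> and length at
  most \<open>c / 2\<close> each. If each is solved at most \<open>M\<close> times, at cost \<open>Q * p ^ (M + 1)\<close> for a part of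
  length \<open>p\<close>, the total \<open>M * Q * c * (c / 2) ^ M\<close> is absorbed by \<open>Q * c ^ (M + 1)\<close> as \<open>M < 2 ^ M\<close>.
\<close>

definition "M = (2 * m + 2) ^ kk"
definition "Q = machine.c_tuples kk N + machine.c_findsep N (N ^ kk) + 100 + M * (c_assign + (N + 1) * (c_comb + 100))"

end

text \<open>The interface between recursion and logic: how factors are evaluated, that pairs without
  an edge share a factor, and that balanced tuples exist. A positive tuple length makes every
  separator meet its component.\<close>

locale solver = machine main w wbar + weighted_types m \<omega> R + solver_costs m kk N \<rho> CF
  for main w wbar m \<omega> R kk N \<rho> CF +
  fixes n :: nat and es :: "nat list list" and ULv BLv Uv Bv :: val
  assumes unary_factor: "v < n \<Longrightarrow> a < m \<Longrightarrow>
      computes_real f_factor [ULv, enc_nat a, enc_nat v, enc_nat v, Uv] (\<omega> v a) \<rho> CF"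
    and binary_factor: "u \<le> Suc n \<Longrightarrow> v \<le> Suc n \<Longrightarrow> a < m \<Longrightarrow> b < m \<Longrightarrow>
      computes_real f_factor [BLv, Node (enc_nat a) (enc_nat b), enc_nat u, enc_nat v, Bv] (R u v a b) \<rho> CF"
    and R_default: "u < n \<Longrightarrow> v < n \<Longrightarrow> u \<noteq> v \<Longrightarrow> \<not> adjacent es u v \<Longrightarrow> R u v a b = R n (Suc n) a b"
    and N: "n \<le> N" "length es \<le> N" "\<And>e. e \<in> set es \<Longrightarrow> length e \<le> N" "kk \<le> N"
    and separator: "distinct C \<Longrightarrow> set C \<subseteq> {..<n} \<Longrightarrow> C \<noteq> [] \<Longrightarrow>
      \<exists>X\<in>set (tuples kk C). balanced (parts es (remove_list X C)) C"
    and kk: "0 < kk"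
begin

definition "ctx = Node ULv (Node BLv (Node Uv (Node Bv (Node (enc_list (enc_list enc_nat) es)
  (Node (enc_nat n) (Node (enc_list enc_nat [0..<m]) (enc_nat kk)))))))"

text \<open>The numbers \<open>n\<close> and \<open>Suc n\<close> lie outside the domain and serve as a pair without evidence.\<close>

definition default_weight :: "nat \<Rightarrow> nat list \<Rightarrow> real" where
  "default_weight a K = (\<Prod>b\<leftarrow>K. R n (Suc n) a b)"

definition cross_weight :: "nat list \<Rightarrow> nat list \<Rightarrow> real" where
  "cross_weight K L = (\<Prod>a\<leftarrow>K. default_weight a L)"

lemma cross_weight_simps [simp]: "cross_weight [] L = 1" "cross_weight (a # K) L = default_weight a L * cross_weight K L"
  by (simp_all add: cross_weight_def)

lemma cross_weight_cong: "mset K = mset K' \<Longrightarrow> mset L = mset L' \<Longrightarrow> cross_weight K L = cross_weight K' L'"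
  unfolding cross_weight_def default_weight_def
  by (subst prod_list_mset_cong[of L L'], assumption) (rule prod_list_mset_cong)

lemma computes_cross1:
  assumes "a < m" "set K \<subseteq> {..<m}" "length K \<le> N"
  shows "computes_real f_cross1 [enc_nat a, enc_list enc_nat K, ctx] (default_weight a K) (length K * \<rho> + 1) c_cross1"
proof -
  have "computes_real f_cross1 [enc_nat a, enc_list enc_nat K, ctx] (default_weight a K) (length K * \<rho> + 1)
    ((length K + 1) * (CF + \<rho> + N * \<rho> + 80))"
    using assms(2,3)
  proof (induction K)
    case Nil
    show ?case unfolding computes_real_def call_fun body_cross1_def by (simp add: default_weight_def)
  next
    case (Cons b K)
    have IH: "computes_real f_cross1 [enc_nat a, enc_list enc_nat K, ctx] (default_weight a K) (length K * \<rho> + 1)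
        ((length K + 1) * (CF + \<rho> + N * \<rho> + 80))"
      using Cons by simp
    have 1: "computes_real f_factor [BLv, Node (enc_nat a) (enc_nat b), enc_nat n, Node Leaf (enc_nat n), Bv] (R n (Suc n) a b) \<rho> CF"
      using binary_factor[of n "Suc n" a b] Cons.prems assms(1) by simp
    have le: "length K * \<rho> \<le> N * \<rho>" using Cons.prems by (intro mult_le_mono1) simp
    show ?case unfolding computes_real_def call_fun body_cross1_def
      by (auto simp: default_weight_def ctx_def intro!: 1[THEN call_computes_real] IH[unfolded ctx_def default_weight_def, THEN call_computes_real])
         (use le in linarith)
  qed
  then show ?thesis by (rule computes_real_mono) (use assms in \<open>auto simp: c_cross1_def intro!: mult_le_mono\<close>)
qed

lemma computes_cross:
  assumes "set J \<subseteq> {..<m}" "length J \<le> N" "set K \<subseteq> {..<m}" "length K \<le> N"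
  shows "computes_real f_cross [enc_list enc_nat J, enc_list enc_nat K, ctx] (cross_weight J K) s_cross c_cross"
proof -
  have "computes_real f_cross [enc_list enc_nat J, enc_list enc_nat K, ctx] (cross_weight J K) (length J * (N * \<rho> + 1) + 1)
     ((length J + 1) * (c_cross1 + 2 * s_cross + 80))"
    using assms(1,2)
  proof (induction J)
    case Nil
    show ?case unfolding computes_real_def call_fun body_cross_def by simp
  next
    case (Cons b J)
    have IH: "computes_real f_cross [enc_list enc_nat J, enc_list enc_nat K, ctx] (cross_weight J K) (length J * (N * \<rho> + 1) + 1)
     ((length J + 1) * (c_cross1 + 2 * s_cross + 80))"
      using Cons by simp
    have 1: "computes_real f_cross1 [enc_nat b, enc_list enc_nat K, ctx] (default_weight b K) (N * \<rho> + 1) c_cross1"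
      by (rule computes_real_mono[OF computes_cross1]) (use Cons.prems assms in auto)
    have "(length J + 1) * q \<le> N * q" for q using Cons.prems by (intro mult_le_mono1) simp
    then have "length J * q + q \<le> N * q" for q by (simp add: distrib_right)
    from this[of "N * \<rho> + 1"] have "length J * (N * \<rho> + 1) + N * \<rho> + 1 \<le> s_cross"
      unfolding s_cross_def by simp
    then show ?case unfolding computes_real_def call_fun body_cross_def
      by (auto intro!: 1[THEN call_computes_real] IH[THEN call_computes_real])
  qed
  then show ?thesis
    by (rule computes_real_mono) (use assms in \<open>auto simp: c_cross_def s_cross_def intro!: mult_le_mono\<close>)
qed

lemma length_table_Lt: "table_ok m c S tab \<Longrightarrow> c \<le> N \<Longrightarrow> length tab \<le> Lt"
  using length_table[of m c S tab] power_mono[of "c + 1" "N + 1" m] unfolding Lt_def by linarith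

definition comb1_sum :: "nat list \<Rightarrow> real \<Rightarrow> table \<Rightarrow> (nat list \<Rightarrow> real) \<Rightarrow> real" where
  "comb1_sum J r tab h = table_sum tab (\<lambda>K. r * cross_weight J K * h (merge J K))"

text \<open>\<open>S''\<close> bounds the sizes in the accumulated table and also every new product,
  so that each insertion raises it by just one.\<close>

lemma computes_comb1:
  assumes "key_ok m c J" "s \<le> S" "c + c' \<le> N" "\<forall>(K, x)\<in>set xs. key_ok m c' K \<and> fst x \<le> S'" "length xs \<le> Lt"
    and "table_ok m (c + c') S'' acc" "S + S' + s_cross \<le> S''" "S'' + length xs \<le> Smax"
  shows "computes_table f_comb1 [enc_list enc_nat J, Real s r, enc_table xs, enc_table acc, ctx]
    (\<lambda>tab. table_ok m (c + c') (S'' + length xs) tab \<and>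
      (\<forall>h. table_sum tab h = table_sum acc h + comb1_sum J r xs h)) c_comb1"
proof -
  define B where "B = c_merge m N + c_cross + c_add m N Lt Smax + 4 * Smax + 100"
  have "computes_table f_comb1 [enc_list enc_nat J, Real s r, enc_table xs, enc_table acc, ctx]
    (\<lambda>tab. table_ok m (c + c') (S'' + length xs) tab \<and>
      (\<forall>h. table_sum tab h = table_sum acc h + comb1_sum J r xs h)) ((length xs + 1) * B)"
    using assms(4,8)
  proof (induction xs)
    case Nil
    show ?case using assms(6) unfolding computes_table_def call_fun body_comb1_def
      by (auto intro!: is_table_enc[of _ acc] simp: comb1_sum_def B_def)
  next
    case (Cons e xs)
    obtain K s' r' where e: "e = (K, s', r')" by (cases e)
    have K: "key_ok m c' K" "s' \<le> S'" using Cons.prems by (auto simp: e)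
    have J: "length J = c" "set J \<subseteq> {..<m}" using assms(1) by (auto simp: key_ok_def)
    have K': "length K = c'" "set K \<subseteq> {..<m}" using K by (auto simp: key_ok_def)
    have M: "key_ok m (c + c') (merge J K)" using key_ok_merge[of J m c' K] J K by simp
    have 1: "computes f_merge [enc_list enc_nat J, enc_list enc_nat K] (enc_list enc_nat (merge J K)) (c_merge m N)"
      using J K' assms(3) by (intro computes_merge) auto
    have 2: "computes_real f_cross [enc_list enc_nat J, enc_list enc_nat K, ctx] (cross_weight J K) s_cross c_cross"
      using J K' assms(3) by (intro computes_cross) auto
    have 3: "computes f_add_entry [enc_list enc_nat (merge J K), Real z y, enc_table tab]
        (enc_table (add_entry (merge J K) (z, y) tab)) (c_add m N Lt Smax)"
      if "table_ok m (c + c') (S'' + length xs) tab" "z \<le> s + s' + s_cross" for tab z y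
      using that Cons.prems(2) assms(2,3,7) K(2)
      by (intro computes_add_entry[OF table_ok_mono[OF that(1)] M] length_table_Lt[OF that(1)]) auto
    have sz: "s + s' + s_cross \<le> Smax" using assms Cons.prems K by auto
    have 4: "table_ok m (c + c') (Suc (S'' + length xs)) (add_entry (merge J K) (z, y) tab)"
      if "table_ok m (c + c') (S'' + length xs) tab" "z \<le> s + s' + s_cross" for tab z y
      using that assms(2,7) K(2) by (intro table_ok_add_entry[OF that(1) M]) auto
    have IH: "computes_table f_comb1 [enc_list enc_nat J, Real s r, enc_table xs, enc_table acc, ctx]
      (\<lambda>tab. table_ok m (c + c') (S'' + length xs) tab \<and>
        (\<forall>h. table_sum tab h = table_sum acc h + comb1_sum J r xs h)) ((length xs + 1) * B)"
      using Cons by simp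
    show ?case using sz unfolding computes_table_def call_fun body_comb1_def
      by (auto simp: e B_def table_sum_add_entry comb1_sum_def intro!: 1[THEN call_computes] 2[THEN call_computes_real]
         IH[THEN call_computes_table] 3[THEN call_computes] is_table_enc 4)
  qed
  then show ?thesis
    by (rule computes_table_mono) (use assms in \<open>auto simp: c_comb1_def B_def intro!: mult_le_mono\<close>)
qed

text \<open>A product of two entries and a cross factor has size at most
  \<open>S + S' + s_cross\<close>, and at most \<open>Lt * Lt\<close> insertions follow.\<close>

lemma computes_comb:
  assumes "table_ok m c S tab1" "table_ok m c' S' tab2" "c + c' \<le> N"
    and "S + S' + s_cross + Lt * Lt \<le> Smax"
  shows "computes_table f_comb [enc_table tab1, enc_table tab2, ctx]
    (\<lambda>tab. table_ok m (c + c') (S + S' + s_cross + Lt * Lt) tab \<and>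
      (\<forall>h. table_sum tab h = (\<Sum>(J, x)\<leftarrow>tab1. comb1_sum J (snd x) tab2 h))) c_comb"
proof -
  let ?S = "S + S' + s_cross"
  have l: "length tab1 \<le> Lt" "length tab2 \<le> Lt"
    using length_table_Lt[OF assms(1)] length_table_Lt[OF assms(2)] assms(3) by simp_all
  have "set xs \<subseteq> set tab1 \<Longrightarrow> length xs \<le> Lt \<Longrightarrow>
    computes_table f_comb [enc_table xs, enc_table tab2, ctx]
    (\<lambda>tab. table_ok m (c + c') (?S + length xs * length tab2) tab \<and>
      (\<forall>h. table_sum tab h = (\<Sum>(J, x)\<leftarrow>xs. comb1_sum J (snd x) tab2 h))) ((length xs + 1) * (c_comb1 + 100))" for xs
  proof (induction xs)
    case Nil
    show ?case unfolding computes_table_def call_fun body_comb_def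
      by (auto intro!: is_table_enc[of _ "[]", simplified])
  next
    case (Cons e xs)
    obtain J s r where e: "e = (J, s, r)" by (cases e)
    have J: "key_ok m c J" "s \<le> S" using assms(1) Cons.prems by (auto simp: e table_ok_def)
    have IH: "computes_table f_comb [enc_table xs, enc_table tab2, ctx]
      (\<lambda>tab. table_ok m (c + c') (?S + length xs * length tab2) tab \<and>
      (\<forall>h. table_sum tab h = (\<Sum>(J, x)\<leftarrow>xs. comb1_sum J (snd x) tab2 h))) ((length xs + 1) * (c_comb1 + 100))"
      using Cons by simp
    have "(length xs + 1) * length tab2 \<le> Lt * Lt" using Cons.prems l by (intro mult_le_mono) auto
    then have "length xs * length tab2 + length tab2 \<le> Lt * Lt" by (simp add: distrib_right)
    then have 1: "computes_table f_comb1 [enc_list enc_nat J, Real s r, enc_table tab2, enc_table acc, ctx]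
      (\<lambda>tab. table_ok m (c + c') (?S + length xs * length tab2 + length tab2) tab \<and>
      (\<forall>h. table_sum tab h = table_sum acc h + comb1_sum J r tab2 h)) c_comb1"
      if "table_ok m (c + c') (?S + length xs * length tab2) acc" for acc
      using assms J that l by (intro computes_comb1[where S = S and S' = S']) (auto simp: table_ok_def)
    show ?case unfolding computes_table_def call_fun body_comb_def
      by (auto simp: e ac_simps intro!: IH[THEN call_computes_table] 1[THEN call_computes_table] is_table_enc)
  qed
  from this[of tab1] have A: "computes_table f_comb [enc_table tab1, enc_table tab2, ctx]
    (\<lambda>tab. table_ok m (c + c') (?S + length tab1 * length tab2) tab \<and>
      (\<forall>h. table_sum tab h = (\<Sum>(J, x)\<leftarrow>tab1. comb1_sum J (snd x) tab2 h))) ((length tab1 + 1) * (c_comb1 + 100))"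
    using l by simp
  have l2: "length tab1 * length tab2 \<le> Lt * Lt" using l by (intro mult_le_mono) auto
  show ?thesis
    by (rule computes_table_mono[OF A]) (use l l2 in \<open>auto simp: c_comb_def intro!: mult_le_mono intro: table_ok_mono\<close>)
qed

lemma computes_link:
  assumes "v < n" "a < m" "\<forall>(u, b)\<in>set \<sigma>. u < n \<and> b < m" "length \<sigma> \<le> N"
  shows "computes_real f_link [enc_nat v, enc_nat a, enc_list (enc_pair enc_nat enc_nat) \<sigma>, ctx]
    (\<omega> v a * link (v, a) \<sigma>) s_link c_link"
proof -
  have "computes_real f_link [enc_nat v, enc_nat a, enc_list (enc_pair enc_nat enc_nat) \<sigma>, ctx]
    (\<omega> v a * link (v, a) \<sigma>) ((length \<sigma> + 1) * \<rho>) ((length \<sigma> + 1) * (CF + \<rho> + s_link + 80))"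
    using assms(3,4)
  proof (induction \<sigma>)
    case Nil
    have 1: "computes_real f_factor [ULv, enc_nat a, enc_nat v, enc_nat v, Uv] (\<omega> v a) \<rho> CF"
      using unary_factor[of v a] assms by simp
    show ?case unfolding computes_real_def call_fun body_link_def
      by (auto simp: ctx_def intro!: 1[THEN call_computes_real])
  next
    case (Cons y \<sigma>)
    obtain u b where y: "y = (u, b)" by (cases y)
    have 1: "computes_real f_factor [BLv, Node (enc_nat a) (enc_nat b), enc_nat v, enc_nat u, Bv] (R v u a b) \<rho> CF"
      using binary_factor[of v u a b] assms Cons.prems by (simp add: y)
    have IH: "computes_real f_link [enc_nat v, enc_nat a, enc_list (enc_pair enc_nat enc_nat) \<sigma>, ctx]
      (\<omega> v a * link (v, a) \<sigma>) ((length \<sigma> + 1) * \<rho>) ((length \<sigma> + 1) * (CF + \<rho> + s_link + 80))"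
      using Cons by simp
    have "(length \<sigma> + 1) * \<rho> \<le> s_link" unfolding s_link_def using Cons.prems by (intro mult_le_mono1) simp
    then show ?case unfolding computes_real_def call_fun body_link_def
      by (auto simp: y ctx_def intro!: 1[THEN call_computes_real] IH[unfolded ctx_def, THEN call_computes_real])
  qed
  then show ?thesis
    by (rule computes_real_mono) (use assms in \<open>auto simp: c_link_def s_link_def intro!: mult_le_mono\<close>)
qed

lemma computes_shift:
  assumes "a < m" "s \<le> s_link" "Suc c \<le> N" "table_ok m c S' xs"
    and "table_ok m (Suc c) S acc" "s_link + S' \<le> S" "S + Lt \<le> Smax"
  shows "computes_table f_shift [enc_nat a, Real s r, enc_table xs, enc_table acc]
    (\<lambda>tab. table_ok m (Suc c) (S + Lt) tab \<and>
      (\<forall>h. table_sum tab h = table_sum acc h + table_sum xs (\<lambda>K. r * h (insort a K)))) c_shift"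
proof -
  define B where "B = c_insort m N + c_add m N Lt Smax + 2 * Smax + 100"
  have l: "length xs \<le> Lt"
    using length_table_Lt[OF assms(4)] assms(3) by simp
  have "\<forall>(K, x)\<in>set xs. key_ok m c K \<and> fst x \<le> S'" using assms(4) by (auto simp: table_ok_def)
  then have "computes_table f_shift [enc_nat a, Real s r, enc_table xs, enc_table acc]
    (\<lambda>tab. table_ok m (Suc c) (S + length xs) tab \<and>
      (\<forall>h. table_sum tab h = table_sum acc h + table_sum xs (\<lambda>K. r * h (insort a K)))) ((length xs + 1) * B)"
    using l
  proof (induction xs)
    case Nil
    show ?case using assms(5) unfolding computes_table_def call_fun body_shift_def
      by (auto intro!: is_table_enc[of _ acc] simp: B_def)
  next
    case (Cons e xs)
    obtain K s' r' where e: "e = (K, s', r')" by (cases e)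
    have K: "key_ok m c K" "s' \<le> S'" using Cons.prems by (auto simp: e)
    have M: "key_ok m (Suc c) (insort a K)" using K assms by (intro key_ok_insort)
    have 1: "computes f_insort [enc_nat a, enc_list enc_nat K] (enc_list enc_nat (insort a K)) (c_insort m N)"
      using K assms(1,3) by (intro computes_insort) (auto simp: key_ok_def)
    have 3: "computes f_add_entry [enc_list enc_nat (insort a K), Real (s + s') y, enc_table tab]
        (enc_table (add_entry (insort a K) (s + s', y) tab)) (c_add m N Lt Smax)"
      if "table_ok m (Suc c) (S + length xs) tab" for tab y
      using that Cons.prems(2) assms(2,3,6,7) K(2)
      by (intro computes_add_entry[OF table_ok_mono[OF that(1)] M] length_table_Lt[OF that(1)]) auto
    have sz: "s + s' \<le> Smax" using assms Cons.prems K by auto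
    have 4: "table_ok m (Suc c) (Suc (S + length xs)) (add_entry (insort a K) (s + s', y) tab)"
      if "table_ok m (Suc c) (S + length xs) tab" for tab y
      using that assms(2,6) K(2) by (intro table_ok_add_entry[OF that(1) M]) auto
    have IH: "computes_table f_shift [enc_nat a, Real s r, enc_table xs, enc_table acc]
      (\<lambda>tab. table_ok m (Suc c) (S + length xs) tab \<and>
      (\<forall>h. table_sum tab h = table_sum acc h + table_sum xs (\<lambda>K. r * h (insort a K)))) ((length xs + 1) * B)"
      using Cons by simp
    show ?case using sz unfolding computes_table_def call_fun body_shift_def
      by (auto simp: e B_def table_sum_add_entry intro!: 1[THEN call_computes]
         IH[THEN call_computes_table] 3[THEN call_computes] is_table_enc 4)
  qed
  then show ?thesis
    by (rule computes_table_mono) (use l in \<open>auto simp: c_shift_def B_def intro!: mult_le_mono intro: table_ok_mono\<close>)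
qed

end

section \<open>Recursion on balanced separators\<close>

context solver
begin

text \<open>The table is the image of the weight under the map from an assignment to its sorted list
  of types. Pairs between \<open>C\<close> and the context \<open>\<sigma>\<close> are included,
  pairs inside \<open>\<sigma>\<close> are not.\<close>

definition good :: "nat list \<Rightarrow> (nat \<times> nat) list \<Rightarrow> nat \<Rightarrow> table \<Rightarrow> bool" where
  "good C \<sigma> S tab \<longleftrightarrow> table_ok m (length C) S tab \<and>
     (\<forall>h. table_sum tab h = sum_types C (\<lambda>s. weight s * links s \<sigma> * h (sort (map snd s))))"

text \<open>Elements may be reordered because the integrand sees an assignment only as a
  multiset.\<close>

lemma good_cong:
  assumes "mset C = mset D" "good C \<sigma> S tab"
  shows "good D \<sigma> S tab"
proof -
  have "weight s * links s \<sigma> * h (sort (map snd s)) = weight t * links t \<sigma> * h (sort (map snd t))"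
    if "mset s = mset t" for s t :: "(nat \<times> nat) list" and h :: "nat list \<Rightarrow> real"
  proof -
    have "mset (map snd s) = mset (map snd t)" using that by simp
    then have "sort (map snd s) = sort (map snd t)" by (intro properties_for_sort) simp_all
    then show ?thesis by (simp add: weight_cong[OF that] links_cong[OF that])
  qed
  then have "sum_types C (\<lambda>s. weight s * links s \<sigma> * h (sort (map snd s))) =
      sum_types D (\<lambda>s. weight s * links s \<sigma> * h (sort (map snd s)))" for h :: "nat list \<Rightarrow> real"
    by (intro sum_types_perm[OF assms(1)])
  then show ?thesis
    using assms(2) mset_eq_length[OF assms(1)] unfolding good_def by simp
qed

lemma good_mono: "good C \<sigma> S tab \<Longrightarrow> S \<le> S' \<Longrightarrow> good C \<sigma> S' tab"
  by (auto simp: good_def intro: table_ok_mono)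

lemma links_default:
  assumes "separate es C D" "set C \<subseteq> {..<n}" "set D \<subseteq> {..<n}" "set C \<inter> set D = {}" "map fst s = C" "map fst t = D"
  shows "links s t = cross_weight (map snd s) (map snd t)"
proof -
  have "link x t = default_weight (snd x) (map snd t)" if "x \<in> set s" for x
  proof -
    have x: "fst x \<in> set C" using that assms(5) by auto
    have "R (fst x) (fst y) (snd x) (snd y) = R n (Suc n) (snd x) (snd y)" if "y \<in> set t" for y
    proof -
      have "fst y \<in> set D" using that assms(6) by auto
      then show ?thesis using x assms(1-4) by (intro R_default) (auto simp: separate_def)
    qed
    then show ?thesis unfolding link_def default_weight_def by (auto intro!: arg_cong[of _ _ prod_list])
  qed
  then show ?thesis unfolding links_def cross_weight_def by (auto intro!: arg_cong[of _ _ prod_list])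
qed

text \<open>Testing the combined table with \<open>h\<close> amounts to testing the first table with
  a function that itself tests the second. Unfolding both specifications gives an iterated sum, in
  which the cross weight supplies exactly the pairs between \<open>C\<close> and
  \<open>D\<close>.\<close>

lemma good_comb:
  assumes "good C \<sigma> S tab1" "good D \<sigma> S' tab2"
    and "separate es C D" "set C \<subseteq> {..<n}" "set D \<subseteq> {..<n}" "set C \<inter> set D = {}"
    and "table_ok m (length C + length D) S'' tab"
    and "\<forall>h. table_sum tab h = (\<Sum>(J, x)\<leftarrow>tab1. comb1_sum J (snd x) tab2 h)"
  shows "good (C @ D) \<sigma> S'' tab"
  unfolding good_def
proof (intro conjI allI)
  fix h
  have "table_sum tab h = (\<Sum>(J, x)\<leftarrow>tab1. snd x * table_sum tab2 (\<lambda>K. cross_weight J K * h (merge J K)))"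
    using assms(8) by (simp add: comb1_sum_def table_sum_def sum_list_const_mult[symmetric] case_prod_unfold mult.assoc mult.left_commute)
  also have "\<dots> = table_sum tab1 (\<lambda>J. table_sum tab2 (\<lambda>K. cross_weight J K * h (merge J K)))"
    by (simp add: table_sum_def)
  also have "\<dots> = sum_types C (\<lambda>s. weight s * links s \<sigma> * sum_types D (\<lambda>t. weight t * links t \<sigma> *
      (cross_weight (sort (map snd s)) (sort (map snd t)) * h (merge (sort (map snd s)) (sort (map snd t))))))"
    using assms(1,2) by (simp add: good_def)
  also have "\<dots> = sum_types C (\<lambda>s. sum_types D (\<lambda>t. weight s * links s \<sigma> * (weight t * links t \<sigma> *
      (cross_weight (sort (map snd s)) (sort (map snd t)) * h (merge (sort (map snd s)) (sort (map snd t)))))))"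
    by (simp add: sum_types_mult)
  also have "\<dots> = sum_types C (\<lambda>s. sum_types D (\<lambda>t. weight (s @ t) * links (s @ t) \<sigma> * h (sort (map snd (s @ t)))))"
  proof (intro sum_types_cong)
    fix s t :: "(nat \<times> nat) list"
    assume st: "map fst s = C" "map fst t = D"
    have "cross_weight (sort (map snd s)) (sort (map snd t)) = cross_weight (map snd s) (map snd t)"
      by (rule cross_weight_cong) auto
    also have "\<dots> = links s t"
      using links_default[OF assms(3-6) st] by simp
    finally show "weight s * links s \<sigma> * (weight t * links t \<sigma> *
        (cross_weight (sort (map snd s)) (sort (map snd t)) * h (merge (sort (map snd s)) (sort (map snd t))))) =
      weight (s @ t) * links (s @ t) \<sigma> * h (sort (map snd (s @ t)))"
      by (simp add: weight_append merge_sort ac_simps)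
  qed
  also have "\<dots> = sum_types (C @ D) (\<lambda>s. weight s * links s \<sigma> * h (sort (map snd s)))"
    by (simp add: sum_types_append)
  finally show "table_sum tab h = \<dots>" .
qed (use assms in simp)

lemma good_Nil: "good [] \<sigma> 1 [([], 1, 1)]"
  by (auto simp: good_def table_ok_def key_ok_def table_sum_def)

definition context_ok :: "(nat \<times> nat) list \<Rightarrow> nat list \<Rightarrow> bool" where
  "context_ok \<sigma> C \<longleftrightarrow> distinct C \<and> set C \<subseteq> {..<n} \<and> length \<sigma> + length C \<le> N \<and> (\<forall>(u, b)\<in>set \<sigma>. u < n \<and> b < m)"

abbreviation "enc_context \<equiv> enc_list (enc_pair enc_nat enc_nat)"

text \<open>Every element is allotted \<open>2 * G\<close>. An element of the separator spends one
  share on the branching over its type; the other one is saved for combining the finished table with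
  those of the sibling parts.\<close>

abbreviation "size_bound C \<equiv> 2 * G * length C + 1"

lemma size_bound_Smax: "length C \<le> N \<Longrightarrow> size_bound C \<le> Smax"
  by (simp add: Smax_def)

text \<open>Each solved part comes with slack \<open>G\<close> in its size bound, and this slack is
  used up when its table is combined with that of the remaining parts. The cost function
  \<open>T\<close> is left open for the induction in \<open>computes_solve\<close>.\<close>

lemma computes_solve_all:
  assumes "\<And>P. P \<in> set Ps \<Longrightarrow> P \<noteq> [] \<and>
     computes_table f_solve [enc_list enc_nat P, enc_context \<sigma>, ctx] (\<lambda>tab. \<exists>S. S + G \<le> size_bound P \<and> good P \<sigma> S tab) (T (length P))"
    and "sorted_wrt (separate es) Ps" "distinct (concat Ps)" "set (concat Ps) \<subseteq> {..<n}" "length (concat Ps) \<le> N"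
  shows "computes_table f_solve_all [enc_list (enc_list enc_nat) Ps, enc_context \<sigma>, ctx]
    (good (concat Ps) \<sigma> (size_bound (concat Ps))) ((\<Sum>P\<leftarrow>Ps. T (length P)) + (length Ps + 1) * (c_comb + 100))"
  using assms
proof (induction Ps)
  case Nil
  show ?case unfolding computes_table_def call_fun body_solve_all_def
    by (auto intro!: is_table_enc[of _ "[([], 1, 1)]", simplified] good_Nil)
next
  case (Cons P Ps)
  have l: "length P + length (concat Ps) \<le> N" using Cons.prems by simp
  have IH: "computes_table f_solve_all [enc_list (enc_list enc_nat) Ps, enc_context \<sigma>, ctx]
    (good (concat Ps) \<sigma> (size_bound (concat Ps))) ((\<Sum>P\<leftarrow>Ps. T (length P)) + (length Ps + 1) * (c_comb + 100))"
    using Cons.prems by (intro Cons.IH) auto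
  have 1: "computes_table f_solve [enc_list enc_nat P, enc_context \<sigma>, ctx] (\<lambda>tab. \<exists>S. S + G \<le> size_bound P \<and> good P \<sigma> S tab) (T (length P))"
    using Cons.prems(1)[of P] by simp
  have sep: "separate es P (concat Ps)"
    using Cons.prems(2) by (auto simp: separate_def)
  have 2: "computes_table f_comb [enc_table tab1, enc_table tab2, ctx] (good (concat (P # Ps)) \<sigma> (size_bound (concat (P # Ps)))) c_comb"
    if t1: "\<exists>S. S + G \<le> size_bound P \<and> good P \<sigma> S tab1" and t2: "good (concat Ps) \<sigma> (size_bound (concat Ps)) tab2" for tab1 tab2
  proof -
    obtain S where S: "S + G \<le> size_bound P" "good P \<sigma> S tab1" using t1 by blast
    \<comment> \<open>The slack pays for \<open>s_cross + Lt * Lt\<close>, and the final 1 in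
      \<open>G\<close> for the second of the two constant terms.\<close>
    have b: "S + size_bound (concat Ps) + s_cross + Lt * Lt \<le> size_bound (concat (P # Ps))"
      using S(1) by (simp add: G_def algebra_simps)
    have b': "S + size_bound (concat Ps) + s_cross + Lt * Lt \<le> Smax"
      using b size_bound_Smax[of "concat (P # Ps)"] l by simp
    have "good (P @ concat Ps) \<sigma> (S + size_bound (concat Ps) + s_cross + Lt * Lt) tab"
      if "table_ok m (length P + length (concat Ps)) (S + size_bound (concat Ps) + s_cross + Lt * Lt) tab"
        "\<forall>h. table_sum tab h = (\<Sum>(J, x)\<leftarrow>tab1. comb1_sum J (snd x) tab2 h)" for tab
      using good_comb[OF S(2) t2 sep _ _ _ that] Cons.prems by auto
    then have "good (concat (P # Ps)) \<sigma> (size_bound (concat (P # Ps))) tab"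
      if "table_ok m (length P + length (concat Ps)) (S + size_bound (concat Ps) + s_cross + Lt * Lt) tab"
        "\<forall>h. table_sum tab h = (\<Sum>(J, x)\<leftarrow>tab1. comb1_sum J (snd x) tab2 h)" for tab
      using that good_mono[OF _ b] by simp
    then show ?thesis
      using S(2) t2 l b' unfolding good_def
      by (intro computes_table_mono[OF computes_comb[of "length P" S tab1 "length (concat Ps)" "size_bound (concat Ps)" tab2]]) auto
  qed
  show ?case unfolding computes_table_def call_fun body_solve_all_def
    by (auto intro!: 1[THEN call_computes_table] 2[THEN call_computes_table] IH[THEN call_computes_table] is_table_enc)
qed

text \<open>The slack \<open>G\<close> arises here: a typed element brings \<open>2 * G\<close>, of
  which its branching uses at most \<open>G\<close>. Nothing is gained if the tuple misses
  \<open>C\<close>, hence the case distinction. \<open>H\<close> is the cost of solving the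
  components once.\<close>

lemma computes_assign:
  assumes "context_ok \<sigma> C" "length X \<le> N" "set X \<subseteq> {..<n}"
    and "\<And>\<tau>. context_ok \<tau> (remove_list X C) \<Longrightarrow>
       computes_table f_solve_all [enc_list (enc_list enc_nat) (parts es (remove_list X C)), enc_context \<tau>, ctx]
         (good (remove_list X C) \<tau> (size_bound (remove_list X C))) H"
  shows "computes_table f_assign [enc_list enc_nat X, enc_list enc_nat C, enc_context \<sigma>, ctx]
    (\<lambda>tab. \<exists>S. S + (if set X \<inter> set C = {} then 0 else G) \<le> size_bound C \<and> good C \<sigma> S tab)
    ((2 * m + 2) ^ length X * (H + c_assign))"
  using assms
proof (induction X arbitrary: C \<sigma>)
  case Nil
  have C: "length C \<le> N" "set C \<subseteq> {..<n}" using Nil by (auto simp: context_ok_def)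
  have 1: "computes f_parts [enc_list enc_nat C, enc_list (enc_list enc_nat) es] (enc_list (enc_list enc_nat) (parts es C)) (c_parts N)"
    using C N by (intro computes_parts) auto
  have 2: "computes_table f_solve_all [enc_list (enc_list enc_nat) (parts es C), enc_context \<sigma>, ctx]
         (good C \<sigma> (size_bound C)) H"
    using Nil(4)[of \<sigma>] Nil(1) by (simp add: remove_list_def)
  show ?case unfolding computes_table_def call_fun body_assign_def
    by (auto simp: ctx_def c_assign_def intro!: 1[THEN call_computes] 2[unfolded ctx_def, THEN call_computes_table] is_table_enc)
next
  case (Cons v X)
  \<comment> \<open>The factor per tuple entry is \<open>2 * m + 2\<close> instead of
    \<open>m\<close>: as \<open>B\<close> contains \<open>c_assign\<close>, one further
    \<open>B\<close> pays for the overhead at this node, and the factor is at least 2 for the case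
    that the entry is skipped.\<close>
  define B where "B = (2 * m + 2) ^ length X * (H + c_assign)"
  have B: "H + c_assign \<le> B" unfolding B_def by simp
  have B2: "2 * B \<le> (2 * m + 2) * B" by simp
  have BX: "(2 * m + 2) ^ length (v # X) * (H + c_assign) = (2 * m + 2) * B"
    unfolding B_def by (simp only: list.size(4) power_Suc mult.assoc add_0_right add_Suc_right)
  have vX: "v < n" "set X \<subseteq> {..<n}" "length X \<le> N" using Cons.prems by auto
  have C: "length C \<le> N" "set C \<subseteq> {..<n}" "distinct C" using Cons.prems by (auto simp: context_ok_def)
  \<comment> \<open>The hypothesis about the components speaks of the list left at the end; it is
    the same list whether the first entry is removed first or last.\<close>
  have r: "remove_list X (removeAll v C) = remove_list (v # X) C"
  proof -
    have "removeAll x (removeAll y xs) = removeAll y (removeAll x xs)" for x y and xs :: "nat list"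
      by (induction xs) auto
    then have "removeAll v (remove_list X C) = remove_list X (removeAll v C)" for X
      by (induction X) (simp_all add: remove_list_def)
    then show ?thesis by (simp add: remove_list_def)
  qed
  have m: "computes f_mem [enc_nat v, enc_list enc_nat C] (enc_bool (v \<in> set C)) (c_memn N)"
    using vX C N by (intro computes_mem_nat) auto
  show ?case
  proof (cases "v \<in> set C")
    case False
    then have rC: "removeAll v C = C" by simp
    have IH: "computes_table f_assign [enc_list enc_nat X, enc_list enc_nat C, enc_context \<sigma>, ctx]
        (\<lambda>tab. \<exists>S. S + (if set X \<inter> set C = {} then 0 else G) \<le> size_bound C \<and> good C \<sigma> S tab) B"
      using Cons.prems vX r unfolding rC B_def by (intro Cons.IH) auto
    have t: "c_memn N + B + 50 \<le> (2 * m + 2) * B"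
      using B B2 unfolding c_assign_def by linarith
    define P where "P tab \<longleftrightarrow> (\<exists>S. S + (if set X \<inter> set C = {} then 0 else G) \<le> size_bound C \<and> good C \<sigma> S tab)" for tab
    have e: "set (v # X) \<inter> set C = set X \<inter> set C" using False by simp
    show ?thesis using False t unfolding BX e P_def[symmetric] computes_table_def call_fun body_assign_def
      by (auto intro!: m[THEN call_computes] IH[folded P_def, THEN call_computes_table] is_table_enc)
  next
    case True
    let ?C = "removeAll v C"
    have mC: "mset (v # ?C) = mset C"
      using True by (simp flip: distinct_remove1_removeAll[OF C(3)])
    have lC: "length C = Suc (length ?C)"
      using mset_eq_length[OF mC] by simp
    have lCN: "Suc (length ?C) \<le> N" using C lC by simp
    have ctx_ok: "context_ok ((v, a) # \<sigma>) ?C" if "a < m" for a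
      using Cons.prems(1) lC vX that by (auto simp: context_ok_def distinct_removeAll)
    have \<sigma>: "\<forall>(u, b)\<in>set \<sigma>. u < n \<and> b < m" "length \<sigma> \<le> N" using Cons.prems(1) by (auto simp: context_ok_def)
    have IH: "computes_table f_assign [enc_list enc_nat X, enc_list enc_nat ?C, enc_context ((v, a) # \<sigma>), ctx]
        (good ?C ((v, a) # \<sigma>) (size_bound ?C)) B" if "a < m" for a
    proof -
      have "computes_table f_assign [enc_list enc_nat X, enc_list enc_nat ?C, enc_context ((v, a) # \<sigma>), ctx]
        (\<lambda>tab. \<exists>S. S + (if set X \<inter> set ?C = {} then 0 else G) \<le> size_bound ?C \<and> good ?C ((v, a) # \<sigma>) S tab) B"
        using Cons.prems(4) vX ctx_ok[OF that] r unfolding B_def by (intro Cons.IH) auto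
      then show ?thesis by (rule computes_table_mono) (auto intro: good_mono)
    qed
    let ?g = "\<lambda>h a. sum_types ?C (\<lambda>s. weight ((v, a) # s) * links ((v, a) # s) \<sigma> * h (sort (map snd ((v, a) # s))))"
    let ?S = "s_link + size_bound ?C"
    have sS: "?S + m * Lt + G \<le> size_bound C" by (simp add: lC G_def algebra_simps)
    have sS': "?S + m * Lt \<le> Smax" using sS size_bound_Smax[of C] C by simp
    have br: "set ts \<subseteq> {..<m} \<Longrightarrow> length ts \<le> m \<Longrightarrow>
       computes_table f_branch [enc_list enc_nat ts, enc_nat v, enc_list enc_nat X, enc_list enc_nat ?C, enc_context \<sigma>, ctx]
        (\<lambda>tab. table_ok m (length C) (?S + length ts * Lt) tab \<and> (\<forall>h. table_sum tab h = (\<Sum>a\<leftarrow>ts. ?g h a)))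
        (length ts * (B + c_link + c_shift + 100) + 50)" for ts
    proof (induction ts)
      case Nil
      show ?case unfolding computes_table_def call_fun body_branch_def
        by (auto intro!: is_table_enc[of _ "[]", simplified])
    next
      case (Cons a ts)
      have a: "a < m" using Cons.prems by simp
      have 1: "computes_real f_link [enc_nat v, enc_nat a, enc_context \<sigma>, ctx] (\<omega> v a * link (v, a) \<sigma>) s_link c_link"
        by (intro computes_link vX a \<sigma>)
      note 2 = IH[OF a, simplified]
      have 3: "computes_table f_branch [enc_list enc_nat ts, enc_nat v, enc_list enc_nat X, enc_list enc_nat ?C, enc_context \<sigma>, ctx]
        (\<lambda>tab. table_ok m (length C) (?S + length ts * Lt) tab \<and> (\<forall>h. table_sum tab h = (\<Sum>a\<leftarrow>ts. ?g h a)))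
        (length ts * (B + c_link + c_shift + 100) + 50)"
        using Cons by simp
      have "(length ts + 1) * Lt \<le> m * Lt" using Cons.prems by (intro mult_le_mono1) simp
      then have lt: "?S + length ts * Lt + Lt \<le> Smax" using sS' by (simp add: distrib_right)
      have 4: "computes_table f_shift [enc_nat a, Real s (\<omega> v a * link (v, a) \<sigma>), enc_table tab, enc_table acc]
        (\<lambda>tab. table_ok m (length C) (?S + length (a # ts) * Lt) tab \<and> (\<forall>h. table_sum tab h = (\<Sum>a\<leftarrow>a # ts. ?g h a))) c_shift"
        if "s \<le> s_link" "good ?C ((v, a) # \<sigma>) (size_bound ?C) tab" "table_ok m (length C) (?S + length ts * Lt) acc"
          "\<forall>h. table_sum acc h = (\<Sum>a\<leftarrow>ts. ?g h a)" for s tab acc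
      proof -
        \<comment> \<open>In the table for the smaller list, \<open>v\<close> belongs to the
          context. Its pairs with that list are therefore included already, and only
          \<open>\<omega> v a\<close> and the links from \<open>v\<close> to \<open>\<sigma>\<close>
          are multiplied in.\<close>
        have g: "table_sum tab (\<lambda>K. \<omega> v a * link (v, a) \<sigma> * h (insort a K)) = ?g h a" for h
        proof -
          have "table_sum tab (\<lambda>K. \<omega> v a * link (v, a) \<sigma> * h (insort a K)) =
            sum_types ?C (\<lambda>s. weight s * links s ((v, a) # \<sigma>) * (\<omega> v a * link (v, a) \<sigma> * h (insort a (sort (map snd s)))))"
            using that(2) by (simp add: good_def)
          also have "\<dots> = ?g h a"
            by (intro sum_types_cong) (simp add: links_Cons2 ac_simps)
          finally show ?thesis .
        qed
        have "computes_table f_shift [enc_nat a, Real s (\<omega> v a * link (v, a) \<sigma>), enc_table tab, enc_table acc]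
          (\<lambda>tab'. table_ok m (Suc (length ?C)) (?S + length ts * Lt + Lt) tab' \<and>
            (\<forall>h. table_sum tab' h = table_sum acc h + table_sum tab (\<lambda>K. \<omega> v a * link (v, a) \<sigma> * h (insort a K)))) c_shift"
          using that lC a lt lCN by (intro computes_shift[where S' = "size_bound ?C"]) (auto simp: good_def)
        then show ?thesis
          by (rule computes_table_mono) (use that g in \<open>auto simp: lC algebra_simps\<close>)
      qed
      show ?case unfolding computes_table_def call_fun body_branch_def
        by (auto intro!: 1[THEN call_computes_real] 2[THEN call_computes_table] 3[THEN call_computes_table] 4[THEN call_computes_table] is_table_enc)
    qed
    have br': "computes_table f_branch [enc_list enc_nat [0..<m], enc_nat v, enc_list enc_nat X, enc_list enc_nat ?C, enc_context \<sigma>, ctx]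
        (\<lambda>tab. \<exists>S. S + G \<le> size_bound C \<and> good C \<sigma> S tab) (m * (B + c_link + c_shift + 100) + 50)"
    proof -
      have "good C \<sigma> (?S + m * Lt) tab"
        if "table_ok m (length C) (?S + m * Lt) tab" "\<forall>h. table_sum tab h = (\<Sum>a\<leftarrow>[0..<m]. ?g h a)" for tab
      proof (rule good_cong[OF mC])
        show "good (v # ?C) \<sigma> (?S + m * Lt) tab"
          using that unfolding good_def by (simp add: lC interv_sum_list_conv_sum_set_nat atLeast0LessThan)
      qed
      then have g: "\<exists>S. S + G \<le> size_bound C \<and> good C \<sigma> S tab"
        if "table_ok m (length C) (?S + m * Lt) tab" "\<forall>h. table_sum tab h = (\<Sum>a\<leftarrow>[0..<m]. ?g h a)" for tab
        using that sS by blast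
      have "set [0..<m] \<subseteq> {..<m}" "length [0..<m] \<le> m" by auto
      then show ?thesis
        by (rule computes_table_mono[OF br]) (unfold length_upt diff_zero, elim conjE, rule g, assumption+, rule order_refl)
    qed
    have rm: "computes f_remove [enc_nat v, enc_list enc_nat C] (enc_list enc_nat ?C) (c_remove N)"
      using vX C N by (intro computes_remove) auto
    have "m * (c_link + c_shift + 100) + c_memn N + c_remove N + 100 \<le> B"
      using B unfolding c_assign_def by linarith
    then have t: "c_memn N + c_remove N + m * (B + c_link + c_shift + 100) + 100 \<le> (2 * m + 2) * B"
      by (simp add: algebra_simps)
    show ?thesis using True t unfolding BX computes_table_def call_fun body_assign_def
      by (auto simp: ctx_def intro!: m[THEN call_computes] rm[THEN call_computes] br'[unfolded ctx_def, THEN call_computes_table] is_table_enc)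
  qed
qed

text \<open>Strong induction on the length, as the parts are at most half as long. \<open>M\<close>
  depends on \<open>m\<close> and \<open>kk\<close> only, so the exponent is a constant.\<close>

lemma computes_solve:
  assumes "context_ok \<sigma> C" "C \<noteq> []"
  shows "computes_table f_solve [enc_list enc_nat C, enc_context \<sigma>, ctx]
    (\<lambda>tab. \<exists>S. S + G \<le> size_bound C \<and> good C \<sigma> S tab) (Q * length C ^ (M + 1))"
  using assms
proof (induction "length C" arbitrary: C \<sigma> rule: less_induct)
  case less
  have C: "distinct C" "set C \<subseteq> {..<n}" "length C \<le> N" using less.prems by (auto simp: context_ok_def)
  have CN: "set C \<subseteq> {..N}" using C N by auto
  let ?Xs = "tuples kk C"
  have Xs: "length X = kk \<and> set X \<subseteq> set C" if "X \<in> set ?Xs" for X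
    using that by (auto simp: set_tuples)
  have Xs': "length X \<le> N \<and> set X \<subseteq> {..N}" if "X \<in> set ?Xs" for X
    using Xs[OF that] CN N(4) by auto
  have "\<exists>X\<in>set ?Xs. balanced (parts es (remove_list X C)) C \<and>
    computes f_find_separator [enc_list (enc_list enc_nat) ?Xs, enc_list enc_nat C, enc_list (enc_list enc_nat) es]
    (enc_list enc_nat X) (c_findsep N (length ?Xs))"
    using Xs' by (intro computes_find_separator C CN N separator less.prems(2)) auto
  then obtain X where X: "X \<in> set ?Xs" "balanced (parts es (remove_list X C)) C"
    and fs: "computes f_find_separator [enc_list (enc_list enc_nat) ?Xs, enc_list enc_nat C, enc_list (enc_list enc_nat) es]
    (enc_list enc_nat X) (c_findsep N (length ?Xs))" by blast
  have "length C ^ kk \<le> N ^ kk" using C by (intro power_mono) auto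
  then have fs: "computes f_find_separator [enc_list (enc_list enc_nat) ?Xs, enc_list enc_nat C, enc_list (enc_list enc_nat) es]
    (enc_list enc_nat X) (c_findsep N (N ^ kk))"
    by (intro computes_mono[OF fs]) (auto simp: c_findsep_def simp del: mult_Suc intro!: mult_le_mono)
  have tup: "computes f_tuples [enc_nat kk, enc_list enc_nat C] (enc_list (enc_list enc_nat) ?Xs) (c_tuples kk N)"
    using C by (intro computes_tuples)
  let ?D = "remove_list X C"
  let ?Ps = "parts es ?D"
  have X': "length X = kk" "set X \<subseteq> set C" using Xs X by auto
  \<comment> \<open>The tuple is drawn from \<open>C\<close> and has positive length, so
    \<open>computes_assign\<close> delivers the slack \<open>G\<close> and the parts have total
    length below that of \<open>C\<close>.\<close>
  have XC: "set X \<inter> set C \<noteq> {}" using X' kk by (cases X) auto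
  have D: "distinct ?D" "set ?D \<subset> set C" "distinct (concat ?Ps)" "set (concat ?Ps) = set ?D"
    using C XC mset_eq_setD[OF mset_parts[of es ?D]] mset_eq_imp_distinct_iff[OF mset_parts[of es ?D]] by auto
  have lD: "length ?D < length C"
    using D(1,2) C(1) by (metis distinct_card finite_set psubset_card_mono)
  have lP: "length ?Ps \<le> N" using length_parts[of es ?D] lD C by linarith
  have lcP: "length (concat ?Ps) = length ?D" using mset_eq_length[OF mset_parts] .
  define H where "H = (\<Sum>P\<leftarrow>?Ps. Q * length P ^ (M + 1)) + (length ?Ps + 1) * (c_comb + 100)"
  have "computes_table f_solve_all [enc_list (enc_list enc_nat) ?Ps, enc_context \<tau>, ctx]
         (good ?D \<tau> (size_bound ?D)) H" if \<tau>: "context_ok \<tau> ?D" for \<tau>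
  proof -
    have "P \<noteq> [] \<and>
      computes_table f_solve [enc_list enc_nat P, enc_context \<tau>, ctx] (\<lambda>tab. \<exists>S. S + G \<le> size_bound P \<and> good P \<tau> S tab) (Q * length P ^ (M + 1))"
      if P: "P \<in> set ?Ps" for P
    proof
      show ne: "P \<noteq> []" using parts_nonempty[of es ?D] P by auto
      have "2 * length P \<le> length C" using X P by (auto simp: balanced_def)
      then have "length P < length C" using less.prems(2) by (cases C) auto
      moreover have "context_ok \<tau> P"
        using \<tau> P D length_part[OF P] by (auto simp: context_ok_def distinct_concat_iff)
      ultimately show "computes_table f_solve [enc_list enc_nat P, enc_context \<tau>, ctx]
        (\<lambda>tab. \<exists>S. S + G \<le> size_bound P \<and> good P \<tau> S tab) (Q * length P ^ (M + 1))"
        using ne by (intro less.hyps)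
    qed
    then have "computes_table f_solve_all [enc_list (enc_list enc_nat) ?Ps, enc_context \<tau>, ctx]
         (good (concat ?Ps) \<tau> (size_bound (concat ?Ps))) H"
      unfolding H_def using D C lcP lD
      by (intro computes_solve_all[where T = "\<lambda>l. Q * l ^ (M + 1)"] separate_parts) auto
    then show ?thesis
      by (rule computes_table_mono) (auto simp: lcP intro: good_cong[OF mset_parts])
  qed
  then have as: "computes_table f_assign [enc_list enc_nat X, enc_list enc_nat C, enc_context \<sigma>, ctx]
    (\<lambda>tab. \<exists>S. S + G \<le> size_bound C \<and> good C \<sigma> S tab) (M * (H + c_assign))"
    using computes_assign[OF less.prems(1), of X H] X' N C XC by (simp add: M_def)
  \<comment> \<open>\<open>Q\<close> collects the cost outside the recursive calls. It enters once,
    through the summand 1 that \<open>sum_power_halves\<close> leaves free.\<close>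
  have cost: "c_tuples kk N + c_findsep N (N ^ kk) + M * (H + c_assign) + 100 \<le> Q * length C ^ (M + 1)"
  proof -
    let ?xs = "map length ?Ps"
    have "M \<le> 2 ^ M" by (rule less_imp_le) (rule less_exp)
    moreover have "2 * x \<le> length C" if "x \<in> set ?xs" for x
      using X(2) that by (auto simp: balanced_def)
    ultimately have *: "M * (\<Sum>x\<leftarrow>?xs. x ^ (M + 1)) + 1 \<le> length C ^ (M + 1)"
      using lD by (intro sum_power_halves) (auto simp: sum_length_parts)
    have "(length ?Ps + 1) * (c_comb + 100) \<le> (N + 1) * (c_comb + 100)" using lP by (intro mult_le_mono1) simp
    then have "M * (H + c_assign) \<le> M * (Q * (\<Sum>x\<leftarrow>?xs. x ^ (M + 1)) + (N + 1) * (c_comb + 100) + c_assign)"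
      unfolding H_def by (intro mult_le_mono2) (simp add: comp_def sum_list_const_mult)
    also have "\<dots> = Q * (M * (\<Sum>x\<leftarrow>?xs. x ^ (M + 1))) + M * (c_assign + (N + 1) * (c_comb + 100))"
      by (simp only: distrib_left mult.left_commute add.commute add.left_commute)
    finally have "c_tuples kk N + c_findsep N (N ^ kk) + M * (H + c_assign) + 100 \<le> Q * (M * (\<Sum>x\<leftarrow>?xs. x ^ (M + 1))) + Q"
      unfolding Q_def[symmetric] using Q_def by linarith
    also have "\<dots> = Q * (M * (\<Sum>x\<leftarrow>?xs. x ^ (M + 1)) + 1)" by (simp only: distrib_left mult_1_right)
    also have "\<dots> \<le> Q * length C ^ (M + 1)" using * by (rule mult_le_mono2)
    finally show ?thesis .
  qed
  obtain v C' where vC: "C = v # C'" using less.prems(2) neq_Nil_conv[of C] by blast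
  show ?case using cost unfolding computes_table_def call_fun body_solve_def
    by (auto simp: vC ctx_def intro!: tup[unfolded vC, simplified, THEN call_computes] fs[unfolded vC, simplified, THEN call_computes]
      as[unfolded vC ctx_def, simplified, THEN call_computes_table] is_table_enc)
qed

lemma computes_solve_range:
  "computes_table f_solve [enc_list enc_nat (rev [0..<n]), Leaf, ctx]
    (\<lambda>tab. table_ok m n (Smax + 1) tab \<and> table_sum tab (\<lambda>_. 1) = sum_types (rev [0..<n]) weight) (Q * (N + 1) ^ (M + 1) + 50)"
proof (cases "n = 0")
  case True
  have "table_ok m 0 (Smax + 1) [([], 1, 1)]" by (simp add: table_ok_def key_ok_def)
  then show ?thesis unfolding computes_table_def call_fun body_solve_def
    by (auto simp: True intro!: is_table_enc[of _ "[([], 1, 1)]", simplified])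
next
  case False
  let ?C = "rev [0..<n]"
  have A: "computes_table f_solve [enc_list enc_nat ?C, enc_context [], ctx]
    (\<lambda>tab. \<exists>S. S + G \<le> size_bound ?C \<and> good ?C [] S tab) (Q * length ?C ^ (M + 1))"
    using False N by (intro computes_solve) (auto simp: context_ok_def)
  have B: "Q * length ?C ^ (M + 1) \<le> Q * (N + 1) ^ (M + 1)"
    using N by (intro mult_le_mono2 power_mono) auto
  have C: "table_ok m n (Smax + 1) tab \<and> table_sum tab (\<lambda>_. 1) = sum_types ?C weight"
    if "S + G \<le> size_bound ?C" "good ?C [] S tab" for S tab
    using that size_bound_Smax[of ?C] N by (auto simp: good_def intro: table_ok_mono)
  show ?thesis
  proof (rule computes_table_mono[OF A, unfolded enc_list.simps])
    show "Q * length ?C ^ (M + 1) \<le> Q * (N + 1) ^ (M + 1) + 50" using B by linarith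
  qed (use C in auto)
qed

end

section \<open>Balanced separators from treewidth\<close>

text \<open>\<open>reach F Z u v\<close>: there is a path from \<open>u\<close> to \<open>v\<close> whose nodes, \<open>u\<close> excepted, avoid \<open>Z\<close>.\<close>

definition reach :: "'v set set \<Rightarrow> 'v set \<Rightarrow> 'v \<Rightarrow> 'v \<Rightarrow> bool" where
  "reach F Z = (\<lambda>u v. {u, v} \<in> F \<and> v \<notin> Z)\<^sup>*\<^sup>*"

lemma reach_refl [simp]: "reach F Z u u"
  by (simp add: reach_def)

lemma reach_trans: "reach F Z u v \<Longrightarrow> reach F Z v x \<Longrightarrow> reach F Z u x"
  unfolding reach_def by (rule rtranclp_trans)

lemma reach_edge: "{u, v} \<in> F \<Longrightarrow> v \<notin> Z \<Longrightarrow> reach F Z u v"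
  unfolding reach_def by (rule r_into_rtranclp) simp

lemma reach_step: "reach F Z u v \<Longrightarrow> {v, x} \<in> F \<Longrightarrow> x \<notin> Z \<Longrightarrow> reach F Z u x"
  by (rule reach_trans[OF _ reach_edge])

lemma reach_induct [consumes 1, case_names refl step]:
  assumes "reach F Z u v" "P u"
    and "\<And>v x. reach F Z u v \<Longrightarrow> {v, x} \<in> F \<Longrightarrow> x \<notin> Z \<Longrightarrow> P v \<Longrightarrow> P x"
  shows "P v"
  using assms(1) unfolding reach_def
  by (induction rule: rtranclp_induct) (use assms(2,3) in \<open>auto simp: reach_def\<close>)

lemma reach_notin: "reach F Z u v \<Longrightarrow> u \<notin> Z \<Longrightarrow> v \<notin> Z"
  unfolding reach_def by (induction rule: rtranclp_induct) auto

lemma reach_sym: "reach F Z u v \<Longrightarrow> u \<notin> Z \<Longrightarrow> reach F Z v u"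
proof (induction rule: reach_induct)
  case (step v x)
  have "v \<notin> Z" using reach_notin[OF step(1,5)] .
  then have "reach F Z x v" using step(2) by (intro reach_edge) (simp_all add: insert_commute)
  then show ?case using step by (blast intro: reach_trans)
qed simp

lemma reach_mono: "reach F Z u v \<Longrightarrow> Z' \<subseteq> Z \<Longrightarrow> reach F Z' u v"
  unfolding reach_def by (erule rtranclp_mono[THEN predicate2D, rotated]) auto

lemma walk_reach: "walk F p \<Longrightarrow> set (tl p) \<inter> Z = {} \<Longrightarrow> reach F Z (hd p) (last p)"
proof (induction p)
  case (Cons a p)
  show ?case
  proof (cases p)
    case (Cons b q)
    have "reach F Z b (last p)"
      using Cons.IH Cons.prems \<open>p = b # q\<close> by (auto simp: walk_def)
    moreover have "reach F Z a b"
      using Cons.prems \<open>p = b # q\<close> by (intro reach_edge) (auto simp: walk_def)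
    ultimately show ?thesis using \<open>p = b # q\<close> reach_trans by fastforce
  qed auto
qed (auto simp: walk_def)

text \<open>A cycle has to be a distinct walk. If the new node occurs already, the walk is cut off
  at its earlier visit.\<close>

lemma reach_walk:
  assumes "reach F Z u v"
  shows "\<exists>p. walk F p \<and> distinct p \<and> hd p = u \<and> last p = v \<and> set (tl p) \<inter> Z = {}"
  using assms unfolding reach_def
proof (induction rule: rtranclp_induct)
  case base
  then show ?case by (intro exI[of _ "[u]"]) (simp add: walk_def)
next
  case (step v x)
  then obtain p where p: "walk F p" "distinct p" "hd p = u" "last p = v" "set (tl p) \<inter> Z = {}" by blast
  have ne: "p \<noteq> []" using p by (simp add: walk_def)
  show ?case
  proof (cases "x \<in> set p")
    case False
    then show ?thesis using p step ne
      by (intro exI[of _ "p @ [x]"]) (auto simp: walk_def successively_append_iff)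
  next
    case True
    then obtain q r where q: "p = q @ x # r" by (meson split_list)
    have "set (tl (q @ [x])) \<subseteq> set (tl p)" using q by (cases q) auto
    then show ?thesis using p q
      by (intro exI[of _ "q @ [x]"]) (auto simp: walk_def successively_append_iff hd_append)
  qed
qed

section \<open>Branches of a tree decomposition\<close>

locale tree_dec =
  fixes W :: "'v set" and E :: "'v set set" and I :: "nat set" and F :: "nat set set" and bag :: "nat \<Rightarrow> 'v set"
  assumes td: "tree_decomposition W E I F bag"
begin

lemma tree: "finite I" "I \<noteq> {}" "e \<in> F \<Longrightarrow> e \<subseteq> I \<and> card e = 2" "connected_on F I" "acyclic_graph F"
  and bags: "(\<Union>i\<in>I. bag i) = W" "d \<in> E \<Longrightarrow> \<exists>i\<in>I. d \<subseteq> bag i"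
    "v \<in> W \<Longrightarrow> connected_on F {i \<in> I. v \<in> bag i}"
  using td by (auto simp: tree_decomposition_def finite_tree_def)

text \<open>For an edge between \<open>i\<close> and \<open>j\<close>: the branch that contains
  \<open>j\<close> once the node \<open>i\<close> is deleted.\<close>

definition side :: "nat \<Rightarrow> nat \<Rightarrow> nat set" where
  "side i j = {l. reach F {i} j l}"

lemma edge: assumes "{i, j} \<in> F" shows "i \<noteq> j" "i \<in> I" "j \<in> I"
  using tree(3)[OF assms] by auto

text \<open>A path from \<open>l\<close> to \<open>i\<close> that avoids \<open>j\<close> would
  close up to a cycle through \<open>j\<close>.\<close>

lemma no_second_path:
  assumes "{i, j} \<in> F" "{l, j} \<in> F" "l \<noteq> i"
  shows "\<not> reach F {j} l i"
proof
  assume "reach F {j} l i"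
  then obtain p where p: "walk F p" "distinct p" "hd p = l" "last p = i" "set (tl p) \<inter> {j} = {}"
    using reach_walk by metis
  have ne: "p \<noteq> []" using p by (simp add: walk_def)
  have "j \<notin> set p" using p edge(1)[OF assms(2)] by (cases p) auto
  moreover have "length p \<ge> 2" using p ne assms(3) by (cases p; cases "tl p") auto
  moreover have "walk F (p @ [j])"
    using p assms(1) ne by (auto simp: walk_def successively_append_iff)
  moreover have "{last (p @ [j]), hd (p @ [j])} \<in> F"
    using p(3) ne assms(2) by (simp add: insert_commute)
  ultimately show False
    using tree(5) p(2) unfolding acyclic_graph_def by fastforce
qed

text \<open>A path from \<open>l\<close> that avoids \<open>j\<close> cannot come to
  \<open>i\<close>, so it stays in the larger branch, while \<open>j\<close> itself is lost. The
  strict decrease drives the extremal choice in \<open>balanced_bag\<close>.\<close>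

lemma side_subset:
  assumes "{i, j} \<in> F" "{j, l} \<in> F" "l \<noteq> i"
  shows "side j l \<subset> side i j"
proof
  have jl: "{l, j} \<in> F" using assms(2) by (simp add: insert_commute)
  show "side j l \<subseteq> side i j"
  proof
    fix x assume "x \<in> side j l"
    then have "reach F {j} l x" by (simp add: side_def)
    then have "reach F {i} l x"
    proof (induction rule: reach_induct)
      case (step y z)
      have "reach F {j} l z" by (rule reach_step[OF step(1-3)])
      then have "z \<noteq> i" using no_second_path[OF assms(1) jl assms(3)] by blast
      then show ?case using reach_step[OF step(4,2)] by simp
    qed simp
    moreover have "reach F {i} j l" using assms by (intro reach_edge) auto
    ultimately show "x \<in> side i j" using reach_trans[of F "{i}" j l x] by (simp add: side_def)
  qed
  have "j \<in> side i j" by (simp add: side_def)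
  moreover have "j \<notin> side j l"
    using reach_notin[of F "{j}" l j] edge(1)[OF jl] by (auto simp: side_def)
  ultimately show "side j l \<noteq> side i j" by blast
qed

lemma side_subset_nodes: "{i, j} \<in> F \<Longrightarrow> side i j \<subseteq> I"
proof -
  assume ij: "{i, j} \<in> F"
  have "reach F {i} j l \<Longrightarrow> l \<in> I" for l
    by (induction rule: reach_induct) (use edge(3)[OF ij] in \<open>auto dest: tree(3)\<close>)
  then show ?thesis by (auto simp: side_def)
qed

lemma node_in_side:
  assumes "i \<in> I" "l \<in> I" "l \<noteq> i"
  shows "\<exists>j. {i, j} \<in> F \<and> l \<in> side i j"
proof -
  obtain p where p: "walk F p" "hd p = i" "last p = l"
    using tree(4) assms unfolding connected_on_def by blast
  have "reach F {} i l" using walk_reach[of F p "{}"] p by simp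
  then obtain q where q: "walk F q" "distinct q" "hd q = i" "last q = l" using reach_walk by metis
  then obtain r where r: "q = i # r" by (cases q) (auto simp: walk_def)
  then obtain j r' where r': "r = j # r'" using q assms(3) by (cases r) auto
  have "reach F {i} (hd r) (last r)"
    using q r r' by (intro walk_reach) (auto simp: walk_def)
  then show ?thesis using q r r' by (intro exI[of _ j]) (auto simp: walk_def side_def)
qed

text \<open>The connecting path stays within the nodes whose bags contain \<open>v\<close>, and no
  node of \<open>Z\<close> is among them.\<close>

lemma bags_reach:
  assumes "v \<in> bag l" "v \<in> bag l'" "l \<in> I" "l' \<in> I" "\<And>z. z \<in> Z \<Longrightarrow> v \<notin> bag z"
  shows "reach F Z l l'"
proof -
  have "v \<in> W" using bags(1) assms by blast
  then obtain p where p: "walk F p" "set p \<subseteq> {i \<in> I. v \<in> bag i}" "hd p = l" "last p = l'"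
    using bags(3)[of v] assms unfolding connected_on_def by blast
  then have "set (tl p) \<inter> Z = {}" using assms(5) by (cases p) auto
  then show ?thesis using walk_reach[of F p Z] p by simp
qed

text \<open>The share of \<open>C\<close> that the bag of \<open>i\<close> cuts off in the direction
  of \<open>j\<close>.\<close>

definition part :: "'v set \<Rightarrow> nat \<Rightarrow> nat \<Rightarrow> 'v set" where
  "part C i j = {v \<in> C. v \<notin> bag i \<and> (\<exists>l\<in>side i j. v \<in> bag l)}"

text \<open>The ends of an edge share a bag, and this bag lies in the same branch because the bags
  that contain \<open>u\<close> do not include that of \<open>i\<close>.\<close>

lemma part_closed:
  assumes "{i, j} \<in> F" "u \<in> part C i j" "v \<in> C" "v \<notin> bag i" "{u, v} \<in> E"
  shows "v \<in> part C i j"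
proof -
  obtain l where l: "reach F {i} j l" "u \<in> bag l" "u \<notin> bag i" using assms(2) by (auto simp: part_def side_def)
  have lI: "l \<in> I" using side_subset_nodes[OF assms(1)] l(1) by (auto simp: side_def)
  obtain l' where l': "l' \<in> I" "u \<in> bag l'" "v \<in> bag l'" using bags(2)[OF assms(5)] by auto
  have "reach F {i} l l'" using bags_reach[OF l(2) l'(2) lI l'(1), of "{i}"] l by auto
  then have "l' \<in> side i j" using reach_trans[OF l(1)] by (simp add: side_def)
  then show ?thesis using l' assms by (auto simp: part_def)
qed

text \<open>An element of both would lie in bags on either side of the edge, connected by a path
  that avoids \<open>i\<close> and \<open>j\<close>; in a tree the edge is the only passage.\<close>

lemma parts_disjoint:
  assumes "{i, j} \<in> F"
  shows "part C i j \<inter> part C j i = {}"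
proof (rule ccontr)
  assume "\<not> ?thesis"
  then obtain v l l' where v: "v \<notin> bag i" "v \<notin> bag j" "v \<in> bag l" "v \<in> bag l'"
    and l: "reach F {i} j l" "reach F {j} i l'"
    by (auto simp: part_def side_def)
  have ji: "{j, i} \<in> F" using assms by (simp add: insert_commute)
  have I: "l \<in> I" "l' \<in> I" using side_subset_nodes[OF assms] side_subset_nodes[OF ji] l by (auto simp: side_def)
  have "reach F {i, j} l l'" using bags_reach[OF v(3,4) I, of "{i, j}"] v by auto
  then have "reach F {i} l l'" by (rule reach_mono) simp
  with l(1) have "reach F {i} j l'" by (rule reach_trans)
  moreover have "l' \<noteq> i" using v by auto
  text \<open>So \<open>l'\<close> is reached from \<open>i\<close> without using \<open>j\<close>, and from \<open>j\<close> without using \<open>i\<close>.\<close>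
  ultimately obtain p where p: "walk F p" "distinct p" "hd p = j" "last p = l'" "set (tl p) \<inter> {i} = {}"
    using reach_walk by metis
  have "p \<noteq> []" "l' \<noteq> j" using p v by (auto simp: walk_def)
  then obtain m q where pq: "p = j # m # q" using p by (cases p; cases "tl p") auto
  have "reach F {j} m l'"
    using p pq walk_reach[of F "m # q" "{j}"] by (auto simp: walk_def)
  \<comment> \<open>From \<open>i\<close> to \<open>l'\<close> and back along the path to
    \<open>m\<close>, the successor of \<open>j\<close>, the node \<open>j\<close> is avoided: a
    second connection between \<open>i\<close> and a neighbour of \<open>j\<close>.\<close>
  then have "reach F {j} l' m" by (rule reach_sym) (use p pq in auto)
  with l(2) have "reach F {j} i m" by (rule reach_trans)
  then have "reach F {j} m i" by (rule reach_sym) (use edge(1)[OF assms] in auto)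
  moreover have "{m, j} \<in> F" using p(1) pq by (simp add: walk_def insert_commute)
  moreover have "m \<noteq> i" using p pq by auto
  ultimately show False using no_second_path[OF assms] by blast
qed

text \<open>If every node had a branch holding more than half of \<open>C\<close>, choose such a
  branch with fewest nodes and consider the heavy branch at its first node \<open>j\<close>. It
  cannot lead back to \<open>i\<close>, since two disjoint parts would both exceed half, and
  otherwise it is a smaller heavy branch.\<close>

lemma balanced_bag:
  assumes "finite C" "C \<subseteq> W"
  shows "\<exists>i\<in>I. \<forall>j. {i, j} \<in> F \<longrightarrow> 2 * card (part C i j) \<le> card C"
proof (rule ccontr)
  assume "\<not> ?thesis"
  then have heavy: "\<exists>j. {i, j} \<in> F \<and> card C < 2 * card (part C i j)" if "i \<in> I" for i
    using that by (meson not_le)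
  define H where "H = {(i, j). {i, j} \<in> F \<and> card C < 2 * card (part C i j)}"
  obtain i0 where "i0 \<in> I" using tree(2) by blast
  then obtain j0 where "{i0, j0} \<in> F \<and> card C < 2 * card (part C i0 j0)" using heavy by blast
  then obtain e where "e \<in> H" by (auto simp: H_def)
  then obtain i j where ij: "(i, j) \<in> H" and min: "\<And>i' j'. (i', j') \<in> H \<Longrightarrow> card (side i j) \<le> card (side i' j')"
    using ex_has_least_nat[of "\<lambda>e. e \<in> H" e "\<lambda>(i, j). card (side i j)"] by fastforce
  have F: "{i, j} \<in> F" and c: "card C < 2 * card (part C i j)" using ij by (auto simp: H_def)
  obtain l where l: "{j, l} \<in> F" "card C < 2 * card (part C j l)" using heavy edge(3)[OF F] by blast
  show False
  proof (cases "l = i")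
    case True
    have "card (part C i j) + card (part C j i) = card (part C i j \<union> part C j i)"
      using parts_disjoint[OF F, of C] assms(1) by (intro card_Un_disjoint[symmetric]) (auto simp: part_def)
    also have "\<dots> \<le> card C" using assms(1) by (intro card_mono) (auto simp: part_def)
    finally show False using c l True by simp
  next
    case False
    have "card (side j l) < card (side i j)"
      using side_subset[OF F l(1) False] finite_subset[OF side_subset_nodes[OF F] tree(1)] by (intro psubset_card_mono)
    then show False using min[of j l] l by (simp add: H_def)
  qed
qed

text \<open>Connectedness of \<open>P\<close> is expressed through sets closed under edges: each of
  them contains \<open>P\<close> or misses it. This needs no paths in the graph and matches both
  \<open>part_closed\<close> and \<open>part_connected\<close>.\<close>

lemma balanced_separator:
  assumes "finite C" "C \<subseteq> W"
  shows "\<exists>i\<in>I. \<forall>P\<subseteq>C - bag i. P \<noteq> {} \<and>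
    (\<forall>S\<subseteq>C - bag i. (\<forall>u\<in>S. \<forall>v\<in>C - bag i. {u, v} \<in> E \<longrightarrow> v \<in> S) \<longrightarrow> P \<subseteq> S \<or> P \<inter> S = {}) \<longrightarrow> 2 * card P \<le> card C"
proof -
  obtain i where i: "i \<in> I" "\<And>j. {i, j} \<in> F \<Longrightarrow> 2 * card (part C i j) \<le> card C"
    using balanced_bag[OF assms] by blast
  have "2 * card P \<le> card C"
    if P: "P \<subseteq> C - bag i" "P \<noteq> {}"
      "\<And>S. S \<subseteq> C - bag i \<Longrightarrow> \<forall>u\<in>S. \<forall>v\<in>C - bag i. {u, v} \<in> E \<longrightarrow> v \<in> S \<Longrightarrow> P \<subseteq> S \<or> P \<inter> S = {}" for P
  proof -
    obtain v where v: "v \<in> P" using P by blast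
    then obtain l where l: "l \<in> I" "v \<in> bag l" using P assms bags(1) by blast
    then have "l \<noteq> i" using v P by auto
    then obtain j where j: "{i, j} \<in> F" "l \<in> side i j" using node_in_side i l by blast
    have "P \<subseteq> part C i j \<or> P \<inter> part C i j = {}"
      using part_closed[OF j(1)] by (intro P(3)) (auto simp: part_def)
    moreover have "v \<in> part C i j" using v l j P by (auto simp: part_def)
    ultimately have "P \<subseteq> part C i j" using v by blast
    then have "card P \<le> card (part C i j)" using assms by (intro card_mono) (auto simp: part_def)
    then show ?thesis using i(2)[OF j(1)] by simp
  qed
  then show ?thesis using i(1) by blast
qed

end

text \<open>A component touched by the inserted \<open>v\<close> has a common hyperedge with it, so
  a closed \<open>S\<close> contains that component if it contains \<open>v\<close> and misses it
  otherwise.\<close>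

lemma part_connected:
  assumes "P \<in> set (parts es C)" "S \<subseteq> set C"
    and "\<And>e u v. e \<in> set es \<Longrightarrow> u \<in> S \<Longrightarrow> v \<in> set C \<Longrightarrow> u \<in> set e \<Longrightarrow> v \<in> set e \<Longrightarrow> v \<in> S"
  shows "set P \<subseteq> S \<or> set P \<inter> S = {}"
  using assms
proof (induction C arbitrary: P S)
  case (Cons v C)
  have sub: "set Q \<subseteq> set C" if "Q \<in> set (parts es C)" for Q
    using that mset_eq_setD[OF mset_parts[of es C]] by auto
  have IH: "set Q \<subseteq> S \<or> set Q \<inter> S = {}" if Q: "Q \<in> set (parts es C)" for Q
  proof -
    have "set Q \<subseteq> S \<inter> set C \<or> set Q \<inter> (S \<inter> set C) = {}"
      using Cons.prems(2,3) by (intro Cons.IH Q) auto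
    then show ?thesis using sub[OF Q] by blast
  qed
  show ?case
  proof (cases "P \<in> set (parts es C)")
    case False
    then have P: "P = concat (filter (touching es v) (parts es C)) @ [v]" using Cons.prems by auto
    have t: "\<exists>u\<in>set Q. \<exists>e\<in>set es. v \<in> set e \<and> u \<in> set e \<and> u \<in> set C" if "Q \<in> set (parts es C)" "touching es v Q" for Q
      using that sub[OF that(1)] unfolding touching_def by blast
    show ?thesis
    proof (cases "v \<in> S")
      case True
      have "set Q \<subseteq> S" if Q: "Q \<in> set (parts es C)" "touching es v Q" for Q
      proof -
        obtain u e where "u \<in> set Q" "e \<in> set es" "v \<in> set e" "u \<in> set e" "u \<in> set C" using t[OF Q] by blast
        then have "u \<in> S" using Cons.prems(3)[of e v u] True by auto
        then show ?thesis using IH[OF Q(1)] \<open>u \<in> set Q\<close> by blast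
      qed
      then show ?thesis using True by (auto simp: P)
    next
      case False
      have "set Q \<inter> S = {}" if Q: "Q \<in> set (parts es C)" "touching es v Q" for Q
      proof -
        obtain u e where "u \<in> set Q" "e \<in> set es" "v \<in> set e" "u \<in> set e" using t[OF Q] by blast
        then have "u \<notin> S" using Cons.prems(3)[of e u v] False by auto
        then show ?thesis using IH[OF Q(1)] \<open>u \<in> set Q\<close> by blast
      qed
      then show ?thesis using False by (auto simp: P)
    qed
  qed (rule IH)
qed auto

text \<open>The least width is attained, because a single bag \<open>W\<close> is a decomposition.
  Truncated subtraction does no harm, as only an upper bound on the bags is concluded.\<close>

lemma treewidth_decomposition:
  assumes "finite W" "\<And>e. e \<in> E \<Longrightarrow> e \<subseteq> W" "treewidth W E \<le> k"
  shows "\<exists>I F bag. tree_decomposition W E I F bag \<and> (\<forall>i\<in>I. card (bag i) \<le> k + 1)"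
proof -
  let ?P = "\<lambda>k. \<exists>I F bag. tree_decomposition W E I F bag \<and> k = Max ((\<lambda>i. card (bag i)) ` I) - 1"
  have "tree_decomposition W E {0} {} (\<lambda>_. W)"
    using assms(2)
    by (auto simp: tree_decomposition_def finite_tree_def acyclic_graph_def connected_on_def walk_def intro!: exI[of _ "[0]"])
  then have "\<exists>k. ?P k" by blast
  then have "?P (treewidth W E)" unfolding treewidth_def by (rule LeastI_ex)
  then obtain I F bag where td: "tree_decomposition W E I F bag"
    and k: "treewidth W E = Max ((\<lambda>i. card (bag i)) ` I) - 1" by blast
  have "finite I" using td by (simp add: tree_decomposition_def finite_tree_def)
  then have "card (bag i) \<le> k + 1" if "i \<in> I" for i
  proof -
    have "card (bag i) \<le> Max ((\<lambda>i. card (bag i)) ` I)" using \<open>finite I\<close> that by (intro Max_ge) auto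
    then show ?thesis using k assms(3) by linarith
  qed
  then show ?thesis using td by blast
qed

text \<open>The separator is padded to a tuple of exactly \<open>k + 1\<close> elements.\<close>

lemma exists_balanced_separator:
  assumes "finite W" "\<And>e. e \<in> E \<Longrightarrow> e \<subseteq> W" "treewidth W E \<le> k"
    and "distinct C" "set C \<subseteq> W" "C \<noteq> []"
    and "\<And>u v. {u, v} \<in> E \<Longrightarrow> u \<noteq> v \<Longrightarrow> \<exists>e\<in>set es. u \<in> set e \<and> v \<in> set e"
    and es: "\<And>u v e. e \<in> set es \<Longrightarrow> u \<in> set e \<Longrightarrow> v \<in> set e \<Longrightarrow> u \<noteq> v \<Longrightarrow> {u, v} \<in> E"
  shows "\<exists>X\<in>set (tuples (k + 1) C). balanced (parts es (remove_list X C)) C"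
proof -
  obtain I F bag where td: "tree_decomposition W E I F bag" and w: "\<forall>i\<in>I. card (bag i) \<le> k + 1"
    using treewidth_decomposition[OF assms(1-3)] by blast
  interpret tree_dec W E I F bag by unfold_locales (rule td)
  obtain i where i: "i \<in> I" and sep: "\<And>P. P \<subseteq> set C - bag i \<Longrightarrow> P \<noteq> {} \<Longrightarrow>
    (\<And>S. S \<subseteq> set C - bag i \<Longrightarrow> \<forall>u\<in>S. \<forall>v\<in>set C - bag i. {u, v} \<in> E \<longrightarrow> v \<in> S \<Longrightarrow> P \<subseteq> S \<or> P \<inter> S = {}) \<Longrightarrow>
     2 * card P \<le> card (set C)"
    using balanced_separator[of "set C"] assms(5) by auto
  obtain xs where xs: "set xs = bag i \<inter> set C" "distinct xs" using finite_distinct_list[of "bag i \<inter> set C"] by auto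
  have "length xs = card (bag i \<inter> set C)" using xs distinct_card by metis
  also have "\<dots> \<le> card (bag i)" using assms(1) i bags(1) by (intro card_mono finite_subset[of "bag i" W]) auto
  finally have l: "length xs \<le> k + 1" using w i by auto
  define X where "X = xs @ replicate (k + 1 - length xs) (hd C)"
  have "length X = k + 1" using l by (simp add: X_def)
  moreover have "set X \<subseteq> set C"
    using xs hd_in_set[OF assms(6)] unfolding X_def set_append set_replicate_conv_if by simp
  ultimately have X: "X \<in> set (tuples (k + 1) C)" unfolding set_tuples by simp
  have sX: "bag i \<inter> set C \<subseteq> set X" unfolding X_def using xs by simp
  have "balanced (parts es (remove_list X C)) C"
    unfolding balanced_def
  proof
    fix P assume P: "P \<in> set (parts es (remove_list X C))"
    have sP: "set P \<subseteq> set C - set X"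
      using P mset_eq_setD[OF mset_parts[of es "remove_list X C"]] by auto
    have "P \<noteq> []" using P parts_nonempty[of es "remove_list X C"] by auto
    have dP: "distinct P"
      using P assms(4) mset_eq_imp_distinct_iff[OF mset_parts[of es "remove_list X C"]] by (simp add: distinct_concat_iff)
    have "2 * card (set P) \<le> card (set C)"
    proof (rule sep)
      show "set P \<subseteq> set C - bag i" "set P \<noteq> {}" using sP sX \<open>P \<noteq> []\<close> by auto
      fix S assume S: "S \<subseteq> set C - bag i" "\<forall>u\<in>S. \<forall>v\<in>set C - bag i. {u, v} \<in> E \<longrightarrow> v \<in> S"
      \<comment> \<open>The tuple \<open>X\<close> may contain a padding element outside the bag.
        What remains of a closed set after removing \<open>X\<close> is still closed within the
        remaining elements.\<close>
      have "set P \<subseteq> S - set X \<or> set P \<inter> (S - set X) = {}"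
      proof (rule part_connected[OF P])
        fix e u v assume *: "e \<in> set es" "u \<in> S - set X" "v \<in> set (remove_list X C)" "u \<in> set e" "v \<in> set e"
        then have "v \<in> set C - bag i" using sX by auto
        then show "v \<in> S - set X" using * S(2) es[of e u v] by (cases "u = v") auto
      qed (use S in auto)
      then show "set P \<subseteq> S \<or> set P \<inter> S = {}" using sP by blast
    qed
    then show "2 * length P \<le> length C" using dP assms(4) by (simp add: distinct_card)
  qed
  then show ?thesis using X by blast
qed

section \<open>Sums over the subsets of a disjoint union\<close>

lemma sum_Pow_Un:
  assumes "finite A" "finite B" "A \<inter> B = {}"
  shows "(\<Sum>X\<in>Pow (A \<union> B). f X) = (\<Sum>X\<in>Pow A. \<Sum>Y\<in>Pow B. f (X \<union> Y))"
proof -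
  have "bij_betw (\<lambda>x. fst x \<union> snd x) (Pow A \<times> Pow B) (Pow (A \<union> B))"
    using assms(3) by (intro bij_betw_byWitness[where f' = "\<lambda>X. (X \<inter> A, X \<inter> B)"]) auto
  then have "(\<Sum>x\<in>Pow A \<times> Pow B. f (fst x \<union> snd x)) = (\<Sum>X\<in>Pow (A \<union> B). f X)"
    by (rule sum.reindex_bij_betw)
  then show ?thesis by (simp add: sum.cartesian_product case_prod_unfold)
qed

text \<open>The distributive law for independent choices; it allows the atoms on different pairs to
  be summed out separately.\<close>

lemma sum_Pow_UN:
  fixes g :: "'i \<Rightarrow> 'a set \<Rightarrow> 'b :: comm_semiring_1"
  assumes "finite I" "\<And>i. i \<in> I \<Longrightarrow> finite (A i)" "\<And>i j. i \<in> I \<Longrightarrow> j \<in> I \<Longrightarrow> i \<noteq> j \<Longrightarrow> A i \<inter> A j = {}"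
  shows "(\<Sum>X\<in>Pow (\<Union>i\<in>I. A i). \<Prod>i\<in>I. g i (X \<inter> A i)) = (\<Prod>i\<in>I. \<Sum>Y\<in>Pow (A i). g i Y)"
  using assms
proof (induction I)
  case (insert i I)
  have d: "A i \<inter> (\<Union>j\<in>I. A j) = {}" using insert.hyps(2) insert.prems(2)[of i] by fastforce
  have "(\<Sum>X\<in>Pow (\<Union>j\<in>insert i I. A j). \<Prod>j\<in>insert i I. g j (X \<inter> A j)) =
     (\<Sum>X\<in>Pow (A i). \<Sum>Y\<in>Pow (\<Union>j\<in>I. A j). \<Prod>j\<in>insert i I. g j ((X \<union> Y) \<inter> A j))"
    using insert.hyps insert.prems d by (simp only: UN_insert) (intro sum_Pow_Un; auto)
  also have "\<dots> = (\<Sum>X\<in>Pow (A i). \<Sum>Y\<in>Pow (\<Union>j\<in>I. A j). g i X * (\<Prod>j\<in>I. g j (Y \<inter> A j)))"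
  proof (intro sum.cong refl)
    fix X Y assume XY: "X \<in> Pow (A i)" "Y \<in> Pow (\<Union>j\<in>I. A j)"
    have 1: "(X \<union> Y) \<inter> A i = X" using XY d by auto
    have 2: "(X \<union> Y) \<inter> A j = Y \<inter> A j" if "j \<in> I" for j using XY d that by auto
    show "(\<Prod>j\<in>insert i I. g j ((X \<union> Y) \<inter> A j)) = g i X * (\<Prod>j\<in>I. g j (Y \<inter> A j))"
      using insert.hyps 1 2 by simp
  qed
  also have "\<dots> = (\<Prod>j\<in>insert i I. \<Sum>Y\<in>Pow (A j). g j Y)"
  proof -
    have IH: "(\<Sum>X\<in>Pow (\<Union>i\<in>I. A i). \<Prod>i\<in>I. g i (X \<inter> A i)) = (\<Prod>i\<in>I. \<Sum>Y\<in>Pow (A i). g i Y)"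
      by (rule insert.IH) (use insert.prems in auto)
    show ?thesis by (simp only: sum_product[symmetric] IH) (simp add: insert.hyps)
  qed
  finally show ?case .
qed auto

section \<open>The weighted count as a sum over type assignments\<close>

text \<open>
  A pattern is an atom over the domain \<open>bool\<close>, where \<open>False\<close> and \<open>True\<close> stand for the first and the
  second element of a pair. The set \<open>c\<close> of elements that occur distinguishes nullary atoms (\<open>{}\<close>),
  atoms on one element (\<open>{False}\<close>) and atoms on two elements (\<open>UNIV\<close>).
\<close>

definition patterns :: "vocab \<Rightarrow> bool set \<Rightarrow> bool gatom set" where
  "patterns V c = {\<pi> \<in> ground_atoms V UNIV. set (snd \<pi>) = c}"

definition atoms_on :: "vocab \<Rightarrow> 'd set \<Rightarrow> 'd gatom set" where
  "atoms_on V S = {\<alpha> \<in> ground_atoms V UNIV. set (snd \<alpha>) = S}"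

definition inst :: "'d \<Rightarrow> 'd \<Rightarrow> bool gatom \<Rightarrow> 'd gatom" where
  "inst u v \<pi> = (fst \<pi>, map (pick u v) (snd \<pi>))"

definition flip :: "bool gatom \<Rightarrow> bool gatom" where
  "flip \<pi> = (fst \<pi>, map Not (snd \<pi>))"

lemma flip_flip [simp]: "flip (flip \<pi>) = \<pi>"
  by (simp add: flip_def comp_def)

lemma inst_flip: "inst u v (flip \<pi>) = inst v u \<pi>"
  by (simp add: inst_def flip_def pick_def)

lemma finite_ground_atoms: "finite D \<Longrightarrow> finite (ground_atoms V D)"
proof -
  assume D: "finite D"
  have "ground_atoms V D \<subseteq> (\<Union>p<length V. Pair p ` {as. set as \<subseteq> D \<and> length as = V ! p})"
    by (auto simp: ground_atoms_def)
  moreover have "finite \<dots>" using D by (auto intro!: finite_lists_length_eq)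
  ultimately show ?thesis by (rule finite_subset)
qed

lemma finite_atoms_on: "finite S \<Longrightarrow> finite (atoms_on V S)"
  by (rule finite_subset[OF _ finite_ground_atoms[of S V]]) (auto simp: atoms_on_def ground_atoms_def)

lemma finite_patterns [simp]: "finite (patterns V c)"
  by (rule finite_subset[OF _ finite_ground_atoms[of UNIV V]]) (auto simp: patterns_def)

lemma pick_inj: "u \<noteq> v \<Longrightarrow> inj (pick u v)"
  by (auto simp: pick_def inj_def split: if_splits)

lemma inst_inj: "u \<noteq> v \<Longrightarrow> inj (inst u v)"
  using pick_inj[of u v] by (auto simp: inst_def inj_def prod_eq_iff)

lemma fst_inst [simp]: "fst (inst u v \<pi>) = fst \<pi>"
  by (simp add: inst_def)

lemma inst_patterns:
  assumes "u \<noteq> v"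
  shows "inst u v ` patterns V c = atoms_on V (pick u v ` c)"
proof (intro equalityI subsetI)
  fix \<alpha> assume "\<alpha> \<in> atoms_on V (pick u v ` c)"
  then obtain p as where \<alpha>: "\<alpha> = (p, as)" "p < length V" "length as = V ! p" "set as = pick u v ` c"
    by (cases \<alpha>) (auto simp: atoms_on_def ground_atoms_def)
  let ?bs = "map (\<lambda>a. a = v) as"
  have "pick u v (a = v) = a" if "a \<in> set as" for a
    using that \<alpha>(4) by (auto simp: pick_def split: if_splits)
  then have "map (pick u v) ?bs = as"
    by (auto intro: map_idI)
  moreover have "set ?bs = c"
  proof -
    have "pick u v b = v \<longleftrightarrow> b" for b using assms by (simp add: pick_def)
    then show ?thesis by (simp add: \<alpha>(4) image_image)
  qed
  ultimately show "\<alpha> \<in> inst u v ` patterns V c"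
    using \<alpha> by (intro image_eqI[of _ _ "(p, ?bs)"]) (auto simp: inst_def patterns_def ground_atoms_def)
qed (auto simp: inst_def patterns_def ground_atoms_def atoms_on_def)

lemma flip_patterns: "flip ` patterns V UNIV = patterns V UNIV"
proof -
  have "range Not = UNIV" by (auto intro: image_eqI[of _ _ "\<not> _"])
  then have "flip ` patterns V UNIV \<subseteq> patterns V UNIV"
    by (auto simp: flip_def patterns_def ground_atoms_def)
  then show ?thesis by (metis (no_types, lifting) flip_flip image_iff subsetI subset_antisym subsetD image_eqI)
qed

lemma set_cases: "(c :: bool set) = {} \<or> c = {False} \<or> c = {True} \<or> c = UNIV"
proof -
  have "c \<in> Pow {False, True}" by auto
  then show ?thesis by (auto simp: Pow_insert UNIV_bool)
qed

text \<open>Without quantifiers, only atoms over the values of the variables are consulted and the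
  domain is not; hence \<open>D\<close> and \<open>D'\<close> may differ.\<close>

lemma sat_cong:
  assumes "quantifier_free f" "wf_fm V f" "\<forall>i\<in>free_vars f. \<sigma> i = \<sigma>' i" "\<forall>i\<in>free_vars f. \<sigma> i \<in> S"
    "\<forall>\<alpha>\<in>ground_atoms V S. \<alpha> \<in> \<mu> \<longleftrightarrow> \<alpha> \<in> \<mu>'"
  shows "sat D \<mu> \<sigma> f \<longleftrightarrow> sat D' \<mu>' \<sigma>' f"
  using assms
proof (induction f)
  case (Atom p xs)
  have m: "map \<sigma> xs = map \<sigma>' xs" using Atom by simp
  have "set (map \<sigma> xs) \<subseteq> S" using Atom(4) by auto
  then have g: "(p, map \<sigma> xs) \<in> ground_atoms V S" using Atom(2) by (simp add: ground_atoms_def)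
  show ?case using Atom(5) g by (simp only: sat.simps m)
qed auto

lemma sat_rename:
  assumes "quantifier_free f" "inj h"
  shows "sat D \<mu> (h \<circ> \<sigma>) f \<longleftrightarrow> sat D' {\<pi>. (fst \<pi>, map h (snd \<pi>)) \<in> \<mu>} \<sigma> f"
  using assms by (induction f) (auto simp: inj_def)

lemma sat_inst:
  assumes "quantifier_free f" "wf_fm V f" "u \<noteq> v"
    "\<And>\<pi>. \<pi> \<in> ground_atoms V S \<Longrightarrow> \<pi> \<in> J \<longleftrightarrow> inst u v \<pi> \<in> \<mu>" "range \<sigma> \<subseteq> S"
  shows "sat D \<mu> (pick u v \<circ> \<sigma>) f \<longleftrightarrow> sat UNIV J \<sigma> f"
  unfolding sat_rename[OF assms(1) pick_inj[OF assms(3)], where D' = UNIV]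
  by (rule sat_cong[OF assms(1,2), of _ _ S]) (use assms(4,5) in \<open>auto simp: inst_def\<close>)

text \<open>Brings both forms of evidence to a condition on one atom at a time, which can be
  distributed over elements and pairs.\<close>

lemma sat_evidence_iff:
  assumes "evidence_of_kind V D m E"
  shows "sat_evidence V D m \<mu> E \<longleftrightarrow> (\<forall>\<alpha>\<in>atoms_of_kind V D m. evidence_ok E (\<alpha> \<in> \<mu>) \<alpha>)"
  using assms
proof (cases E)
  case (Open_World L)
  then have L: "snd ` L \<subseteq> atoms_of_kind V D m" using assms by simp
  show ?thesis unfolding Open_World sat_evidence.simps evidence_ok.simps
  proof (intro iffI ballI)
    fix \<alpha> assume "\<forall>(b, a)\<in>L. (a \<in> \<mu>) = b" "\<alpha> \<in> atoms_of_kind V D m"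
    then show "(\<alpha> \<notin> \<mu>, \<alpha>) \<notin> L" by auto
  next
    fix l assume *: "\<forall>\<alpha>\<in>atoms_of_kind V D m. (\<alpha> \<notin> \<mu>, \<alpha>) \<notin> L" "l \<in> L"
    obtain b a where l: "l = (b, a)" by (cases l)
    have "a \<in> atoms_of_kind V D m" using * L l by force
    then have "(a \<notin> \<mu>, a) \<notin> L" using * by simp
    then show "case l of (b, a) \<Rightarrow> (a \<in> \<mu>) = b" using * l by (cases b; cases "a \<in> \<mu>") auto
  qed
qed auto

text \<open>The product runs over a set \<open>A\<close> that does not depend on the interpretation,
  so it splits along any partition of the atoms.\<close>

definition lit_weight :: "(nat \<Rightarrow> real) \<Rightarrow> (nat \<Rightarrow> real) \<Rightarrow> 'd gatom set \<Rightarrow> 'd gatom set \<Rightarrow> real" where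
  "lit_weight w wbar A \<mu> = (\<Prod>\<alpha>\<in>A. if \<alpha> \<in> \<mu> then w (fst \<alpha>) else wbar (fst \<alpha>))"

lemma lit_weight_Un: "finite A \<Longrightarrow> finite B \<Longrightarrow> A \<inter> B = {} \<Longrightarrow>
  lit_weight w wbar (A \<union> B) \<mu> = lit_weight w wbar A \<mu> * lit_weight w wbar B \<mu>"
  unfolding lit_weight_def by (rule prod.union_disjoint)

lemma lit_weight_cong: "A \<inter> \<mu> = A \<inter> \<mu>' \<Longrightarrow> lit_weight w wbar A \<mu> = lit_weight w wbar A \<mu>'"
  unfolding lit_weight_def by (intro prod.cong) auto

lemma lit_weight_inst:
  assumes "u \<noteq> v"
  shows "lit_weight w wbar (inst u v ` A) (inst u v ` M) = lit_weight w wbar A M"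
  unfolding lit_weight_def
  using inst_inj[OF assms] by (subst prod.reindex) (auto simp: inj_image_mem_iff intro: inj_on_subset cong: if_cong)

lemma interpretation_weight_eq:
  assumes "finite D" "\<mu> \<subseteq> ground_atoms V D"
  shows "interpretation_weight V D w wbar \<mu> = lit_weight w wbar (ground_atoms V D) \<mu>"
proof -
  have f: "finite (ground_atoms V D)" using finite_ground_atoms[OF assms(1)] .
  have "lit_weight w wbar (ground_atoms V D) \<mu> = lit_weight w wbar \<mu> \<mu> * lit_weight w wbar (ground_atoms V D - \<mu>) \<mu>"
    using lit_weight_Un[of \<mu> "ground_atoms V D - \<mu>" w wbar \<mu>] assms f by (simp add: finite_subset Un_absorb1)
  then show ?thesis unfolding interpretation_weight_def lit_weight_def by simp
qed

lemma sum_lit_weight: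
  assumes "finite A"
  shows "(\<Sum>\<mu>\<in>Pow A. lit_weight w wbar A \<mu>) = (\<Prod>\<alpha>\<in>A. w (fst \<alpha>) + wbar (fst \<alpha>))"
proof -
  have "(\<Sum>\<mu>\<in>Pow (\<Union>\<alpha>\<in>A. {\<alpha>}). \<Prod>\<alpha>\<in>A. if \<mu> \<inter> {\<alpha>} = {} then wbar (fst \<alpha>) else w (fst \<alpha>)) =
     (\<Prod>\<alpha>\<in>A. \<Sum>Y\<in>Pow {\<alpha>}. if Y = {} then wbar (fst \<alpha>) else w (fst \<alpha>))"
    using assms by (intro sum_Pow_UN) auto
  moreover have "(\<Sum>Y\<in>Pow {\<alpha>}. if Y = {} then wbar (fst \<alpha>) else w (fst \<alpha>)) = w (fst \<alpha>) + wbar (fst \<alpha>)" for \<alpha> :: "'a gatom"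
    by (simp add: Pow_insert)
  moreover have "(\<Prod>\<alpha>\<in>A. if \<mu> \<inter> {\<alpha>} = {} then wbar (fst \<alpha>) else w (fst \<alpha>)) = lit_weight w wbar A \<mu>" for \<mu>
    unfolding lit_weight_def by (intro prod.cong) auto
  ultimately show ?thesis by simp
qed

definition enum :: "'a set \<Rightarrow> 'a list" where
  "enum A = (SOME xs. distinct xs \<and> set xs = A)"

lemma enum: "finite A \<Longrightarrow> distinct (enum A) \<and> set (enum A) = A"
  unfolding enum_def by (rule someI_ex) (metis finite_distinct_list)

text \<open>Weights and evidence are parameters without assumptions, so the facts about one sentence
  hold for all evidence at once.\<close>

locale decomposition =
  fixes V :: vocab and \<psi> :: fm and x y :: nat and w wbar :: "nat \<Rightarrow> real" and U B :: "nat evidence"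
  assumes qf: "quantifier_free \<psi>" and wf: "wf_fm V \<psi>" and fv: "free_vars \<psi> \<subseteq> {x, y}" and xy: "x \<noteq> y"
begin

abbreviation "P0 \<equiv> patterns V {}"
abbreviation "P1 \<equiv> patterns V {False}"
abbreviation "P2 \<equiv> patterns V UNIV"

text \<open>Every set of one-element patterns is a type, also one that violates the sentence; such a
  type gets the factor 0. The program refers to types by their positions in this list.\<close>

definition TS :: "bool gatom set list" where
  "TS = enum (Pow P1)"

definition "m = length TS"

lemma TS: "distinct TS" "set TS = Pow P1"
  using enum[of "Pow P1"] by (simp_all add: TS_def)

lemma TS_nth: "a < m \<Longrightarrow> TS ! a \<subseteq> P1"
  using nth_mem[of a TS] TS(2) by (simp add: m_def)

definition ok1 :: "bool gatom set \<Rightarrow> bool gatom set \<Rightarrow> bool" where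
  "ok1 z a \<longleftrightarrow> sat UNIV (z \<union> a) (\<lambda>_. False) \<psi>"

text \<open>\<open>J\<close> is a structure on the elements \<open>False\<close> and
  \<open>True\<close>, where \<open>flip\<close> moves the type of the second element into place.
  Under \<open>\<lambda>i. i \<noteq> x\<close> the variable \<open>x\<close> denotes the first
  element and \<open>y\<close> the second; universal quantification requires both orders.\<close>

definition ok2 :: "bool gatom set \<Rightarrow> bool gatom set \<Rightarrow> bool gatom set \<Rightarrow> bool gatom set \<Rightarrow> bool" where
  "ok2 z a b M \<longleftrightarrow> (let J = z \<union> a \<union> flip ` b \<union> M in
     sat UNIV J (\<lambda>i. i \<noteq> x) \<psi> \<and> sat UNIV J (\<lambda>i. i = x) \<psi>)"

definition obeys :: "nat evidence \<Rightarrow> bool gatom set \<Rightarrow> bool gatom set \<Rightarrow> nat \<Rightarrow> nat \<Rightarrow> bool" where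
  "obeys E P M u v \<longleftrightarrow> (\<forall>\<pi>\<in>P. evidence_ok E (\<pi> \<in> M) (inst u v \<pi>))"

definition unary :: "bool gatom set \<Rightarrow> nat \<Rightarrow> nat \<Rightarrow> real" where
  "unary z v a = (if ok1 z (TS ! a) \<and> obeys U P1 (TS ! a) v v then lit_weight w wbar P1 (TS ! a) else 0)"

definition binary :: "bool gatom set \<Rightarrow> nat \<Rightarrow> nat \<Rightarrow> nat \<Rightarrow> nat \<Rightarrow> real" where
  "binary z u v a b = (\<Sum>M\<in>Pow P2. if ok2 z (TS ! a) (TS ! b) M \<and> obeys B P2 M u v then lit_weight w wbar P2 M else 0)"

text \<open>Negation exchanges the two elements and fixes nullary patterns, which is why
  \<open>z\<close> is restricted to those.\<close>

lemma ok2_flip: "ok2 z a b M \<longleftrightarrow> ok2 z b a (flip ` M)" if "z \<subseteq> P0"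
proof -
  have z: "flip ` z = z"
  proof -
    have "flip \<pi> = id \<pi>" if "\<pi> \<in> z" for \<pi>
      using that \<open>z \<subseteq> P0\<close> by (auto simp: patterns_def flip_def prod_eq_iff)
    then have "flip ` z = id ` z" by (rule image_cong[OF refl])
    then show ?thesis by simp
  qed
  have eq: "flip ` (z \<union> a \<union> flip ` b \<union> M) = z \<union> b \<union> flip ` a \<union> flip ` M"
    by (simp only: image_Un image_image flip_flip z image_ident) auto
  have sat_flip: "sat UNIV J (\<lambda>i. \<not> \<sigma> i) \<psi> \<longleftrightarrow> sat UNIV (flip ` J) \<sigma> \<psi>" for J and \<sigma> :: "nat \<Rightarrow> bool"
  proof -
    have "{\<pi>. (fst \<pi>, map Not (snd \<pi>)) \<in> J} = flip ` J"
      unfolding flip_def[symmetric] by (auto intro: image_eqI[of _ _ "flip _"])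
    moreover have "inj Not" by (auto simp: inj_def)
    ultimately show ?thesis
      using sat_rename[OF qf, of Not UNIV J \<sigma> UNIV] by (simp add: comp_def)
  qed
  have "sat UNIV J (\<lambda>i. \<not> (i \<noteq> x)) \<psi> = sat UNIV J (\<lambda>i. i = x) \<psi>" for J by simp
  with sat_flip[of _ "\<lambda>i. i = x"] sat_flip[of _ "\<lambda>i. i \<noteq> x"] have flip: "sat UNIV J (\<lambda>i. i \<noteq> x) \<psi> \<longleftrightarrow> sat UNIV (flip ` J) (\<lambda>i. i = x) \<psi>"
    "sat UNIV J (\<lambda>i. i = x) \<psi> \<longleftrightarrow> sat UNIV (flip ` J) (\<lambda>i. i \<noteq> x) \<psi>" for J by blast+
  show ?thesis
    unfolding ok2_def Let_def flip[of "z \<union> a \<union> flip ` b \<union> M"] eq by (rule conj_commute)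
qed

text \<open>Re-indexing by \<open>flip\<close> exchanges the roles of the two elements in formula,
  evidence and weight alike.\<close>

lemma binary_sym:
  assumes "z \<subseteq> P0"
  shows "binary z u v a b = binary z v u b a"
proof -
  have inj: "inj_on flip A" for A by (rule inj_on_inverseI[of _ flip]) simp
  have "bij_betw (image flip) (Pow P2) (Pow P2)"
    using bij_betw_Pow[of flip P2 P2] inj flip_patterns[of V] by (simp add: bij_betw_def)
  then have "binary z v u b a = (\<Sum>M\<in>Pow P2. if ok2 z (TS ! b) (TS ! a) (flip ` M) \<and> obeys B P2 (flip ` M) v u
      then lit_weight w wbar P2 (flip ` M) else 0)"
    unfolding binary_def by (rule sum.reindex_bij_betw[symmetric])
  also have "\<dots> = binary z u v a b"
    unfolding binary_def
  proof (intro sum.cong refl)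
    fix M assume "M \<in> Pow P2"
    have mem: "\<pi> \<in> flip ` M \<longleftrightarrow> flip \<pi> \<in> M" for \<pi> by (auto intro: image_eqI[of _ _ "flip _"])
    have "obeys B P2 (flip ` M) v u \<longleftrightarrow> (\<forall>\<pi>\<in>flip ` P2. evidence_ok B (flip \<pi> \<in> M) (inst v u \<pi>))"
      unfolding obeys_def mem flip_patterns ..
    also have "\<dots> \<longleftrightarrow> obeys B P2 M u v"
      by (simp add: obeys_def inst_flip)
    finally have r: "obeys B P2 (flip ` M) v u \<longleftrightarrow> obeys B P2 M u v" .
    have "lit_weight w wbar (flip ` P2) (flip ` M) = lit_weight w wbar P2 M"
      unfolding lit_weight_def mem using inj[of P2]
      by (subst prod.reindex) (auto simp: flip_def comp_def cong: if_cong)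
    then have "lit_weight w wbar P2 (flip ` M) = lit_weight w wbar P2 M"
      by (simp add: flip_patterns)
    then show "(if ok2 z (TS ! b) (TS ! a) (flip ` M) \<and> obeys B P2 (flip ` M) v u
      then lit_weight w wbar P2 (flip ` M) else 0) =
      (if ok2 z (TS ! a) (TS ! b) M \<and> obeys B P2 M u v then lit_weight w wbar P2 M else 0)"
      using r ok2_flip[OF assms, of "TS ! a" "TS ! b" M] by simp
  qed
  finally show ?thesis ..
qed

end

section \<open>Interpretations with fixed nullary atoms\<close>

locale decomposition_zero = decomposition +
  fixes z :: "bool gatom set"
  assumes z: "z \<subseteq> P0"

sublocale decomposition_zero \<subseteq> weighted_types m "unary z" "binary z"
  by unfold_locales (rule binary_sym[OF z])

context decomposition_zero
begin

text \<open>Nullary patterns have no arguments, so the pair \<open>0\<close>, \<open>1\<close> is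
  arbitrary; it is chosen distinct because \<open>inst\<close> is then injective.\<close>

definition zero_atoms :: "nat gatom set" where
  "zero_atoms = inst 0 1 ` z"

definition vtype :: "nat gatom set \<Rightarrow> nat \<Rightarrow> bool gatom set" where
  "vtype \<mu> v = {\<pi> \<in> P1. inst v v \<pi> \<in> \<mu>}"

definition table :: "nat gatom set \<Rightarrow> nat \<Rightarrow> nat \<Rightarrow> bool gatom set" where
  "table \<mu> u v = {\<pi> \<in> P2. inst u v \<pi> \<in> \<mu>}"

definition tindex :: "nat gatom set \<Rightarrow> nat \<Rightarrow> nat" where
  "tindex \<mu> v = (SOME a. a < m \<and> TS ! a = vtype \<mu> v)"

lemma tindex: "tindex \<mu> v < m" "TS ! tindex \<mu> v = vtype \<mu> v"
proof -
  have "vtype \<mu> v \<in> set TS" unfolding TS(2) by (auto simp: vtype_def)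
  then have "\<exists>a. a < m \<and> TS ! a = vtype \<mu> v" by (auto simp: in_set_conv_nth m_def)
  from someI_ex[OF this] show "tindex \<mu> v < m" "TS ! tindex \<mu> v = vtype \<mu> v" by (auto simp: tindex_def)
qed

text \<open>The second element does not occur. So \<open>inst v v\<close>, which is not injective in
  general, can be traded for \<open>inst v (Suc v)\<close>.\<close>

lemma inst_P1: "\<pi> \<in> P1 \<Longrightarrow> inst u v \<pi> = inst u u \<pi>"
  by (auto simp: patterns_def inst_def pick_def)

lemma inst_P0: "\<pi> \<in> P0 \<Longrightarrow> inst u v \<pi> = inst 0 1 \<pi>"
  by (auto simp: patterns_def inst_def)

lemma inst_P1_image: "inst u u ` P1 = atoms_on V {u}" for u :: nat
proof -
  have "inst u u ` P1 = inst u (Suc u) ` P1" by (intro image_cong refl inst_P1[symmetric])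
  then show ?thesis by (simp add: inst_patterns pick_def)
qed

lemma inst_P2_image: "u \<noteq> v \<Longrightarrow> inst u v ` P2 = atoms_on V {u, v}"
  using inst_patterns[of u v V UNIV] by (simp add: pick_def UNIV_bool insert_commute)

lemma vtype_cong: "\<forall>\<alpha>\<in>atoms_on V {v}. \<alpha> \<in> \<mu> \<longleftrightarrow> \<alpha> \<in> \<mu>' \<Longrightarrow> vtype \<mu> v = vtype \<mu>' v"
  unfolding inst_P1_image[symmetric] vtype_def by auto

lemma tindex_cong: "\<forall>\<alpha>\<in>atoms_on V {v}. \<alpha> \<in> \<mu> \<longleftrightarrow> \<alpha> \<in> \<mu>' \<Longrightarrow> tindex \<mu> v = tindex \<mu>' v"
  unfolding tindex_def using vtype_cong by metis

lemma table_cong: "u \<noteq> v \<Longrightarrow> \<forall>\<alpha>\<in>atoms_on V {u, v}. \<alpha> \<in> \<mu> \<longleftrightarrow> \<alpha> \<in> \<mu>' \<Longrightarrow> table \<mu> u v = table \<mu>' u v"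
  unfolding inst_P2_image[symmetric] table_def by auto

abbreviation assignment :: "nat \<Rightarrow> nat \<Rightarrow> nat \<Rightarrow> nat" where
  "assignment u v \<equiv> (\<lambda>i. if i = x then u else v)"

definition ok_vertex :: "nat gatom set \<Rightarrow> nat \<Rightarrow> bool" where
  "ok_vertex \<mu> v \<longleftrightarrow> sat UNIV (zero_atoms \<union> \<mu>) (assignment v v) \<psi> \<and> (\<forall>\<alpha>\<in>atoms_on V {v}. evidence_ok U (\<alpha> \<in> \<mu>) \<alpha>)"

definition ok_pair :: "nat gatom set \<Rightarrow> nat \<Rightarrow> nat \<Rightarrow> bool" where
  "ok_pair \<mu> u v \<longleftrightarrow> sat UNIV (zero_atoms \<union> \<mu>) (assignment u v) \<psi> \<and> sat UNIV (zero_atoms \<union> \<mu>) (assignment v u) \<psi> \<and>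
     (\<forall>\<alpha>\<in>atoms_on V {u, v}. evidence_ok B (\<alpha> \<in> \<mu>) \<alpha>)"

lemma zero_atoms_iff: "\<pi> \<in> P0 \<Longrightarrow> inst u v \<pi> \<in> zero_atoms \<longleftrightarrow> \<pi> \<in> z"
  using inj_image_mem_iff[OF inst_inj[of 0 "1::nat"], of \<pi> z] inst_P0[of \<pi> u v] unfolding zero_atoms_def by simp

lemma z_empty: "\<pi> \<in> z \<Longrightarrow> set (snd \<pi>) = {}"
  using z by (auto simp: patterns_def)

lemma inst_zero_atoms_empty: "inst u v \<pi> \<in> zero_atoms \<Longrightarrow> set (snd \<pi>) = {}"
proof -
  assume "inst u v \<pi> \<in> zero_atoms"
  then obtain \<rho> where "\<rho> \<in> z" "inst u v \<pi> = inst 0 1 \<rho>" by (auto simp: zero_atoms_def)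
  then show ?thesis using z_empty[of \<rho>] by (simp add: inst_def)
qed

lemma inst_P0_atoms_on: "\<pi> \<in> P0 \<Longrightarrow> inst u v \<pi> \<in> atoms_on V {}"
  by (cases \<pi>) (simp add: patterns_def inst_def atoms_on_def ground_atoms_def)

lemma vtype_single: "\<pi> \<in> vtype \<mu> v \<Longrightarrow> set (snd \<pi>) = {False}"
  by (simp add: vtype_def patterns_def)

lemma flip_vtype_single: "flip \<pi> \<in> vtype \<mu> v \<Longrightarrow> set (snd \<pi>) = {True}"
proof -
  assume "flip \<pi> \<in> vtype \<mu> v"
  then have "Not ` set (snd \<pi>) = {False}" using vtype_single[of "flip \<pi>"] by (simp add: flip_def)
  then have "Not ` Not ` set (snd \<pi>) = Not ` {False}" by (rule arg_cong)
  then show ?thesis by (simp add: image_image)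
qed

lemma table_full: "\<pi> \<in> table \<mu> u v \<Longrightarrow> set (snd \<pi>) = UNIV"
  by (simp add: table_def patterns_def)

lemma pattern_set: "\<pi> \<in> patterns V c \<Longrightarrow> set (snd \<pi>) = c"
  by (simp add: patterns_def)

lemma bool_sets: "{} \<noteq> (UNIV :: bool set)" "{False} \<noteq> UNIV" "{True} \<noteq> UNIV"
  by (auto simp: UNIV_bool)

lemma pattern_cases:
  assumes "\<pi> \<in> ground_atoms V UNIV"
  obtains "\<pi> \<in> P0" | "\<pi> \<in> P1" | "flip \<pi> \<in> P1" "\<pi> \<in> patterns V {True}" | "\<pi> \<in> P2"
proof -
  consider "set (snd \<pi>) = {}" | "set (snd \<pi>) = {False}" | "set (snd \<pi>) = {True}" | "set (snd \<pi>) = UNIV"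
    using set_cases[of "set (snd \<pi>)"] by blast
  then show ?thesis
  proof cases
    case 1
    show ?thesis by (rule that(1)) (use 1 assms in \<open>simp add: patterns_def\<close>)
  next
    case 2
    show ?thesis by (rule that(2)) (use 2 assms in \<open>simp add: patterns_def\<close>)
  next
    case 3
    show ?thesis
      by (rule that(3)) (use 3 assms in \<open>cases \<pi>; simp add: patterns_def flip_def ground_atoms_def\<close>)+
  next
    case 4
    show ?thesis by (rule that(4)) (use 4 assms in \<open>simp add: patterns_def\<close>)
  qed
qed

text \<open>Up to renaming \<open>v\<close> to \<open>False\<close>, the structure on
  \<open>v\<close> is \<open>z\<close> together with its type. Nullary atoms have to come from
  \<open>z\<close> alone, hence the hypothesis on \<open>\<mu>\<close>.\<close>

lemma ok_vertex_iff:
  assumes "\<mu> \<inter> atoms_on V {} = {}"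
  shows "ok_vertex \<mu> v \<longleftrightarrow> ok1 z (vtype \<mu> v) \<and> obeys U P1 (vtype \<mu> v) v v"
proof -
  have J: "\<pi> \<in> z \<union> vtype \<mu> v \<longleftrightarrow> inst v (Suc v) \<pi> \<in> zero_atoms \<union> \<mu>" if \<pi>: "\<pi> \<in> ground_atoms V {False}" for \<pi>
  proof -
    have "set (snd \<pi>) = {} \<or> set (snd \<pi>) = {False}"
      using \<pi> by (intro subset_singletonD) (auto simp: ground_atoms_def)
    then have "\<pi> \<in> P0 \<or> \<pi> \<in> P1" using \<pi> by (auto simp: patterns_def ground_atoms_def)
    then show ?thesis
    proof
      assume 0: "\<pi> \<in> P0"
      have "inst v (Suc v) \<pi> \<notin> \<mu>" using assms inst_P0_atoms_on[OF 0, of v "Suc v"] by auto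
      moreover have "\<pi> \<notin> vtype \<mu> v" using pattern_set[OF 0] vtype_single[of \<pi>] by auto
      ultimately show ?thesis using zero_atoms_iff[OF 0] by simp
    next
      assume 1: "\<pi> \<in> P1"
      then have "\<pi> \<notin> z" "inst v (Suc v) \<pi> \<notin> zero_atoms"
        using pattern_set[OF 1] z_empty[of \<pi>] inst_zero_atoms_empty[of v "Suc v" \<pi>] by auto
      then show ?thesis using 1 inst_P1[OF 1, of v "Suc v"] by (simp add: vtype_def)
    qed
  qed
  have "sat UNIV (zero_atoms \<union> \<mu>) (assignment v v) \<psi> \<longleftrightarrow> ok1 z (vtype \<mu> v)"
    using sat_inst[OF qf wf _ J, where \<sigma> = "\<lambda>_. False" and D = UNIV] by (simp add: ok1_def pick_def comp_def)
  moreover have "(\<forall>\<alpha>\<in>atoms_on V {v}. evidence_ok U (\<alpha> \<in> \<mu>) \<alpha>) \<longleftrightarrow> obeys U P1 (vtype \<mu> v) v v"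
    unfolding inst_P1_image[symmetric] obeys_def vtype_def by auto
  ultimately show ?thesis by (simp add: ok_vertex_def)
qed

text \<open>Each of the four kinds of patterns in \<open>pattern_cases\<close> is governed by
  exactly one of the four sets that make up \<open>?J\<close>.\<close>

lemma ok_pair_iff:
  assumes "\<mu> \<inter> atoms_on V {} = {}" "u \<noteq> v"
  shows "ok_pair \<mu> u v \<longleftrightarrow> ok2 z (vtype \<mu> u) (vtype \<mu> v) (table \<mu> u v) \<and> obeys B P2 (table \<mu> u v) u v"
proof -
  let ?J = "z \<union> vtype \<mu> u \<union> flip ` vtype \<mu> v \<union> table \<mu> u v"
  have flip: "\<pi> \<in> flip ` A \<longleftrightarrow> flip \<pi> \<in> A" for \<pi> A by (auto intro: image_eqI[of _ _ "flip _"])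
  note none = z_empty inst_zero_atoms_empty[of u v] vtype_single[of _ \<mu> u] flip_vtype_single[of _ \<mu> v] table_full[of _ \<mu> u v]
  have J: "\<pi> \<in> ?J \<longleftrightarrow> inst u v \<pi> \<in> zero_atoms \<union> \<mu>" if \<pi>: "\<pi> \<in> ground_atoms V UNIV" for \<pi>
    using \<pi>
  proof (cases rule: pattern_cases)
    case 1
    have "inst u v \<pi> \<notin> \<mu>" using assms(1) inst_P0_atoms_on[OF 1, of u v] by auto
    then show ?thesis
      using zero_atoms_iff[OF 1, of u v] pattern_set[OF 1] none[of \<pi>] by (auto simp: flip bool_sets)
  next
    case 2
    then show ?thesis
      using pattern_set[OF 2] none[of \<pi>] inst_P1[OF 2, of u v] by (auto simp: flip vtype_def bool_sets)
  next
    case 3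
    have "inst v v (flip \<pi>) = inst u v \<pi>"
      using inst_P1[OF 3(1), of v u] by (simp add: inst_flip)
    then show ?thesis using 3(1) pattern_set[OF 3(2)] none[of \<pi>] by (auto simp: flip bool_sets vtype_def[of \<mu> v])
  next
    case 4
    then show ?thesis using pattern_set[OF 4] none[of \<pi>] by (auto simp: flip bool_sets table_def)
  qed
  have "sat UNIV (zero_atoms \<union> \<mu>) (assignment u v) \<psi> \<longleftrightarrow> sat UNIV ?J (\<lambda>i. i \<noteq> x) \<psi>"
    "sat UNIV (zero_atoms \<union> \<mu>) (assignment v u) \<psi> \<longleftrightarrow> sat UNIV ?J (\<lambda>i. i = x) \<psi>"
  proof -
    have "assignment u v = pick u v \<circ> (\<lambda>i. i \<noteq> x)" "assignment v u = pick u v \<circ> (\<lambda>i. i = x)"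
      by (auto simp: pick_def fun_eq_iff)
    then show "sat UNIV (zero_atoms \<union> \<mu>) (assignment u v) \<psi> \<longleftrightarrow> sat UNIV ?J (\<lambda>i. i \<noteq> x) \<psi>"
      "sat UNIV (zero_atoms \<union> \<mu>) (assignment v u) \<psi> \<longleftrightarrow> sat UNIV ?J (\<lambda>i. i = x) \<psi>"
      using sat_inst[OF qf wf assms(2) J] by simp_all
  qed
  moreover have "(\<forall>\<alpha>\<in>atoms_on V {u, v}. evidence_ok B (\<alpha> \<in> \<mu>) \<alpha>) \<longleftrightarrow> obeys B P2 (table \<mu> u v) u v"
    unfolding inst_P2_image[OF assms(2), symmetric] obeys_def table_def by auto
  ultimately show ?thesis by (auto simp: ok_pair_def ok2_def Let_def)
qed

text \<open>The case \<open>u = v\<close> is included, so these are the atoms on one or two elements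
  of \<open>C\<close>.\<close>

definition atoms2 :: "nat set \<Rightarrow> nat gatom set" where
  "atoms2 C = {\<alpha> \<in> ground_atoms V UNIV. \<exists>u\<in>C. \<exists>v\<in>C. set (snd \<alpha>) = {u, v}}"

lemma atoms_on_subset:
  assumes "u \<in> C" "v \<in> C"
  shows "atoms_on V {u, v} \<subseteq> atoms2 C"
  unfolding atoms2_def atoms_on_def using assms by blast

lemma atoms2_mono: "C \<subseteq> D \<Longrightarrow> atoms2 C \<subseteq> atoms2 D"
  unfolding atoms2_def by blast

text \<open>Recursive, so that the sum over interpretations can lose one element at a time;
  \<open>admissible_iff\<close> removes the dependence on the order.\<close>

fun admissible :: "nat list \<Rightarrow> nat gatom set \<Rightarrow> bool" where
  "admissible [] \<mu> \<longleftrightarrow> True"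
| "admissible (v # C) \<mu> \<longleftrightarrow> ok_vertex \<mu> v \<and> (\<forall>u\<in>set C. ok_pair \<mu> v u) \<and> admissible C \<mu>"

lemma admissible_cong:
  assumes "distinct C" "\<forall>\<alpha>\<in>atoms2 (set C). \<alpha> \<in> \<mu> \<longleftrightarrow> \<alpha> \<in> \<mu>'"
    "\<mu> \<inter> atoms_on V {} = {}" "\<mu>' \<inter> atoms_on V {} = {}"
  shows "admissible C \<mu> \<longleftrightarrow> admissible C \<mu>'"
  using assms(1,2)
proof (induction C)
  case (Cons v C)
  have t: "vtype \<mu> u = vtype \<mu>' u" if "u \<in> set (v # C)" for u
    using Cons.prems(2) atoms_on_subset[OF that that] by (intro vtype_cong) auto
  have p: "table \<mu> v u = table \<mu>' v u" if "u \<in> set C" for u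
    using Cons.prems that atoms_on_subset[of v "set (v # C)" u] by (intro table_cong) auto
  have "admissible C \<mu> \<longleftrightarrow> admissible C \<mu>'"
    using Cons.prems atoms2_mono[of "set C" "set (v # C)"] by (intro Cons.IH) auto
  moreover have "ok_vertex \<mu> v \<longleftrightarrow> ok_vertex \<mu>' v"
    by (simp add: ok_vertex_iff[OF assms(3)] ok_vertex_iff[OF assms(4)] t)
  moreover have "ok_pair \<mu> v u \<longleftrightarrow> ok_pair \<mu>' v u" if "u \<in> set C" for u
  proof -
    have "v \<noteq> u" using Cons.prems(1) that by auto
    then show ?thesis using that by (simp add: ok_pair_iff[OF assms(3)] ok_pair_iff[OF assms(4)] t p)
  qed
  ultimately show ?case by simp
qed auto

abbreviation "lw \<equiv> lit_weight w wbar"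

lemma finite_atoms2 [simp]: "finite C \<Longrightarrow> finite (atoms2 C)"
  by (rule finite_subset[OF _ finite_ground_atoms[of C V]]) (auto simp: atoms2_def ground_atoms_def)

text \<open>The subsets of the atoms on \<open>v\<close> alone correspond bijectively to the types,
  numbered below \<open>m\<close>; \<open>h\<close> stands for everything else that depends on the
  type of \<open>v\<close>.\<close>

lemma sum_vertex:
  "(\<Sum>\<nu>\<in>Pow (atoms_on V {v}). if ok1 z (vtype \<nu> v) \<and> obeys U P1 (vtype \<nu> v) v v
      then lw (atoms_on V {v}) \<nu> * h (tindex \<nu> v) else 0) = (\<Sum>a<m. unary z v a * h a)"
proof -
  let ?i = "\<lambda>a. inst v (Suc v) ` (TS ! a)"
  have inj: "inj (inst v (Suc v))" by (rule inst_inj) simp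
  have im: "inst v (Suc v) ` P1 = atoms_on V {v}" by (simp add: inst_patterns pick_def)
  have vtype: "vtype (?i a) v = TS ! a" if "a < m" for a
  proof -
    have "inst v v \<pi> \<in> ?i a \<longleftrightarrow> \<pi> \<in> TS ! a" if "\<pi> \<in> P1" for \<pi>
      using inst_P1[OF that, of v "Suc v"] inj_image_mem_iff[OF inj, of \<pi> "TS ! a"] by simp
    then show ?thesis using TS_nth[OF that] by (auto simp: vtype_def)
  qed
  have "bij_betw (\<lambda>a. TS ! a) {..<m} (Pow P1)"
    using bij_betw_nth[OF TS(1), of "{..<m}" "Pow P1"] TS(2) by (simp add: m_def)
  moreover have "bij_betw (image (inst v (Suc v))) (Pow P1) (Pow (atoms_on V {v}))"
    using im inj by (intro bij_betw_Pow) (auto simp: bij_betw_def intro: inj_on_subset)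
  ultimately have bij: "bij_betw ?i {..<m} (Pow (atoms_on V {v}))"
    using bij_betw_trans by (fastforce simp: comp_def)
  have ti: "tindex (?i a) v = a" if "a < m" for a
    using tindex[of "?i a" v] vtype[OF that] that TS(1) by (simp add: nth_eq_iff_index_eq m_def)
  have lwi: "lw (atoms_on V {v}) (?i a) = lw P1 (TS ! a)" for a
    unfolding im[symmetric] by (rule lit_weight_inst) simp
  have "(\<Sum>\<nu>\<in>Pow (atoms_on V {v}). if ok1 z (vtype \<nu> v) \<and> obeys U P1 (vtype \<nu> v) v v
      then lw (atoms_on V {v}) \<nu> * h (tindex \<nu> v) else 0) =
    (\<Sum>a<m. if ok1 z (vtype (?i a) v) \<and> obeys U P1 (vtype (?i a) v) v v
      then lw (atoms_on V {v}) (?i a) * h (tindex (?i a) v) else 0)"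
    using bij by (rule sum.reindex_bij_betw[symmetric])
  also have "\<dots> = (\<Sum>a<m. unary z v a * h a)"
    by (intro sum.cong refl) (auto simp: vtype ti lwi unary_def)
  finally show ?thesis .
qed

lemma sum_pair:
  assumes "u \<noteq> v"
  shows "(\<Sum>\<xi>\<in>Pow (atoms_on V {u, v}). if ok2 z (TS ! a) (TS ! b) (table \<xi> u v) \<and> obeys B P2 (table \<xi> u v) u v
      then lw (atoms_on V {u, v}) \<xi> else 0) = binary z u v a b"
proof -
  have inj: "inj (inst u v)" using inst_inj[OF assms] .
  have im: "inst u v ` P2 = atoms_on V {u, v}" using inst_P2_image[OF assms] .
  have bij: "bij_betw (image (inst u v)) (Pow P2) (Pow (atoms_on V {u, v}))"
    using im inj by (intro bij_betw_Pow) (auto simp: bij_betw_def intro: inj_on_subset)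
  have tab: "table (inst u v ` M) u v = M" if "M \<in> Pow P2" for M
    using that inj_image_mem_iff[OF inj, of _ M] by (auto simp: table_def)
  have lwi: "lw (atoms_on V {u, v}) (inst u v ` M) = lw P2 M" for M
    unfolding im[symmetric] by (rule lit_weight_inst[OF assms])
  have "(\<Sum>\<xi>\<in>Pow (atoms_on V {u, v}). if ok2 z (TS ! a) (TS ! b) (table \<xi> u v) \<and> obeys B P2 (table \<xi> u v) u v
      then lw (atoms_on V {u, v}) \<xi> else 0) =
    (\<Sum>M\<in>Pow P2. if ok2 z (TS ! a) (TS ! b) (table (inst u v ` M) u v) \<and> obeys B P2 (table (inst u v ` M) u v) u v
      then lw (atoms_on V {u, v}) (inst u v ` M) else 0)"
    using bij by (rule sum.reindex_bij_betw[symmetric])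
  also have "\<dots> = binary z u v a b"
    unfolding binary_def by (intro sum.cong refl) (simp add: tab lwi)
  finally show ?thesis .
qed

text \<open>Induction with arbitrary \<open>g\<close>. A new element brings the atoms on it alone
  and the atoms on its pairs with old elements. For fixed types these groups are independent, and
  their total contribution is moved into a new test function \<open>h\<close>.\<close>

lemma sum_admissible:
  assumes "distinct C"
  shows "(\<Sum>\<mu>\<in>Pow (atoms2 (set C)). if admissible C \<mu> then lw (atoms2 (set C)) \<mu> * g (map (\<lambda>v. (v, tindex \<mu> v)) C) else 0) =
    sum_types C (\<lambda>s. weight s * g s)"
  using assms
proof (induction C arbitrary: g)
  case Nil
  then show ?case by (simp add: atoms2_def lit_weight_def)
next
  case (Cons v C)
  have v: "v \<notin> set C" "distinct C" using Cons.prems by auto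
  let ?A = "atoms2 (set C)" and ?V = "atoms_on V {v}" and ?N = "\<Union>u\<in>set C. atoms_on V {v, u}"
  have fin: "finite ?A" "finite ?V" "finite ?N" by (auto simp: finite_atoms_on)
  have dis: "?A \<inter> ?V = {}" "?A \<inter> ?N = {}" "?V \<inter> ?N = {}"
    using v by (auto simp: atoms2_def atoms_on_def doubleton_eq_iff)
  have disN: "atoms_on V {v, u} \<inter> atoms_on V {v, u'} = {}" if "u \<noteq> u'" for u u'
    using that by (auto simp: atoms_on_def doubleton_eq_iff)
  have un: "atoms2 (set (v # C)) = ?A \<union> (?V \<union> ?N)"
    by (auto simp: atoms2_def atoms_on_def insert_commute)
  have one: "atoms_on V {u} \<subseteq> ?A" if "u \<in> set C" for u
    using atoms_on_subset[OF that that] by simp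
  define h where "h s = (\<Sum>a<m. unary z v a * (link (v, a) s * g ((v, a) # s)))" for s
  have "(\<Sum>\<mu>\<in>Pow (atoms2 (set (v # C))). if admissible (v # C) \<mu>
      then lw (atoms2 (set (v # C))) \<mu> * g (map (\<lambda>v. (v, tindex \<mu> v)) (v # C)) else 0) =
    (\<Sum>\<mu>\<in>Pow ?A. \<Sum>\<nu>\<in>Pow ?V. \<Sum>\<xi>\<in>Pow ?N. if admissible (v # C) (\<mu> \<union> (\<nu> \<union> \<xi>))
      then lw (?A \<union> (?V \<union> ?N)) (\<mu> \<union> (\<nu> \<union> \<xi>)) * g (map (\<lambda>v. (v, tindex (\<mu> \<union> (\<nu> \<union> \<xi>)) v)) (v # C)) else 0)"
    unfolding un using fin dis by (subst sum_Pow_Un) (auto simp: sum_Pow_Un intro!: sum.cong)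
  also have "\<dots> = (\<Sum>\<mu>\<in>Pow ?A. if admissible C \<mu> then lw ?A \<mu> * h (map (\<lambda>v. (v, tindex \<mu> v)) C) else 0)"
  proof (intro sum.cong refl)
    fix \<mu> assume \<mu>: "\<mu> \<in> Pow ?A"
    let ?s = "map (\<lambda>v. (v, tindex \<mu> v)) C"
    \<comment> \<open>Violated conditions are encoded by the value 0. The conjunction over all
      \<open>u\<close> thereby becomes a product, to which \<open>sum_Pow_UN\<close>
      applies.\<close>
    define k where "k a u \<xi> = (if ok2 z (TS ! a) (TS ! tindex \<mu> u) (table \<xi> v u) \<and> obeys B P2 (table \<xi> v u) v u
      then lw (atoms_on V {v, u}) \<xi> else 0)" for a u \<xi>
    have k: "(\<Sum>\<xi>\<in>Pow ?N. \<Prod>u\<in>set C. k a u (\<xi> \<inter> atoms_on V {v, u})) = link (v, a) ?s" for a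
    proof -
      have "(\<Sum>\<xi>\<in>Pow ?N. \<Prod>u\<in>set C. k a u (\<xi> \<inter> atoms_on V {v, u})) =
         (\<Prod>u\<in>set C. \<Sum>\<xi>\<in>Pow (atoms_on V {v, u}). k a u \<xi>)"
        using disN by (intro sum_Pow_UN) (simp_all add: finite_atoms_on)
      also have "\<dots> = (\<Prod>u\<in>set C. binary z v u a (tindex \<mu> u))"
        using v(1) unfolding k_def by (intro prod.cong refl sum_pair) auto
      also have "\<dots> = link (v, a) ?s"
        using v(2) by (simp add: link_def comp_def prod.distinct_set_conv_list)
      finally show ?thesis .
    qed
    have "(if admissible (v # C) (\<mu> \<union> (\<nu> \<union> \<xi>))
        then lw (?A \<union> (?V \<union> ?N)) (\<mu> \<union> (\<nu> \<union> \<xi>)) * g (map (\<lambda>v. (v, tindex (\<mu> \<union> (\<nu> \<union> \<xi>)) v)) (v # C)) else 0) =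
      (if admissible C \<mu> then lw ?A \<mu> else 0) *
      (if ok1 z (vtype \<nu> v) \<and> obeys U P1 (vtype \<nu> v) v v then lw ?V \<nu> * g ((v, tindex \<nu> v) # ?s) else 0) *
      (\<Prod>u\<in>set C. k (tindex \<nu> v) u (\<xi> \<inter> atoms_on V {v, u}))" (is "?lhs = ?rhs")
      if \<nu>: "\<nu> \<in> Pow ?V" and \<xi>: "\<xi> \<in> Pow ?N" for \<nu> \<xi>
    proof -
      let ?M = "\<mu> \<union> (\<nu> \<union> \<xi>)"
      have e: "?M \<inter> atoms_on V {} = {}" "\<mu> \<inter> atoms_on V {} = {}"
        using \<mu> \<nu> \<xi> by (auto simp: atoms2_def atoms_on_def)
      have mA: "\<forall>\<alpha>\<in>?A. \<alpha> \<in> ?M \<longleftrightarrow> \<alpha> \<in> \<mu>" using \<nu> \<xi> dis by blast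
      have mV: "\<forall>\<alpha>\<in>?V. \<alpha> \<in> ?M \<longleftrightarrow> \<alpha> \<in> \<nu>" using \<mu> \<xi> dis by blast
      have mN: "\<forall>\<alpha>\<in>?N. \<alpha> \<in> ?M \<longleftrightarrow> \<alpha> \<in> \<xi>" using \<mu> \<nu> dis by blast
      have ad: "admissible C ?M \<longleftrightarrow> admissible C \<mu>" using mA e v by (intro admissible_cong) auto
      have tv: "vtype ?M v = vtype \<nu> v" "tindex ?M v = tindex \<nu> v"
        by (rule vtype_cong[OF mV], rule tindex_cong[OF mV])
      have tu: "vtype ?M u = vtype \<mu> u" "tindex ?M u = tindex \<mu> u" if "u \<in> set C" for u
      proof -
        have "\<forall>\<alpha>\<in>atoms_on V {u}. \<alpha> \<in> ?M \<longleftrightarrow> \<alpha> \<in> \<mu>" using mA one[OF that] by blast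
        then show "vtype ?M u = vtype \<mu> u" "tindex ?M u = tindex \<mu> u"
          by (rule vtype_cong, rule tindex_cong)
      qed
      have tab: "table ?M v u = table (\<xi> \<inter> atoms_on V {v, u}) v u" if "u \<in> set C" for u
        using mN that v(1) by (intro table_cong) auto
      have ts: "TS ! tindex \<nu> v = vtype \<nu> v" "TS ! tindex \<mu> u = vtype \<mu> u" for u
        by (simp_all add: tindex)
      have vu: "v \<noteq> u" if "u \<in> set C" for u using that v by auto
      have "lw (?A \<union> (?V \<union> ?N)) ?M = lw ?A ?M * (lw ?V ?M * lw ?N ?M)"
        using fin dis by (subst lit_weight_Un; (subst lit_weight_Un)?) auto
      also have "lw ?A ?M = lw ?A \<mu>" using mA by (intro lit_weight_cong) auto
      also have "lw ?V ?M = lw ?V \<nu>" using mV by (intro lit_weight_cong) auto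
      also have "lw ?N ?M = (\<Prod>u\<in>set C. lw (atoms_on V {v, u}) ?M)"
        unfolding lit_weight_def
        using disN by (intro prod.UNION_disjoint) (simp_all add: finite_atoms_on)
      also have "\<dots> = (\<Prod>u\<in>set C. lw (atoms_on V {v, u}) (\<xi> \<inter> atoms_on V {v, u}))"
        using mN by (intro prod.cong refl lit_weight_cong) auto
      finally have l: "lw (?A \<union> (?V \<union> ?N)) ?M = lw ?A \<mu> * (lw ?V \<nu> * (\<Prod>u\<in>set C. lw (atoms_on V {v, u}) (\<xi> \<inter> atoms_on V {v, u})))" .
      have gs: "g (map (\<lambda>v. (v, tindex ?M v)) (v # C)) = g ((v, tindex \<nu> v) # ?s)"
        using tv tu by (auto intro!: arg_cong[of _ _ g])
      have okp: "(\<forall>u\<in>set C. ok_pair ?M v u) \<longleftrightarrow> (\<forall>u\<in>set C. ok2 z (vtype \<nu> v) (vtype \<mu> u) (table (\<xi> \<inter> atoms_on V {v, u}) v u) \<and>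
          obeys B P2 (table (\<xi> \<inter> atoms_on V {v, u}) v u) v u)"
        by (intro ball_cong refl) (simp add: ok_pair_iff[OF e(1) vu] tv tu tab)
      have okv: "ok_vertex ?M v \<longleftrightarrow> ok1 z (vtype \<nu> v) \<and> obeys U P1 (vtype \<nu> v) v v"
        by (simp add: ok_vertex_iff[OF e(1)] tv)
      have pk: "(\<Prod>u\<in>set C. k (tindex \<nu> v) u (\<xi> \<inter> atoms_on V {v, u})) =
        (if \<forall>u\<in>set C. ok2 z (vtype \<nu> v) (vtype \<mu> u) (table (\<xi> \<inter> atoms_on V {v, u}) v u) \<and>
          obeys B P2 (table (\<xi> \<inter> atoms_on V {v, u}) v u) v u
         then \<Prod>u\<in>set C. lw (atoms_on V {v, u}) (\<xi> \<inter> atoms_on V {v, u}) else 0)"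
        unfolding k_def ts by (auto intro!: prod.cong prod_zero split: if_splits)
      show ?thesis
        unfolding admissible.simps okp okv ad l gs pk by simp
    qed
    then have "(\<Sum>\<nu>\<in>Pow ?V. \<Sum>\<xi>\<in>Pow ?N. if admissible (v # C) (\<mu> \<union> (\<nu> \<union> \<xi>))
        then lw (?A \<union> (?V \<union> ?N)) (\<mu> \<union> (\<nu> \<union> \<xi>)) * g (map (\<lambda>v. (v, tindex (\<mu> \<union> (\<nu> \<union> \<xi>)) v)) (v # C)) else 0) =
      (\<Sum>\<nu>\<in>Pow ?V. \<Sum>\<xi>\<in>Pow ?N. (if admissible C \<mu> then lw ?A \<mu> else 0) *
      (if ok1 z (vtype \<nu> v) \<and> obeys U P1 (vtype \<nu> v) v v then lw ?V \<nu> * g ((v, tindex \<nu> v) # ?s) else 0) *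
      (\<Prod>u\<in>set C. k (tindex \<nu> v) u (\<xi> \<inter> atoms_on V {v, u})))"
      by (intro sum.cong refl) blast
    also have "\<dots> = (\<Sum>\<nu>\<in>Pow ?V. (if admissible C \<mu> then lw ?A \<mu> else 0) *
      (if ok1 z (vtype \<nu> v) \<and> obeys U P1 (vtype \<nu> v) v v then lw ?V \<nu> * (link (v, tindex \<nu> v) ?s * g ((v, tindex \<nu> v) # ?s)) else 0))"
      by (intro sum.cong refl) (simp add: sum_distrib_left[symmetric] k)
    also have "\<dots> = (if admissible C \<mu> then lw ?A \<mu> else 0) * h ?s"
      unfolding h_def sum_vertex[symmetric] by (simp add: sum_distrib_left)
    finally show "(\<Sum>\<nu>\<in>Pow ?V. \<Sum>\<xi>\<in>Pow ?N. if admissible (v # C) (\<mu> \<union> (\<nu> \<union> \<xi>))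
        then lw (?A \<union> (?V \<union> ?N)) (\<mu> \<union> (\<nu> \<union> \<xi>)) * g (map (\<lambda>v. (v, tindex (\<mu> \<union> (\<nu> \<union> \<xi>)) v)) (v # C)) else 0) =
      (if admissible C \<mu> then lw ?A \<mu> * h ?s else 0)" by simp
  qed
  also have "\<dots> = sum_types C (\<lambda>s. weight s * h s)" by (rule Cons.IH[OF v(2)])
  also have "\<dots> = sum_types C (\<lambda>s. \<Sum>a<m. weight ((v, a) # s) * g ((v, a) # s))"
    by (simp add: h_def sum_distrib_left ac_simps)
  also have "\<dots> = (\<Sum>a<m. sum_types C (\<lambda>s. weight ((v, a) # s) * g ((v, a) # s)))"
    by (rule sum_types_sum)
  finally show ?case by simp
qed

end

section \<open>From admissible interpretations to models\<close>

lemma sum_Pow_Un3: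
  assumes "finite A" "finite B" "finite C" "A \<inter> B = {}" "A \<inter> C = {}" "B \<inter> C = {}"
  shows "(\<Sum>X\<in>Pow (A \<union> (B \<union> C)). f X) = (\<Sum>X\<in>Pow A. \<Sum>Y\<in>Pow B. \<Sum>Z\<in>Pow C. f (X \<union> (Y \<union> Z)))"
proof -
  have "(\<Sum>X\<in>Pow (A \<union> (B \<union> C)). f X) = (\<Sum>X\<in>Pow A. \<Sum>W\<in>Pow (B \<union> C). f (X \<union> W))"
    using assms by (intro sum_Pow_Un) auto
  also have "\<dots> = (\<Sum>X\<in>Pow A. \<Sum>Y\<in>Pow B. \<Sum>Z\<in>Pow C. f (X \<union> (Y \<union> Z)))"
    using assms by (intro sum.cong refl sum_Pow_Un)
  finally show ?thesis .
qed

context decomposition_zero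
begin

lemma ok_pair_sym: "ok_pair \<mu> u v \<longleftrightarrow> ok_pair \<mu> v u"
  unfolding ok_pair_def by (subst insert_commute) blast

lemma admissible_iff:
  "distinct C \<Longrightarrow> admissible C \<mu> \<longleftrightarrow>
    (\<forall>u\<in>set C. ok_vertex \<mu> u) \<and> (\<forall>u\<in>set C. \<forall>v\<in>set C. u \<noteq> v \<longrightarrow> ok_pair \<mu> u v)"
proof (induction C)
  case (Cons a C)
  have "(\<forall>u\<in>set (a # C). \<forall>v\<in>set (a # C). u \<noteq> v \<longrightarrow> ok_pair \<mu> u v) \<longleftrightarrow>
    (\<forall>u\<in>set C. ok_pair \<mu> a u) \<and> (\<forall>u\<in>set C. \<forall>v\<in>set C. u \<noteq> v \<longrightarrow> ok_pair \<mu> u v)"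
    (is "?l \<longleftrightarrow> ?r")
  proof
    assume ?l
    then show ?r using Cons.prems by auto
  next
    assume r: ?r
    show ?l
    proof (intro ballI impI)
      fix u v assume uv: "u \<in> set (a # C)" "v \<in> set (a # C)" "u \<noteq> v"
      then consider "u = a" "v \<in> set C" | "v = a" "u \<in> set C" | "u \<in> set C" "v \<in> set C" by auto
      then show "ok_pair \<mu> u v"
        by cases (use r uv ok_pair_sym[of \<mu> u v] in blast)+
    qed
  qed
  then show ?case using Cons by (simp only: admissible.simps list.simps ball_simps distinct.simps simp_thms) blast
qed auto

lemma sat_assignment:
  assumes "\<forall>\<alpha>\<in>ground_atoms V {u, v}. \<alpha> \<in> \<mu> \<longleftrightarrow> \<alpha> \<in> \<mu>'"
  shows "sat D \<mu> (\<sigma>(x := u, y := v)) \<psi> \<longleftrightarrow> sat UNIV \<mu>' (assignment u v) \<psi>"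
  by (rule sat_cong[OF qf wf, of _ _ "{u, v}"]) (use fv xy assms in auto)

text \<open>The formula has two variables and the evidence concerns at most two elements at a time,
  so the atoms in \<open>\<rho>\<close> are unconstrained.\<close>

lemma models_iff:
  assumes U: "unary_evidence V {..<n} U" and B: "binary_evidence V {..<n} B"
    and M: "M = zero_atoms \<union> (\<mu> \<union> \<rho>)"
    and \<mu>: "\<mu> \<subseteq> atoms2 {..<n}" and \<rho>: "\<And>\<alpha>. \<alpha> \<in> \<rho> \<Longrightarrow> 3 \<le> card (set (snd \<alpha>))"
  shows "(\<forall>\<sigma>. sat {..<n} M \<sigma> (Forall x (Forall y \<psi>))) \<and> sat_evidence V {..<n} 1 M U \<and> sat_evidence V {..<n} 2 M B \<longleftrightarrow>
    admissible (rev [0..<n]) \<mu>"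
proof -
  have two: "\<alpha> \<in> M \<longleftrightarrow> \<alpha> \<in> zero_atoms \<union> \<mu>" if "set (snd \<alpha>) \<subseteq> {u, v}" for \<alpha> u v
  proof -
    have "card (set (snd \<alpha>)) \<le> card {u, v}" using that by (intro card_mono) auto
    also have "\<dots> \<le> 2" by (simp add: card_insert_if)
    finally show ?thesis using \<rho>[of \<alpha>] by (auto simp: M)
  qed
  have pos: "\<alpha> \<in> M \<longleftrightarrow> \<alpha> \<in> \<mu>" if "set (snd \<alpha>) = {u, v}" for \<alpha> u v
  proof -
    have "\<alpha> \<notin> zero_atoms" using that by (auto simp: zero_atoms_def inst_def dest!: z_empty)
    then show ?thesis using two[of \<alpha> u v] that by simp
  qed
  have e1: "(\<forall>\<sigma>. sat {..<n} M \<sigma> (Forall x (Forall y \<psi>))) \<longleftrightarrow>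
     (\<forall>u<n. \<forall>v<n. sat UNIV (zero_atoms \<union> \<mu>) (assignment u v) \<psi>)"
  proof -
    have "sat {..<n} M (\<sigma>(x := u, y := v)) \<psi> \<longleftrightarrow> sat UNIV (zero_atoms \<union> \<mu>) (assignment u v) \<psi>" for \<sigma> u v
    proof (rule sat_assignment, intro ballI)
      fix \<alpha> assume "\<alpha> \<in> ground_atoms V {u, v}"
      then show "\<alpha> \<in> M \<longleftrightarrow> \<alpha> \<in> zero_atoms \<union> \<mu>" by (intro two[of \<alpha> u v]) (auto simp: ground_atoms_def)
    qed
    then show ?thesis by auto
  qed
  have e2: "sat_evidence V {..<n} 1 M U \<longleftrightarrow> (\<forall>u<n. \<forall>\<alpha>\<in>atoms_on V {u}. evidence_ok U (\<alpha> \<in> \<mu>) \<alpha>)"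
  proof -
    have "atoms_of_kind V {..<n} 1 = (\<Union>u\<in>{..<n}. atoms_on V {u})"
      by (auto simp: atoms_of_kind_def atoms_on_def ground_atoms_def card_1_singleton_iff One_nat_def)
    moreover have "\<alpha> \<in> M \<longleftrightarrow> \<alpha> \<in> \<mu>" if "\<alpha> \<in> atoms_on V {u}" for \<alpha> u
      using pos[of \<alpha> u u] that by (simp add: atoms_on_def)
    ultimately show ?thesis unfolding sat_evidence_iff[OF U] by auto
  qed
  have e3: "sat_evidence V {..<n} 2 M B \<longleftrightarrow>
    (\<forall>u<n. \<forall>v<n. u \<noteq> v \<longrightarrow> (\<forall>\<alpha>\<in>atoms_on V {u, v}. evidence_ok B (\<alpha> \<in> \<mu>) \<alpha>))"
  proof -
    have kinds: "atoms_of_kind V {..<n} 2 = {\<alpha>. \<exists>u<n. \<exists>v<n. u \<noteq> v \<and> \<alpha> \<in> atoms_on V {u, v}}"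
      by (auto simp: atoms_of_kind_def atoms_on_def ground_atoms_def card_2_iff) blast
    have mem: "\<alpha> \<in> M \<longleftrightarrow> \<alpha> \<in> \<mu>" if "\<alpha> \<in> atoms_on V {u, v}" for \<alpha> u v
      using pos[of \<alpha> u v] that by (simp add: atoms_on_def)
    show ?thesis unfolding sat_evidence_iff[OF B]
    proof (intro iffI allI impI ballI)
      fix u v \<alpha>
      assume *: "\<forall>\<alpha>\<in>atoms_of_kind V {..<n} 2. evidence_ok B (\<alpha> \<in> M) \<alpha>"
        "u < n" "v < n" "u \<noteq> v" "\<alpha> \<in> atoms_on V {u, v}"
      then have "\<alpha> \<in> atoms_of_kind V {..<n} 2" unfolding kinds by blast
      then have "evidence_ok B (\<alpha> \<in> M) \<alpha>" using *(1) by blast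
      then show "evidence_ok B (\<alpha> \<in> \<mu>) \<alpha>" using mem[OF *(5)] by simp
    next
      fix \<alpha>
      assume *: "\<forall>u<n. \<forall>v<n. u \<noteq> v \<longrightarrow> (\<forall>\<alpha>\<in>atoms_on V {u, v}. evidence_ok B (\<alpha> \<in> \<mu>) \<alpha>)"
        "\<alpha> \<in> atoms_of_kind V {..<n} 2"
      then obtain u v where uv: "u < n" "v < n" "u \<noteq> v" "\<alpha> \<in> atoms_on V {u, v}" unfolding kinds by blast
      then have "evidence_ok B (\<alpha> \<in> \<mu>) \<alpha>" using *(1) by blast
      then show "evidence_ok B (\<alpha> \<in> M) \<alpha>" using mem[OF uv(4)] by simp
    qed
  qed
  have e4: "admissible (rev [0..<n]) \<mu> \<longleftrightarrow> (\<forall>u<n. ok_vertex \<mu> u) \<and> (\<forall>u<n. \<forall>v<n. u \<noteq> v \<longrightarrow> ok_pair \<mu> u v)"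
    by (subst admissible_iff) (auto simp: atLeast0LessThan Ball_def)
  \<comment> \<open>Equal values of the two variables are covered by \<open>ok_vertex\<close>,
    distinct values by \<open>ok_pair\<close>.\<close>
  have e5: "\<dots> \<longleftrightarrow> (\<forall>u<n. \<forall>v<n. sat UNIV (zero_atoms \<union> \<mu>) (assignment u v) \<psi>) \<and>
      (\<forall>u<n. \<forall>\<alpha>\<in>atoms_on V {u}. evidence_ok U (\<alpha> \<in> \<mu>) \<alpha>) \<and>
      (\<forall>u<n. \<forall>v<n. u \<noteq> v \<longrightarrow> (\<forall>\<alpha>\<in>atoms_on V {u, v}. evidence_ok B (\<alpha> \<in> \<mu>) \<alpha>))" (is "?l \<longleftrightarrow> ?a \<and> ?b \<and> ?c")
  proof
    assume l: ?l
    have "sat UNIV (zero_atoms \<union> \<mu>) (assignment u v) \<psi>" if "u < n" "v < n" for u v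
      by (cases "u = v") (use l that in \<open>auto simp: ok_vertex_def ok_pair_def\<close>)
    then show "?a \<and> ?b \<and> ?c" using l by (simp add: ok_vertex_def ok_pair_def)
  next
    assume "?a \<and> ?b \<and> ?c"
    then show ?l unfolding ok_vertex_def ok_pair_def by blast
  qed
  show ?thesis unfolding e1 e2 e3 e4 e5 ..
qed

end

context decomposition
begin

abbreviation "total_weight z C \<equiv> weighted_types.sum_types m C (weighted_types.weight (unary z) (binary z))"

definition large_atoms :: "nat \<Rightarrow> nat gatom set" where
  "large_atoms n = {\<alpha> \<in> ground_atoms V {..<n}. 3 \<le> card (set (snd \<alpha>))}"

lemma wfomc_eq:
  assumes U: "unary_evidence V {..<n} U" and B: "binary_evidence V {..<n} B"
  shows "wfomc V {..<n} w wbar (Forall x (Forall y \<psi>)) (U, B) =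
    (\<Prod>\<alpha>\<in>large_atoms n. w (fst \<alpha>) + wbar (fst \<alpha>)) *
    (\<Sum>z\<in>Pow P0. lit_weight w wbar P0 z * total_weight z (rev [0..<n]))"
proof -
  let ?GA = "ground_atoms V {..<n}" and ?C = "rev [0..<n]"
  let ?Z = "atoms_on V {}" and ?A = "{\<alpha> \<in> ground_atoms V UNIV. \<exists>u<n. \<exists>v<n. set (snd \<alpha>) = {u, v}}" and ?T = "large_atoms n"
  let ?lw = "lit_weight w wbar"
  let ?P = "\<lambda>M. (\<forall>\<sigma>. sat {..<n} M \<sigma> (Forall x (Forall y \<psi>))) \<and> sat_evidence V {..<n} 1 M U \<and> sat_evidence V {..<n} 2 M B"
  have card2: "card {u, v} \<le> 2" for u v :: nat by (simp add: card_insert_if)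
  have GA: "?GA = ?Z \<union> (?A \<union> ?T)"
  proof (intro equalityI subsetI)
    fix \<alpha> assume \<alpha>: "\<alpha> \<in> ?GA"
    then have s: "set (snd \<alpha>) \<subseteq> {..<n}" "\<alpha> \<in> ground_atoms V UNIV" by (auto simp: ground_atoms_def)
    consider "card (set (snd \<alpha>)) = 0" | "card (set (snd \<alpha>)) = 1" | "card (set (snd \<alpha>)) = 2" | "3 \<le> card (set (snd \<alpha>))"
      by linarith
    then show "\<alpha> \<in> ?Z \<union> (?A \<union> ?T)"
    proof cases
      case 1
      then show ?thesis using s by (simp add: atoms_on_def)
    next
      case 2
      then obtain u where "set (snd \<alpha>) = {u}" using card_1_singletonE by blast
      then show ?thesis using s by auto
    next
      case 3
      then obtain u v where "set (snd \<alpha>) = {u, v}" by (auto simp: card_2_iff)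
      then show ?thesis using s by auto
    next
      case 4
      then show ?thesis using \<alpha> by (simp add: large_atoms_def)
    qed
  qed (auto simp: atoms_on_def ground_atoms_def large_atoms_def)
  have fin: "finite ?GA" by (simp add: finite_ground_atoms)
  note f = fin[unfolded GA finite_Un]
  note fins = f[THEN conjunct1] f[THEN conjunct2, THEN conjunct1] f[THEN conjunct2, THEN conjunct2]
  have dis: "?Z \<inter> ?A = {}" "?Z \<inter> ?T = {}" "?A \<inter> ?T = {}"
  proof -
    show "?Z \<inter> ?A = {}" "?Z \<inter> ?T = {}" by (auto simp: atoms_on_def large_atoms_def)
    have "\<alpha> \<notin> ?T" if \<alpha>: "\<alpha> \<in> ?A" for \<alpha>
    proof -
      obtain u v where "set (snd \<alpha>) = {u, v}" using \<alpha> by blast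
      then show ?thesis using card2[of u v] by (simp add: large_atoms_def)
    qed
    then show "?A \<inter> ?T = {}" by blast
  qed
  have "wfomc V {..<n} w wbar (Forall x (Forall y \<psi>)) (U, B) = (\<Sum>M\<in>{M \<in> Pow ?GA. ?P M}. ?lw ?GA M)"
    unfolding wfomc_def fst_conv snd_conv
    by (intro sum.cong) (auto simp: interpretation_weight_eq)
  also have "\<dots> = (\<Sum>M\<in>Pow ?GA. if ?P M then ?lw ?GA M else 0)"
    using fin by (intro sum.inter_filter) simp
  also have "\<dots> = (\<Sum>\<zeta>\<in>Pow ?Z. \<Sum>\<mu>\<in>Pow ?A. \<Sum>\<rho>\<in>Pow ?T. if ?P (\<zeta> \<union> (\<mu> \<union> \<rho>)) then ?lw ?GA (\<zeta> \<union> (\<mu> \<union> \<rho>)) else 0)"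
    unfolding GA by (intro sum_Pow_Un3 fins dis)
  \<comment> \<open>Nullary atoms are re-indexed by nullary patterns, whose list is part of the
    program.\<close>
  also have "\<dots> = (\<Sum>z\<in>Pow P0. \<Sum>\<mu>\<in>Pow ?A. \<Sum>\<rho>\<in>Pow ?T. if ?P (inst 0 1 ` z \<union> (\<mu> \<union> \<rho>)) then ?lw ?GA (inst 0 1 ` z \<union> (\<mu> \<union> \<rho>)) else 0)"
  proof -
    have "inst 0 (1::nat) ` P0 = ?Z" by (simp add: inst_patterns)
    moreover have "inj (inst 0 (1::nat))" by (rule inst_inj) simp
    ultimately have "bij_betw (image (inst 0 (1::nat))) (Pow P0) (Pow ?Z)"
      by (intro bij_betw_Pow) (auto simp: bij_betw_def intro: inj_on_subset)
    then show ?thesis by (rule sum.reindex_bij_betw[symmetric])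
  qed
  also have "\<dots> = (\<Sum>z\<in>Pow P0. ?lw P0 z * total_weight z ?C * (\<Sum>\<rho>\<in>Pow ?T. ?lw ?T \<rho>))"
  proof (intro sum.cong refl)
    fix z assume "z \<in> Pow P0"
    then interpret z: decomposition_zero V \<psi> x y w wbar U B z by unfold_locales auto
    let ?\<zeta> = "inst 0 (1::nat) ` z"
    have \<zeta>: "?\<zeta> \<subseteq> ?Z" using \<open>z \<in> Pow P0\<close> inst_patterns[of 0 "1::nat" V "{}"] by auto
    have A: "?A = z.atoms2 {..<n}" by (auto simp: z.atoms2_def)
    have "(if ?P (?\<zeta> \<union> (\<mu> \<union> \<rho>)) then ?lw ?GA (?\<zeta> \<union> (\<mu> \<union> \<rho>)) else 0) =
      ?lw P0 z * (if z.admissible ?C \<mu> then ?lw ?A \<mu> else 0) * ?lw ?T \<rho>"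
      if \<mu>: "\<mu> \<in> Pow ?A" and \<rho>: "\<rho> \<in> Pow ?T" for \<mu> \<rho>
    proof -
      let ?M = "?\<zeta> \<union> (\<mu> \<union> \<rho>)"
      have "?P ?M \<longleftrightarrow> z.admissible ?C \<mu>"
        using \<mu> \<rho> by (intro z.models_iff[OF U B]) (auto simp: z.zero_atoms_def A large_atoms_def)
      moreover have "?lw ?GA ?M = ?lw ?Z ?M * (?lw ?A ?M * ?lw ?T ?M)"
        unfolding GA using fins dis by (subst lit_weight_Un; (subst lit_weight_Un)?) auto
      moreover have "?lw ?Z ?M = ?lw ?Z ?\<zeta>" using \<mu> \<rho> dis by (intro lit_weight_cong) blast
      moreover have "?lw ?A ?M = ?lw ?A \<mu>" using \<zeta> \<rho> dis by (intro lit_weight_cong) blast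
      moreover have "?lw ?T ?M = ?lw ?T \<rho>" using \<mu> \<zeta> dis by (intro lit_weight_cong) blast
      moreover have "?lw ?Z ?\<zeta> = ?lw P0 z"
        using lit_weight_inst[of 0 "1::nat" w wbar P0 z] inst_patterns[of 0 "1::nat" V "{}"] by simp
      ultimately show ?thesis by simp
    qed
    then have "(\<Sum>\<mu>\<in>Pow ?A. \<Sum>\<rho>\<in>Pow ?T. if ?P (?\<zeta> \<union> (\<mu> \<union> \<rho>)) then ?lw ?GA (?\<zeta> \<union> (\<mu> \<union> \<rho>)) else 0) =
      (\<Sum>\<mu>\<in>Pow ?A. \<Sum>\<rho>\<in>Pow ?T. ?lw P0 z * (if z.admissible ?C \<mu> then ?lw ?A \<mu> else 0) * ?lw ?T \<rho>)"
      by (intro sum.cong refl) blast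
    also have "\<dots> = ?lw P0 z * (\<Sum>\<mu>\<in>Pow ?A. if z.admissible ?C \<mu> then ?lw ?A \<mu> else 0) * (\<Sum>\<rho>\<in>Pow ?T. ?lw ?T \<rho>)"
      by (simp only: sum_distrib_left[symmetric] sum_distrib_right[symmetric])
    also have "(\<Sum>\<mu>\<in>Pow ?A. if z.admissible ?C \<mu> then ?lw ?A \<mu> else 0) = total_weight z ?C"
      using z.sum_admissible[of ?C "\<lambda>_. 1"] by (simp add: A atLeast0LessThan cong: if_cong)
    finally show "(\<Sum>\<mu>\<in>Pow ?A. \<Sum>\<rho>\<in>Pow ?T. if ?P (?\<zeta> \<union> (\<mu> \<union> \<rho>)) then ?lw ?GA (?\<zeta> \<union> (\<mu> \<union> \<rho>)) else 0) =
      ?lw P0 z * total_weight z ?C * (\<Sum>\<rho>\<in>Pow ?T. ?lw ?T \<rho>)" .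
  qed
  also have "\<dots> = (\<Prod>\<alpha>\<in>?T. w (fst \<alpha>) + wbar (fst \<alpha>)) * (\<Sum>z\<in>Pow P0. ?lw P0 z * total_weight z ?C)"
    unfolding sum_lit_weight[OF fins(3)] by (simp add: sum_distrib_left mult.commute)
  finally show ?thesis .
qed

text \<open>Grouped by predicate, the product takes the form in which \<open>f_prod3\<close> and
  \<open>f_power3\<close> evaluate it.\<close>

lemma large_atoms_product:
  "(\<Prod>\<alpha>\<in>large_atoms n. f (fst \<alpha>)) =
    (\<Prod>p\<leftarrow>[0..<length V]. f p ^ length (filter (\<lambda>as. 3 \<le> length (remdups as)) (tuples (V ! p) (rev [0..<n]))) :: real)"
proof -
  let ?S = "\<lambda>p. {as. as \<in> set (filter (\<lambda>as. 3 \<le> length (remdups as)) (tuples (V ! p) (rev [0..<n])))}"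
  have "large_atoms n = (SIGMA p:{..<length V}. ?S p)"
    by (auto simp: large_atoms_def ground_atoms_def set_tuples length_remdups_card_conv atLeast0LessThan)
  moreover have "(\<Prod>p<length V. \<Prod>as\<in>?S p. f p) = (\<Prod>\<alpha>\<in>(SIGMA p:{..<length V}. ?S p). f (fst \<alpha>))"
    by (subst prod.Sigma) (auto simp: case_prod_unfold)
  ultimately have "(\<Prod>\<alpha>\<in>large_atoms n. f (fst \<alpha>)) = (\<Prod>p<length V. \<Prod>as\<in>?S p. f p)" by simp
  also have "\<dots> = (\<Prod>p<length V. f p ^ length (filter (\<lambda>as. 3 \<le> length (remdups as)) (tuples (V ! p) (rev [0..<n]))))"
  proof (intro prod.cong refl)
    fix p
    have "distinct (filter (\<lambda>as. 3 \<le> length (remdups as)) (tuples (V ! p) (rev [0..<n])))"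
      by (simp add: distinct_tuples)
    from distinct_card[OF this]
    show "(\<Prod>as\<in>?S p. f p) = f p ^ length (filter (\<lambda>as. 3 \<le> length (remdups as)) (tuples (V ! p) (rev [0..<n])))"
      by simp
  qed
  finally show ?thesis by (simp add: prod.distinct_set_conv_list[symmetric] atLeast0LessThan)
qed

end

section \<open>The main program and its running time\<close>

fun const_exp :: "val \<Rightarrow> exp" where
  "const_exp (Node u v) = ENode (const_exp u) (const_exp v)"
| "const_exp _ = ELeaf"

definition list_exp :: "exp list \<Rightarrow> exp" where
  "list_exp es = foldr ENode es ELeaf"

definition weight_exp :: "literal list \<Rightarrow> exp" where
  "weight_exp T = foldr (\<lambda>(s, p, bs) e. EMul (if s then EWeight p else EWeight_bar p) e) T EOne"

definition literals_weight :: "(nat \<Rightarrow> real) \<Rightarrow> (nat \<Rightarrow> real) \<Rightarrow> literal list \<Rightarrow> real" where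
  "literals_weight w wbar T = (\<Prod>(s, p, bs)\<leftarrow>T. if s then w p else wbar p)"

definition weighted :: "(nat \<Rightarrow> real) \<Rightarrow> (nat \<Rightarrow> real) \<Rightarrow> 'k \<times> literal list \<Rightarrow> 'k \<times> literal list \<times> sized_real" where
  "weighted w wbar e = (fst e, snd e, length (snd e) + 1, literals_weight w wbar (snd e))"

definition entry_exp :: "('k \<Rightarrow> val) \<Rightarrow> 'k \<times> literal list \<Rightarrow> exp" where
  "entry_exp enc e = ENode (const_exp (enc (fst e))) (ENode (const_exp (enc_list enc_literal (snd e))) (weight_exp (snd e)))"

definition edges_exp :: exp where
  "edges_exp = EIf (ELeft (ERight (ERight (EVar 0))))
     (ECall f_edges_open [ERight (ERight (ERight (EVar 0)))])
     (ECall f_edges_closed [ERight (ERight (ERight (ERight (EVar 0))))])"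

text \<open>The input is read only for the domain size, the evidence and its edges;
  \<open>powers\<close> and \<open>zeros\<close> are constants of the sentence.\<close>

definition main_exp :: "exp \<Rightarrow> exp \<Rightarrow> nat \<Rightarrow> nat \<Rightarrow> exp" where
  "main_exp powers zeros m width =
    EMul (ECall f_prod3 [powers, ECall f_range [ELeft (EVar 0)]])
     (ECall f_sum_zero [zeros,
       ENode (ELeft (ERight (EVar 0)))
        (ENode (ERight (ERight (EVar 0)))
          (ENode edges_exp
            (ENode (ELeft (EVar 0)) (ENode (const_exp (enc_list enc_nat [0..<m])) (const_exp (enc_nat width)))))),
       ECall f_range [ELeft (EVar 0)]])"

section \<open>Constant expressions and the outermost sums and products\<close>

context machine
begin

text \<open>Evaluation in every environment at one and the same cost: the expression is a constant,
  and its cost cannot depend on the input.\<close>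

definition yields :: "exp \<Rightarrow> val \<Rightarrow> nat \<Rightarrow> bool" where
  "yields e v t \<longleftrightarrow> (\<forall>env Q. Q v t \<longrightarrow> wp env e Q)"

lemma wp_yields: "yields e v t \<Longrightarrow> Q v t \<Longrightarrow> wp env e Q"
  by (simp add: yields_def)

lemma yields_const_exp: "pure v \<Longrightarrow> yields (const_exp v) v (vsize v)"
proof (induction v)
  case (Node u v)
  have "yields (const_exp u) u (vsize u)" "yields (const_exp v) v (vsize v)" using Node by auto
  then show ?case unfolding yields_def by simp
qed (auto simp: yields_def)

lemma yields_node: "yields e1 v1 t1 \<Longrightarrow> yields e2 v2 t2 \<Longrightarrow> yields (ENode e1 e2) (Node v1 v2) (t1 + t2 + 1)"
  unfolding yields_def by simp

lemma yields_mul: "yields e1 (Real s1 r1) t1 \<Longrightarrow> yields e2 (Real s2 r2) t2 \<Longrightarrow>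
    yields (EMul e1 e2) (Real (s1 + s2) (r1 * r2)) (t1 + t2 + s1 + s2)"
  unfolding yields_def by simp

lemma yields_list_exp:
  assumes "\<And>x. x \<in> set xs \<Longrightarrow> \<exists>t. yields (f x) (enc x) t"
  shows "\<exists>t. yields (list_exp (map f xs)) (enc_list enc xs) t"
  using assms
proof (induction xs)
  case Nil
  show ?case by (auto simp: list_exp_def yields_def)
next
  case (Cons x xs)
  obtain t1 t2 where "yields (f x) (enc x) t1" "yields (list_exp (map f xs)) (enc_list enc xs) t2"
    using Cons by fastforce
  from yields_node[OF this] show ?case by (auto simp: list_exp_def)
qed

lemma yields_weight_exp: "\<exists>t. yields (weight_exp T) (Real (length T + 1) (literals_weight w wbar T)) t"
proof (induction T)
  case Nil
  show ?case by (auto simp: weight_exp_def yields_def literals_weight_def)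
next
  case (Cons x T)
  obtain s p bs where x: "x = (s, p, bs)" by (cases x) auto
  obtain t where t: "yields (weight_exp T) (Real (length T + 1) (literals_weight w wbar T)) t" using Cons by blast
  have "yields (if s then EWeight p else EWeight_bar p) (Real 1 (if s then w p else wbar p)) 1"
    by (simp add: yields_def)
  from yields_mul[OF this t] show ?case
    by (auto simp: weight_exp_def x literals_weight_def One_nat_def)
qed

lemma yields_entry_exp:
  assumes "faithful enc"
  shows "\<exists>t. yields (entry_exp enc e) (enc_entry enc (weighted w wbar e)) t"
proof -
  obtain t where t: "yields (weight_exp (snd e)) (Real (length (snd e) + 1) (literals_weight w wbar (snd e))) t"
    using yields_weight_exp by blast
  have "pure (enc (fst e))" "pure (enc_list enc_literal (snd e))"
    using assms by (intro faithfulD; simp)+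
  from yields_node[OF yields_const_exp[OF this(1)] yields_node[OF yields_const_exp[OF this(2)] t]]
  show ?thesis by (auto simp: entry_exp_def weighted_def)
qed

definition "c_power3 N s L = (L + 1) * (c_dedup N + s + L * s + 300)" for N s L :: nat

lemma computes_power3:
  assumes "\<And>t. t \<in> set ts \<Longrightarrow> length t \<le> N \<and> set t \<subseteq> {..N}"
  shows "computes_real f_power3 [enc_list (enc_list enc_nat) ts, Real s r]
    (r ^ length (filter (\<lambda>t. 3 \<le> length (remdups t)) ts)) (length ts * s + 1) (c_power3 N s (length ts))"
proof -
  have "length xs \<le> length ts \<Longrightarrow> set xs \<subseteq> set ts \<Longrightarrow> computes_real f_power3 [enc_list (enc_list enc_nat) xs, Real s r]
    (r ^ length (filter (\<lambda>t. 3 \<le> length (remdups t)) xs)) (length xs * s + 1) ((length xs + 1) * (c_dedup N + s + length ts * s + 300))" for xs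
  proof (induction xs)
    case Nil
    show ?case unfolding computes_real_def call_fun body_power3_def by simp
  next
    case (Cons x xs)
    have IH: "computes_real f_power3 [enc_list (enc_list enc_nat) xs, Real s r]
       (r ^ length (filter (\<lambda>t. 3 \<le> length (remdups t)) xs)) (length xs * s + 1) ((length xs + 1) * (c_dedup N + s + length ts * s + 300))"
      using Cons by simp
    have 1: "computes f_dedup [enc_list enc_nat x] (enc_list enc_nat (remdups x)) (c_dedup N)"
      using assms[of x] Cons.prems by (intro computes_dedup) auto
    have 2: "computes f_leq [Node Leaf (Node Leaf (Node Leaf Leaf)), enc_list enc_nat (remdups x)] (enc_bool (3 \<le> length (remdups x))) 80"
      using computes_leq[of "enc_nat 3" "enc_list enc_nat (remdups x)"] by (simp add: numeral_3_eq_3)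
    have le: "length xs * s \<le> length ts * s" using Cons.prems by (intro mult_le_mono1) simp
    show ?case unfolding computes_real_def call_fun body_power3_def
      by (auto intro!: 1[THEN call_computes] 2[THEN call_computes] IH[THEN call_computes_real])
        (use le in linarith)
  qed
  from this[of ts] show ?thesis by (simp add: c_power3_def)
qed

definition "c_prod3 N A s L j = (j + 1) * (c_tuples A N + c_power3 N s L + (j + 2) * (L * s + 2) + 100)" for N A s L j :: nat

lemma computes_prod3:
  assumes "length C \<le> N" "set C \<subseteq> {..N}" "A \<le> N" "\<And>a s' r. (a, s', r) \<in> set ps \<Longrightarrow> a \<le> A \<and> s' \<le> s"
    and L: "(length C + 1) ^ A \<le> L"
  shows "computes_real f_prod3 [enc_list (enc_pair enc_nat enc_real) ps, enc_list enc_nat C]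
    (\<Prod>(a, x)\<leftarrow>ps. snd x ^ length (filter (\<lambda>t. 3 \<le> length (remdups t)) (tuples a C)))
    (length ps * (L * s + 1) + 1) (c_prod3 N A s L (length ps))"
proof -
  define B where "B = c_tuples A N + c_power3 N s L + (length ps + 2) * (L * s + 2) + 100"
  have "length xs \<le> length ps \<Longrightarrow> set xs \<subseteq> set ps \<Longrightarrow> computes_real f_prod3 [enc_list (enc_pair enc_nat enc_real) xs, enc_list enc_nat C]
    (\<Prod>(a, x)\<leftarrow>xs. snd x ^ length (filter (\<lambda>t. 3 \<le> length (remdups t)) (tuples a C)))
    (length xs * (L * s + 1) + 1) ((length xs + 1) * B)" for xs
  proof (induction xs)
    case Nil
    show ?case unfolding computes_real_def call_fun body_prod3_def by (simp add: B_def)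
  next
    case (Cons x xs)
    obtain a s' r where x: "x = (a, s', r)" by (cases x)
    have a: "a \<le> A" "s' \<le> s" using assms(4)[of a s' r] Cons.prems by (auto simp: x)
    have lt: "length (tuples a C) \<le> L"
    proof -
      have "length C ^ a \<le> (length C + 1) ^ a" by (intro power_mono) auto
      also have "\<dots> \<le> (length C + 1) ^ A" using a by (intro power_increasing) auto
      finally show ?thesis using L by simp
    qed
    have IH: "computes_real f_prod3 [enc_list (enc_pair enc_nat enc_real) xs, enc_list enc_nat C]
      (\<Prod>(a, x)\<leftarrow>xs. snd x ^ length (filter (\<lambda>t. 3 \<le> length (remdups t)) (tuples a C)))
      (length xs * (L * s + 1) + 1) ((length xs + 1) * B)"
      using Cons by simp
    have "c_tuples a N \<le> c_tuples A N"
      using a unfolding c_tuples_def c_outer_def by (intro mult_le_mono add_mono power_increasing) auto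
    then have 1: "computes f_tuples [enc_nat a, enc_list enc_nat C] (enc_list (enc_list enc_nat) (tuples a C)) (c_tuples A N)"
      by (rule computes_mono[OF computes_tuples[OF assms(1)]])
    have "length t \<le> N \<and> set t \<subseteq> {..N}" if "t \<in> set (tuples a C)" for t
      using that assms(2,3) a by (auto simp: set_tuples)
    then have "computes_real f_power3 [enc_list (enc_list enc_nat) (tuples a C), Real s' r]
      (r ^ length (filter (\<lambda>t. 3 \<le> length (remdups t)) (tuples a C))) (length (tuples a C) * s' + 1) (c_power3 N s' (length (tuples a C)))"
      by (rule computes_power3)
    then have 2: "computes_real f_power3 [enc_list (enc_list enc_nat) (tuples a C), Real s' r]
      (r ^ length (filter (\<lambda>t. 3 \<le> length (remdups t)) (tuples a C))) (L * s + 1) (c_power3 N s L)"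
      by (rule computes_real_mono) (use a lt in \<open>auto simp only: c_power3_def intro!: mult_le_mono add_mono\<close>)
    have "(length xs + 1) * q \<le> length ps * q" for q using Cons.prems by (intro mult_le_mono1) simp
    from this[of "L * s + 1"] have le: "s1 + s2 \<le> (length ps + 2) * (L * s + 2)"
      if "s1 \<le> L * s + 1" "s2 \<le> length xs * (L * s + 1) + 1" for s1 s2
    proof -
      have "s1 + s2 \<le> (length xs + 1) * (L * s + 1) + 1" using that by (simp add: distrib_right)
      also have "\<dots> \<le> length ps * (L * s + 1) + 1" using \<open>_ \<le> length ps * (L * s + 1)\<close> by simp
      also have "length ps * (L * s + 1) + 1 \<le> (length ps + 2) * (L * s + 1 + 1)"
        by (simp add: distrib_left distrib_right)
      also have "\<dots> = (length ps + 2) * (L * s + 2)" by (simp add: add.assoc)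
      finally show ?thesis .
    qed
    have Bd: "c_tuples A N + c_power3 N s L + (length ps + 2) * (L * s + 2) + 100 = B" by (simp add: B_def)
    show ?case unfolding computes_real_def call_fun body_prod3_def
      by (auto simp: x intro!: 1[THEN call_computes] 2[THEN call_computes_real] IH[THEN call_computes_real])
        (drule (1) le, use Bd in linarith)
  qed
  from this[of ps] show ?thesis by (simp add: B_def c_prod3_def)
qed

definition "c_sum_zero b s S L j = (j + 1) * (b + (L + 1) * (2 * S + L + 60) + 3 * (s + S + L + j + 2) + 200)" for b s S L j :: nat

lemma computes_sum_zero:
  assumes "\<And>z. z \<in> set zs \<Longrightarrow> sz z \<le> s \<and>
    computes_table f_solve [C, Leaf, Node (ul z) (Node (bl z) rest)] (\<lambda>tab. table_ok m c S tab \<and> table_sum tab (\<lambda>_. 1) = tot z) b"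
    and L: "(c + 1) ^ m \<le> L"
  shows "computes_real f_sum_zero [enc_list (\<lambda>z. Node (Real (sz z) (wz z)) (Node (ul z) (bl z))) zs, rest, C]
    (\<Sum>z\<leftarrow>zs. wz z * tot z) (s + S + L + 1 + length zs + 1) (c_sum_zero b s S L (length zs))"
proof -
  define B where "B = b + (L + 1) * (2 * S + L + 60) + 3 * (s + S + L + length zs + 2) + 200"
  have "length xs \<le> length zs \<Longrightarrow> set xs \<subseteq> set zs \<Longrightarrow>
    computes_real f_sum_zero [enc_list (\<lambda>z. Node (Real (sz z) (wz z)) (Node (ul z) (bl z))) xs, rest, C]
    (\<Sum>z\<leftarrow>xs. wz z * tot z) (s + S + L + 1 + length xs + 1) ((length xs + 1) * B)" for xs
  proof (induction xs)
    case Nil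
    show ?case unfolding computes_real_def call_fun body_sum_zero_def by (simp add: B_def)
  next
    case (Cons z xs)
    have IH: "computes_real f_sum_zero [enc_list (\<lambda>z. Node (Real (sz z) (wz z)) (Node (ul z) (bl z))) xs, rest, C]
        (\<Sum>z\<leftarrow>xs. wz z * tot z) (s + S + L + 1 + length xs + 1) ((length xs + 1) * B)"
      using Cons by simp
    have z: "sz z \<le> s" and 1: "computes_table f_solve [C, Leaf, Node (ul z) (Node (bl z) rest)]
        (\<lambda>tab. table_ok m c S tab \<and> table_sum tab (\<lambda>_. 1) = tot z) b"
      using Cons.prems assms(1) by auto
    have 2: "computes_real f_sum_table [enc_table tab] (tot z) (S + L + 1) ((L + 1) * (2 * S + L + 60))"
      if "table_ok m c S tab" "table_sum tab (\<lambda>_. 1) = tot z" for tab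
    proof -
      have "length tab \<le> L" using length_table[OF that(1)] L by linarith
      then have "(length tab + 1) * (2 * S + length tab + 60) \<le> (L + 1) * (2 * S + L + 60)"
        by (intro mult_le_mono) auto
      then show ?thesis
        using computes_real_mono[OF computes_sum_table[OF that(1)]] that(2) \<open>length tab \<le> L\<close> by simp
    qed
    show ?case using z Cons.prems unfolding computes_real_def call_fun body_sum_zero_def
      by (auto simp: B_def intro!: 1[THEN call_computes_table] 2[THEN call_computes_real] IH[THEN call_computes_real])
  qed
  from this[of zs] show ?thesis by (simp add: B_def c_sum_zero_def)
qed

end

section \<open>Polynomial bounds and the length of the evidence\<close>

definition poly_bounded :: "(nat \<Rightarrow> nat) \<Rightarrow> bool" where
  "poly_bounded f \<longleftrightarrow> (\<exists>q :: nat poly. \<forall>n. f n \<le> poly q n)"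

lemma poly_bounded_const [intro!]: "poly_bounded (\<lambda>n. c)"
  unfolding poly_bounded_def by (rule exI[of _ "[:c:]"]) simp

lemma poly_bounded_id [intro!]: "poly_bounded (\<lambda>n. n)"
  unfolding poly_bounded_def by (rule exI[of _ "[:0, 1:]"]) simp

lemma poly_bounded_add [intro!]: "poly_bounded f \<Longrightarrow> poly_bounded g \<Longrightarrow> poly_bounded (\<lambda>n. f n + g n)"
  unfolding poly_bounded_def by (metis add_mono poly_add)

lemma poly_bounded_mult [intro!]: "poly_bounded f \<Longrightarrow> poly_bounded g \<Longrightarrow> poly_bounded (\<lambda>n. f n * g n)"
  unfolding poly_bounded_def by (metis mult_le_mono poly_mult)

lemma poly_bounded_power [intro!]: "poly_bounded f \<Longrightarrow> poly_bounded (\<lambda>n. f n ^ k)"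
  by (induction k) auto

text \<open>Evidence can tell two atoms of one predicate apart only by mentioning one of them;
  closed-world evidence makes both false or leaves both open.\<close>

lemma evidence_ok_cong:
  assumes "fst \<alpha> = fst \<beta>" "\<alpha> \<notin> evidence_atoms E" "\<beta> \<notin> evidence_atoms E"
  shows "evidence_ok E s \<alpha> \<longleftrightarrow> evidence_ok E s \<beta>"
  using assms by (cases E) (auto simp: image_iff)

lemma card_ground_atoms: "card (ground_atoms V {..<n}) \<le> length V * (n + 1) ^ sum_list V"
proof -
  have "ground_atoms V {..<n} = (SIGMA p:{..<length V}. {as. set as \<subseteq> {..<n} \<and> length as = V ! p})"
    by (auto simp: ground_atoms_def)
  then have "card (ground_atoms V {..<n}) = (\<Sum>p<length V. n ^ (V ! p))"
    by (simp add: card_SigmaI finite_lists_length_eq card_lists_length_eq)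
  also have "\<dots> \<le> (\<Sum>p<length V. (n + 1) ^ sum_list V)"
  proof (intro sum_mono)
    fix p assume "p \<in> {..<length V}"
    then have "V ! p \<le> sum_list V" by (intro member_le_sum_list) simp_all
    then have "(n + 1) ^ (V ! p) \<le> (n + 1) ^ sum_list V" by (intro power_increasing) auto
    moreover have "n ^ (V ! p) \<le> (n + 1) ^ (V ! p)" by (intro power_mono) auto
    ultimately show "n ^ (V ! p) \<le> (n + 1) ^ sum_list V" by linarith
  qed
  finally show ?thesis by simp
qed

text \<open>Open-world evidence may contain every ground atom with both signs; the last summand is
  for the list of closed-world predicates.\<close>

definition evidence_length :: "vocab \<Rightarrow> nat \<Rightarrow> nat" where
  "evidence_length V n = 2 * (length V * (n + 1) ^ sum_list V) + length V"

text \<open>Input lists are free of duplicates, so the number of possible literals bounds their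
  length.\<close>

lemma enc_evidence_length:
  assumes "encodes_evidence v E" "evidence_of_kind V {..<n} c E"
  shows "enc_evidence (evidence_length V n) v E"
  using assms(1)
proof cases
  case (1 v' L)
  then obtain xs where xs: "distinct xs" "set xs = L" "v' = enc_list (enc_pair enc_bool enc_gatom) xs"
    by (auto simp: encodes_set_def)
  have "L \<subseteq> UNIV \<times> ground_atoms V {..<n}" using assms(2) 1 by (force simp: atoms_of_kind_def)
  then have "card L \<le> card ((UNIV :: bool set) \<times> ground_atoms V {..<n})"
    by (intro card_mono) (auto simp: finite_ground_atoms)
  also have "\<dots> \<le> evidence_length V n"
    using card_ground_atoms[of V n] by (simp add: card_cartesian_product evidence_length_def)
  finally have "length xs \<le> evidence_length V n" using distinct_card[OF xs(1)] xs(2) by simp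
  then show ?thesis using 1 xs enc_evidence.intros(1)[of xs] by simp
next
  case (2 v1 P v2 A)
  then obtain xs ys where xs: "distinct xs" "set xs = P" "v1 = enc_list enc_nat xs"
    and ys: "distinct ys" "set ys = A" "v2 = enc_list enc_gatom ys"
    by (auto simp: encodes_set_def)
  have "P \<subseteq> {..<length V}" using assms(2) 2 by simp
  then have "card P \<le> card {..<length V}" by (intro card_mono) auto
  then have "length xs \<le> evidence_length V n"
    using distinct_card[OF xs(1)] xs(2) by (simp add: evidence_length_def)
  moreover have "A \<subseteq> ground_atoms V {..<n}" using assms(2) 2 by (auto simp: atoms_of_kind_def)
  then have "card A \<le> card (ground_atoms V {..<n})" by (intro card_mono) (auto simp: finite_ground_atoms)
  then have "length ys \<le> evidence_length V n"
    using card_ground_atoms[of V n] distinct_card[OF ys(1)] ys(2) by (simp add: evidence_length_def)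
  ultimately show ?thesis using 2 xs ys enc_evidence.intros(2)[of xs _ ys] by simp
qed

context machine
begin

lemma edges_run:
  assumes "enc_evidence l v E"
  shows "\<exists>es. length es \<le> l \<and> set es = snd ` evidence_atoms E \<and>
    (\<forall>x y Q. (\<forall>t. t \<le> 20 * (l + 1) + 20 \<longrightarrow> Q (enc_list (enc_list enc_nat) es) t) \<longrightarrow>
      wp [Node x (Node y v)] edges_exp Q)"
  using assms
proof cases
  case (1 xs)
  have "set (map (snd \<circ> snd) xs) = snd ` evidence_atoms E" using 1 by (auto simp: image_image)
  moreover have "wp [Node x (Node y v)] edges_exp Q"
    if "\<forall>t. t \<le> 20 * (l + 1) + 20 \<longrightarrow> Q (enc_list (enc_list enc_nat) (map (snd \<circ> snd) xs)) t" for x y Q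
    using that 1 unfolding edges_exp_def by (auto intro!: computes_edges_open[THEN call_computes])
  ultimately show ?thesis using 1 by (intro exI[of _ "map (snd \<circ> snd) xs"]) simp
next
  case (2 xs ys)
  have "set (map snd ys) = snd ` evidence_atoms E" using 2 by auto
  moreover have "wp [Node x (Node y v)] edges_exp Q"
    if "\<forall>t. t \<le> 20 * (l + 1) + 20 \<longrightarrow> Q (enc_list (enc_list enc_nat) (map snd ys)) t" for x y Q
    using that 2 unfolding edges_exp_def by (auto intro!: computes_edges_closed[THEN call_computes])
  ultimately show ?thesis using 2 by (intro exI[of _ "map snd ys"]) simp
qed

end

section \<open>Constants compiled from the sentence, and the final cost\<close>

context decomposition
begin

definition literals :: "bool gatom list \<Rightarrow> bool gatom set \<Rightarrow> literal list" where
  "literals \<pi>s M = map (\<lambda>\<pi>. (\<pi> \<in> M, \<pi>)) \<pi>s"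

text \<open>Types that violate the sentence are left out here, once and for all; the evidence
  discards further entries at run time.\<close>

definition unary_keys :: "bool gatom set \<Rightarrow> (nat \<times> literal list) list" where
  "unary_keys z = map (\<lambda>a. (a, literals (enum P1) (TS ! a))) (filter (\<lambda>a. ok1 z (TS ! a)) [0..<m])"

definition binary_keys :: "bool gatom set \<Rightarrow> ((nat \<times> nat) \<times> literal list) list" where
  "binary_keys z = map (\<lambda>e. (fst e, literals (enum P2) (snd e)))
    (filter (\<lambda>e. ok2 z (TS ! fst (fst e)) (TS ! snd (fst e)) (snd e))
      (List.product (List.product [0..<m] [0..<m]) (enum (Pow P2))))"

definition "zeros = enum (Pow P0)"

definition "powers_exp = list_exp (map (\<lambda>p. ENode (const_exp (enc_nat (V ! p))) (EAdd (EWeight p) (EWeight_bar p))) [0..<length V])"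

definition "zero_exp z = ENode (weight_exp (literals (enum P0) z))
  (ENode (list_exp (map (entry_exp enc_nat) (unary_keys z)))
    (list_exp (map (entry_exp (enc_pair enc_nat enc_nat)) (binary_keys z))))"

definition "zeros_exp = list_exp (map zero_exp zeros)"

definition "main k = main_exp powers_exp zeros_exp m (k + 1)"

definition "unary_val z = enc_list (enc_entry enc_nat) (map (weighted w wbar) (unary_keys z))"
definition "binary_val z = enc_list (enc_entry (enc_pair enc_nat enc_nat)) (map (weighted w wbar) (binary_keys z))"
definition "zero_val z = Node (Real (length (enum P0) + 1) (lit_weight w wbar P0 z)) (Node (unary_val z) (binary_val z))"
text \<open>The size 2 is that of a sum of two weights.\<close>

definition "powers = map (\<lambda>p. (V ! p, 2 :: nat, w p + wbar p)) [0..<length V]"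

lemma enum_patterns [simp]: "distinct (enum (patterns V c))" "set (enum (patterns V c)) = patterns V c"
  "distinct (enum (Pow (patterns V c)))" "set (enum (Pow (patterns V c))) = Pow (patterns V c)"
  using enum[of "patterns V c"] enum[of "Pow (patterns V c)"] by simp_all

lemma literals_weight_literals: "literals_weight w wbar (literals (enum (patterns V c)) M) = lit_weight w wbar (patterns V c) M"
proof -
  have "literals_weight w wbar (literals (enum (patterns V c)) M) =
      (\<Prod>\<pi>\<leftarrow>enum (patterns V c). if \<pi> \<in> M then w (fst \<pi>) else wbar (fst \<pi>))"
    by (simp add: literals_weight_def literals_def comp_def case_prod_unfold cong: if_cong)
  also have "\<dots> = lit_weight w wbar (patterns V c) M"
    unfolding lit_weight_def by (subst prod.distinct_set_conv_list[symmetric]) simp_all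
  finally show ?thesis .
qed

lemma consistent_literals: "consistent E u v (literals (enum (patterns V c)) M) \<longleftrightarrow> obeys E (patterns V c) M u v"
  by (auto simp: consistent_def literals_def obeys_def inst_def case_prod_unfold)

lemma factor_unary:
  assumes "a < m"
  shows "factor_value U (map (weighted w wbar) (unary_keys z)) a v v = unary z v a"
proof -
  let ?f = "\<lambda>b. if ok1 z (TS ! b) then if a = b \<and> obeys U P1 (TS ! b) v v then lit_weight w wbar P1 (TS ! b) else 0 else 0"
  have "factor_value U (map (weighted w wbar) (unary_keys z)) a v v =
     (\<Sum>b\<leftarrow>filter (\<lambda>a. ok1 z (TS ! a)) [0..<m]. if a = b \<and> obeys U P1 (TS ! b) v v then lit_weight w wbar P1 (TS ! b) else 0)"
    by (simp add: factor_value_def unary_keys_def comp_def weighted_def consistent_literals literals_weight_literals cong: if_cong)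
  also have "\<dots> = (\<Sum>b\<leftarrow>[0..<m]. ?f b)" by (rule sum_list_map_filter')
  also have "\<dots> = (\<Sum>b<m. ?f b)" by (simp add: interv_sum_list_conv_sum_set_nat atLeast0LessThan)
  also have "\<dots> = (\<Sum>b<m. if b = a then unary z v a else 0)"
    by (intro sum.cong refl) (auto simp: unary_def)
  finally show ?thesis using assms by simp
qed

lemma factor_binary:
  assumes "a < m" "b < m"
  shows "factor_value B (map (weighted w wbar) (binary_keys z)) (a, b) u v = binary z u v a b"
proof -
  let ?L = "List.product (List.product [0..<m] [0..<m]) (enum (Pow P2))"
  let ?ok = "\<lambda>e. ok2 z (TS ! fst (fst e)) (TS ! snd (fst e)) (snd e)"
  let ?g = "\<lambda>e. if (a, b) = fst e \<and> obeys B P2 (snd e) u v then lit_weight w wbar P2 (snd e) else 0"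
  have "factor_value B (map (weighted w wbar) (binary_keys z)) (a, b) u v = (\<Sum>e\<leftarrow>filter ?ok ?L. ?g e)"
    by (simp add: factor_value_def binary_keys_def comp_def weighted_def consistent_literals literals_weight_literals cong: if_cong)
  also have "\<dots> = (\<Sum>e\<leftarrow>?L. if ?ok e then ?g e else 0)" by (rule sum_list_map_filter')
  also have "\<dots> = (\<Sum>e\<in>set ?L. if ?ok e then ?g e else 0)"
    by (rule sum_list_distinct_conv_sum_set) (simp add: distinct_product)
  also have "\<dots> = (\<Sum>e\<in>({..<m} \<times> {..<m}) \<times> Pow P2. if ?ok e then ?g e else 0)"
    by (simp add: atLeast0LessThan)
  also have "\<dots> = (\<Sum>p\<in>{..<m} \<times> {..<m}. \<Sum>M\<in>Pow P2. if ?ok (p, M) then ?g (p, M) else 0)"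
    by (simp add: sum.cartesian_product case_prod_unfold cong: if_cong)
  also have "\<dots> = (\<Sum>p\<in>{..<m} \<times> {..<m}. if p = (a, b) then binary z u v a b else 0)"
  proof (intro sum.cong refl)
    fix p
    show "(\<Sum>M\<in>Pow P2. if ?ok (p, M) then ?g (p, M) else 0) = (if p = (a, b) then binary z u v a b else 0)"
    proof (cases "p = (a, b)")
      case True
      then show ?thesis unfolding binary_def by (auto intro!: sum.cong)
    next
      case False
      then have "(if ?ok (p, M) then ?g (p, M) else 0) = 0" for M by simp
      then show ?thesis using False by (simp only: sum.neutral_const if_False)
    qed
  qed
  finally show ?thesis using assms by simp
qed

definition "key_size n = 2 * length V + sum_list V * (2 * n + 6) + 4 * m + 20 + length (enum P1) + length (enum P2)"
definition "entry_size = length (enum P1) + length (enum P2) + 1"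
definition "max_entries = m + m * m * length (enum (Pow P2))"
definition "factor_size = entry_size + max_entries + 1"
definition "factor_cost n = (max_entries + 1) * c_factor (evidence_length V n) (key_size n) entry_size max_entries"
text \<open>One number that dominates the domain size, the number and the length of the hyperedges
  and the tuple length, as the solver demands of \<open>N\<close>.\<close>

definition "list_bound k n = n + evidence_length V n + sum_list V + k + 3"
definition "solve_cost k n = solver_costs.Q m (k + 1) (list_bound k n) factor_size (factor_cost n) *
  (list_bound k n + 1) ^ (solver_costs.M m (k + 1) + 1) + 50"
definition "real_size k n = solver_costs.Smax m (list_bound k n) factor_size + 1"
definition "main_cost k n t =
   machine.c_sum_zero (solve_cost k n) (length (enum P0) + 1) (real_size k n) ((n + 1) ^ m) (length zeros) +
   machine.c_prod3 (list_bound k n) (sum_list V) 2 ((n + 1) ^ sum_list V) (length V) +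
   length V * ((n + 1) ^ sum_list V * 2 + 1) + (length (enum P0) + 1 + real_size k n + (n + 1) ^ m + 1 + length zeros + 1) +
   40 * (n + 1) + 20 * (evidence_length V n + 1) + t + vsize (enc_list enc_nat [0..<m]) + 2 * k + 300"

text \<open>All exponents, namely \<open>m\<close>, \<open>k + 1\<close>, \<open>sum_list V\<close>
  and the one built from \<open>M\<close>, are independent of \<open>n\<close>, so only sums,
  products and fixed powers occur.\<close>

lemma poly_bounded_main_cost: "poly_bounded (\<lambda>n. main_cost k n t)"
  unfolding main_cost_def machine.c_sum_zero_def machine.c_prod3_def machine.c_power3_def
    machine.c_tuples_def machine.c_outer_def machine.c_dedup_def machine.c_memn_def
    solve_cost_def real_size_def list_bound_def evidence_length_def factor_cost_def factor_size_def
    solver_costs.Q_def solver_costs.Smax_def solver_costs.G_def solver_costs.s_cross_def solver_costs.s_link_def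
    solver_costs.Lt_def solver_costs.c_assign_def solver_costs.c_comb_def solver_costs.c_comb1_def
    solver_costs.c_cross_def solver_costs.c_cross1_def solver_costs.c_link_def solver_costs.c_shift_def
    machine.c_findsep_def machine.c_diff_def machine.c_parts_def machine.c_balanced_def machine.c_remove_def
    machine.c_nat_def machine.c_gather_def machine.c_touches_def machine.c_adj_def machine.c_merge_def
    machine.c_insort_def machine.c_add_def c_factor_def c_ok_def c_mem_def key_size_def
  by (intro poly_bounded_add poly_bounded_mult poly_bounded_power poly_bounded_const poly_bounded_id)

lemma atom_size:
  assumes "\<pi> \<in> patterns V c" "u \<le> Suc n" "v \<le> Suc n"
  shows "vsize (enc_gatom (fst \<pi>, map (pick u v) (snd \<pi>))) \<le> key_size n" "length (snd \<pi>) \<le> key_size n"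
proof -
  have p: "fst \<pi> < length V" "length (snd \<pi>) = V ! fst \<pi>"
    using assms(1) by (auto simp: patterns_def ground_atoms_def)
  have l: "length (snd \<pi>) \<le> sum_list V" unfolding p(2) by (rule member_le_sum_list) (simp_all add: p(1))
  have "vsize (enc_list enc_nat (map (pick u v) (snd \<pi>))) \<le> length (map (pick u v) (snd \<pi>)) * (2 * n + 3 + 1) + 1"
    using assms by (intro vsize_enc_list) (auto simp: pick_def)
  also have "\<dots> \<le> sum_list V * (2 * n + 6) + 1" by (rule add_mono[OF mult_le_mono order_refl]) (use l in simp_all)
  finally show "vsize (enc_gatom (fst \<pi>, map (pick u v) (snd \<pi>))) \<le> key_size n"
    using p(1) by (simp add: key_size_def)
  have "sum_list V * 1 \<le> sum_list V * (2 * n + 6)" by (intro mult_le_mono2) simp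
  then show "length (snd \<pi>) \<le> key_size n" using l unfolding key_size_def by linarith
qed

lemma keys_run:
  fixes prog :: exp
  assumes "enc_evidence (evidence_length V n) ev E" "faithful enc" "vsize (enc key) \<le> key_size n"
    and ks: "\<And>k T. (k, T) \<in> set ks \<Longrightarrow> \<exists>c M. T = literals (enum (patterns V c)) M \<and> length (enum (patterns V c)) \<le> length (enum P1) + length (enum P2)"
    and uv: "u \<le> Suc n" "v \<le> Suc n" and l: "length ks \<le> max_entries"
  shows "machine.computes_real prog w wbar f_factor
    [enc_list (enc_entry enc) (map (weighted w wbar) ks), enc key, enc_nat u, enc_nat v, ev]
    (factor_value E (map (weighted w wbar) ks) key u v) factor_size (factor_cost n)"
proof -
  interpret mc: machine prog w wbar .
  have sizes: "length T \<le> length (enum P1) + length (enum P2)" if "(k, T) \<in> set ks" for k T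
    using ks[OF that] by (auto simp: literals_def)
  have "mc.computes_real f_factor
    [enc_list (enc_entry enc) (map (weighted w wbar) ks), enc key, enc_nat u, enc_nat v, ev]
    (factor_value E (map (weighted w wbar) ks) key u v) (entry_size + length (map (weighted w wbar) ks) + 1)
    ((length (map (weighted w wbar) ks) + 1) * c_factor (evidence_length V n) (key_size n) entry_size (length (map (weighted w wbar) ks)))"
  proof (rule mc.computes_factor[OF assms(1-3)])
    fix k T s r assume "(k, T, s, r) \<in> set (map (weighted w wbar) ks)"
    then have "(k, T) \<in> set ks" "s = length T + 1" by (auto simp: weighted_def)
    then show "s \<le> entry_size \<and> length T \<le> key_size n"
      using sizes by (fastforce simp: entry_size_def key_size_def)
  next
    fix k T x s p bs assume *: "(k, T, x) \<in> set (map (weighted w wbar) ks)" "(s, p, bs) \<in> set T"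
    then have "(k, T) \<in> set ks" by (auto simp: weighted_def)
    then obtain c M where T: "T = literals (enum (patterns V c)) M" using ks by blast
    then have "(p, bs) \<in> patterns V c" using *(2) by (auto simp: literals_def)
    from atom_size[OF this uv] show "vsize (enc_gatom (p, map (pick u v) bs)) \<le> key_size n \<and> length bs \<le> key_size n"
      by simp
  qed
  then show ?thesis
    by (rule mc.computes_real_mono)
      (use l in \<open>auto simp: factor_size_def factor_cost_def c_factor_def intro!: mult_le_mono add_mono\<close>)
qed

lemma length_binary_keys: "length (binary_keys z) \<le> max_entries"
proof -
  have "length (binary_keys z) \<le> length (List.product (List.product [0..<m] [0..<m]) (enum (Pow P2)))"
    unfolding binary_keys_def length_map by (rule length_filter_le)
  then show ?thesis by (simp add: max_entries_def)
qed

lemma length_unary_keys: "length (unary_keys z) \<le> max_entries"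
proof -
  have "length (unary_keys z) \<le> length [0..<m]"
    unfolding unary_keys_def length_map by (rule length_filter_le)
  then show ?thesis by (simp add: max_entries_def)
qed

lemma solver_instance:
  fixes prog :: exp
  assumes U: "enc_evidence (evidence_length V n) uv U" and Bk: "binary_evidence V {..<n} B"
    and B: "enc_evidence (evidence_length V n) bv B"
    and tw: "treewidth {..<n} (gaifman_edges B) \<le> k"
    and es: "length es \<le> evidence_length V n" "set es = snd ` evidence_atoms B" and z: "z \<subseteq> P0"
  shows "solver prog w wbar m (unary z) (binary z) (k + 1) (list_bound k n) factor_size (factor_cost n) n es
    (unary_val z) (binary_val z) uv bv"
proof -
  interpret z: decomposition_zero V \<psi> x y w wbar U B z by unfold_locales (rule z)
  interpret mc: machine prog w wbar .
  have ev: "evidence_atoms B \<subseteq> ground_atoms V {..<n}"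
    using Bk by (cases B) (auto simp: atoms_of_kind_def)
  have edge: "{u, v} \<in> gaifman_edges B \<longleftrightarrow> u \<noteq> v \<and> adjacent es u v" for u v
    unfolding gaifman_edges_def adjacent_def es(2) by (auto simp: doubleton_eq_iff case_prod_unfold)
  have es_n: "length e \<le> sum_list V" "set e \<subseteq> {..<n}" if "e \<in> set es" for e
    using that ev unfolding es(2) ground_atoms_def by (auto intro!: member_le_sum_list)
  show ?thesis
  proof
    fix v a assume va: "v < n" "a < m"
    show "mc.computes_real f_factor [unary_val z, enc_nat a, enc_nat v, enc_nat v, uv] (unary z v a) factor_size (factor_cost n)"
      unfolding unary_val_def factor_unary[OF va(2), symmetric]
    proof (rule keys_run[OF U])
      show "vsize (enc_nat a) \<le> key_size n" using va by (simp add: key_size_def)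
      show "length (unary_keys z) \<le> max_entries" by (rule length_unary_keys)
    qed (use va in \<open>auto simp: unary_keys_def\<close>)
  next
    fix u v a b assume uv: "u \<le> Suc n" "v \<le> Suc n" "a < m" "b < m"
    have "mc.computes_real f_factor [binary_val z, enc_pair enc_nat enc_nat (a, b), enc_nat u, enc_nat v, bv] (binary z u v a b) factor_size (factor_cost n)"
      unfolding binary_val_def factor_binary[OF uv(3,4), symmetric]
    proof (rule keys_run[OF B])
      show "vsize (enc_pair enc_nat enc_nat (a, b)) \<le> key_size n" using uv by (simp add: key_size_def)
      show "length (binary_keys z) \<le> max_entries" by (rule length_binary_keys)
    qed (use uv in \<open>auto simp: binary_keys_def\<close>)
    then show "mc.computes_real f_factor [binary_val z, Node (enc_nat a) (enc_nat b), enc_nat u, enc_nat v, bv] (binary z u v a b) factor_size (factor_cost n)"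
      by simp
  next
    fix u v a b assume uv: "u < n" "v < n" "u \<noteq> v" "\<not> adjacent es u v"
    \<comment> \<open>No evidence atom contains either pair: the first is not adjacent, and the
      second lies outside the domain. The evidence thus treats corresponding atoms alike.\<close>
    have "obeys B P2 M u v \<longleftrightarrow> obeys B P2 M n (Suc n)" for M
      unfolding obeys_def
    proof (intro ball_cong refl)
      fix \<pi> assume \<pi>: "\<pi> \<in> P2"
      then have s: "set (snd (inst u v \<pi>)) = {u, v}" "set (snd (inst n (Suc n) \<pi>)) = {n, Suc n}"
        by (auto simp: inst_def patterns_def pick_def UNIV_bool)
      have "inst u v \<pi> \<notin> evidence_atoms B"
        using uv(4) s(1) unfolding adjacent_def es(2) by force
      moreover have "inst n (Suc n) \<pi> \<notin> evidence_atoms B"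
        using ev s(2) by (auto simp: ground_atoms_def)
      ultimately show "evidence_ok B (\<pi> \<in> M) (inst u v \<pi>) \<longleftrightarrow> evidence_ok B (\<pi> \<in> M) (inst n (Suc n) \<pi>)"
        by (intro evidence_ok_cong) simp_all
    qed
    then show "binary z u v a b = binary z n (Suc n) a b" by (simp add: binary_def)
  next
    fix C assume C: "distinct C" "set C \<subseteq> {..<n}" "C \<noteq> []"
    show "\<exists>X\<in>set (tuples (k + 1) C). balanced (parts es (remove_list X C)) C"
    proof (rule exists_balanced_separator[OF _ _ tw C])
      show "e \<subseteq> {..<n}" if "e \<in> gaifman_edges B" for e
        using that ev by (auto simp: gaifman_edges_def ground_atoms_def)
      show "\<exists>e\<in>set es. u \<in> set e \<and> v \<in> set e" if "{u, v} \<in> gaifman_edges B" "u \<noteq> v" for u v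
        using that edge by (simp add: adjacent_def)
      show "{u, v} \<in> gaifman_edges B" if "e \<in> set es" "u \<in> set e" "v \<in> set e" "u \<noteq> v" for u v e
        using that edge by (auto simp: adjacent_def)
    qed simp
  next
    show "length e \<le> list_bound k n" if "e \<in> set es" for e
      using es_n(1)[OF that] by (simp add: list_bound_def)
  qed (use es in \<open>simp_all add: list_bound_def\<close>)
qed

lemma enc_list_map: "enc_list enc (map f xs) = enc_list (\<lambda>x. enc (f x)) xs"
  by (induction xs) auto

lemma zeros_yield:
  fixes prog :: exp
  shows "\<exists>t. machine.yields prog w wbar zeros_exp (enc_list zero_val zeros) t"
  and "\<exists>t. machine.yields prog w wbar powers_exp (enc_list (enc_pair enc_nat enc_real) powers) t"
proof -
  interpret mc: machine prog w wbar .
  have "\<exists>t. mc.yields (zero_exp z) (zero_val z) t" for z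
  proof -
    obtain t1 where 1: "mc.yields (weight_exp (literals (enum P0) z)) (Real (length (enum P0) + 1) (lit_weight w wbar P0 z)) t1"
      using mc.yields_weight_exp[of "literals (enum P0) z"]
      unfolding literals_weight_literals by (auto simp: literals_def)
    obtain t2 where 2: "mc.yields (list_exp (map (entry_exp enc_nat) (unary_keys z))) (unary_val z) t2"
      unfolding unary_val_def enc_list_map
      using mc.yields_list_exp[where xs = "unary_keys z" and f = "entry_exp enc_nat" and enc = "\<lambda>x. enc_entry enc_nat (weighted w wbar x)"]
        mc.yields_entry_exp[OF faithful_enc(1)] by blast
    obtain t3 where 3: "mc.yields (list_exp (map (entry_exp (enc_pair enc_nat enc_nat)) (binary_keys z))) (binary_val z) t3"
      unfolding binary_val_def enc_list_map
      using mc.yields_list_exp[where xs = "binary_keys z" and f = "entry_exp (enc_pair enc_nat enc_nat)" and enc = "\<lambda>x. enc_entry (enc_pair enc_nat enc_nat) (weighted w wbar x)"]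
        mc.yields_entry_exp[OF faithful_enc(4)[OF faithful_enc(1) faithful_enc(1)]] by blast
    show ?thesis unfolding zero_exp_def zero_val_def
      using mc.yields_node[OF 1 mc.yields_node[OF 2 3]] by blast
  qed
  then show "\<exists>t. mc.yields zeros_exp (enc_list zero_val zeros) t"
    unfolding zeros_exp_def by (intro mc.yields_list_exp) blast
  have "\<exists>t. mc.yields (ENode (const_exp (enc_nat (V ! p))) (EAdd (EWeight p) (EWeight_bar p)))
      (enc_pair enc_nat enc_real (V ! p, 2, w p + wbar p)) t" for p
  proof -
    have "mc.yields (EAdd (EWeight p) (EWeight_bar p)) (Real 2 (w p + wbar p)) 4"
      by (simp add: mc.yields_def)
    from mc.yields_node[OF mc.yields_const_exp this, of "enc_nat (V ! p)"] show ?thesis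
      using faithfulD(2)[OF faithful_enc(1), of "V ! p"] by auto
  qed
  then show "\<exists>t. mc.yields powers_exp (enc_list (enc_pair enc_nat enc_real) powers) t"
    unfolding powers_exp_def powers_def enc_list_map by (intro mc.yields_list_exp) blast
qed

lemma main_correct:
  assumes Uk: "unary_evidence V {..<n} U" and Bk: "binary_evidence V {..<n} B"
    and tw: "treewidth {..<n} (gaifman_edges B) \<le> k" and inp: "encodes_input inp n (U, B)"
    and tz: "machine.yields (main k) w wbar zeros_exp (enc_list zero_val zeros) tz"
    and tp: "machine.yields (main k) w wbar powers_exp (enc_list (enc_pair enc_nat enc_real) powers) tp"
  shows "outputs_in_time (main k # lib) w wbar inp (wfomc V {..<n} w wbar (Forall x (Forall y \<psi>)) (U, B)) (main_cost k n (tz + tp))"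
proof -
  interpret mc: machine "main k" w wbar .
  obtain uv bv where inp': "inp = Node (enc_nat n) (Node uv bv)" "encodes_evidence uv U" "encodes_evidence bv B"
    using inp by cases auto
  have uv: "enc_evidence (evidence_length V n) uv U" and bv: "enc_evidence (evidence_length V n) bv B"
    using enc_evidence_length inp'(2,3) Uk Bk by blast+
  obtain es where es: "length es \<le> evidence_length V n" "set es = snd ` evidence_atoms B"
    and er: "\<And>x y Q. (\<And>t. t \<le> 20 * (evidence_length V n + 1) + 20 \<Longrightarrow> Q (enc_list (enc_list enc_nat) es) t) \<Longrightarrow>
      mc.wp [Node x (Node y bv)] edges_exp Q"
    using mc.edges_run[OF bv] by blast
  define rest where "rest = Node uv (Node bv (Node (enc_list (enc_list enc_nat) es)
    (Node (enc_nat n) (Node (enc_list enc_nat [0..<m]) (enc_nat (k + 1))))))"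
  let ?C = "rev [0..<n]"
  let ?N = "list_bound k n"
  have zs: "mc.computes_table f_solve [enc_list enc_nat ?C, Leaf, Node (unary_val z) (Node (binary_val z) rest)]
    (\<lambda>tab. table_ok m n (real_size k n) tab \<and> table_sum tab (\<lambda>_. 1) = total_weight z ?C) (solve_cost k n)"
    if "z \<in> set zeros" for z
  proof -
    have "z \<subseteq> P0" using that by (auto simp: zeros_def)
    note S = solver_instance[OF uv Bk bv tw es this, where prog = "main k"]
    show ?thesis
      using solver.computes_solve_range[OF S] unfolding solver.ctx_def[OF S] rest_def real_size_def solve_cost_def .
  qed
  have sz: "mc.computes_real f_sum_zero [enc_list zero_val zeros, rest, enc_list enc_nat ?C]
    (\<Sum>z\<leftarrow>zeros. lit_weight w wbar P0 z * total_weight z ?C)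
    (length (enum P0) + 1 + real_size k n + (n + 1) ^ m + 1 + length zeros + 1)
    (machine.c_sum_zero (solve_cost k n) (length (enum P0) + 1) (real_size k n) ((n + 1) ^ m) (length zeros))"
    using mc.computes_sum_zero[of zeros "\<lambda>_. length (enum P0) + 1" "length (enum P0) + 1" "enc_list enc_nat ?C" unary_val binary_val rest m n
       "real_size k n" "\<lambda>z. total_weight z ?C" "solve_cost k n" "(n + 1) ^ m" "\<lambda>z. lit_weight w wbar P0 z"] zs
    unfolding zero_val_def by simp
  have ps: "mc.computes_real f_prod3 [enc_list (enc_pair enc_nat enc_real) powers, enc_list enc_nat ?C]
    (\<Prod>(a, x)\<leftarrow>powers. snd x ^ length (filter (\<lambda>t. 3 \<le> length (remdups t)) (tuples a ?C)))
    (length powers * ((n + 1) ^ sum_list V * 2 + 1) + 1)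
    (machine.c_prod3 ?N (sum_list V) 2 ((n + 1) ^ sum_list V) (length powers))"
  proof (rule mc.computes_prod3)
    show "length ?C \<le> ?N" "set ?C \<subseteq> {..?N}" "sum_list V \<le> ?N" by (auto simp: list_bound_def)
    show "(length ?C + 1) ^ sum_list V \<le> (n + 1) ^ sum_list V" by simp
    fix a s' r assume "(a, s', r) \<in> set powers"
    then show "a \<le> sum_list V \<and> s' \<le> 2" by (auto simp: powers_def intro!: member_le_sum_list)
  qed
  have lp: "length powers = length V" by (simp add: powers_def)
  define p z where "p = (\<Prod>(a, x)\<leftarrow>powers. snd x ^ length (filter (\<lambda>t. 3 \<le> length (remdups t)) (tuples a ?C)))"
    and "z = (\<Sum>z\<leftarrow>zeros. lit_weight w wbar P0 z * total_weight z ?C)"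
  have "wfomc V {..<n} w wbar (Forall x (Forall y \<psi>)) (U, B) = p * z"
    unfolding wfomc_eq[OF Uk Bk] p_def z_def
    using large_atoms_product[of "\<lambda>p. w p + wbar p" n]
    by (simp add: powers_def zeros_def comp_def sum_list_distinct_conv_sum_set)
  moreover have "mc.wp [inp] (ECall 0 [EVar 0]) (\<lambda>v t. \<exists>s. v = Real s (p * z) \<and> t \<le> main_cost k n (tz + tp))"
  proof -
    have c0: "mc.call 0 [Node (enc_nat n) (Node uv bv)] Q \<longleftrightarrow> mc.wp [Node (enc_nat n) (Node uv bv)] (main_exp powers_exp zeros_exp m (k + 1)) Q" for Q
      unfolding main_def[symmetric] by (simp add: mc.call_def mc.prg_def)
    have y1: "mc.yields (const_exp (enc_list enc_nat [0..<m])) (enc_list enc_nat [0..<m]) (vsize (enc_list enc_nat [0..<m]))"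
      "mc.yields (const_exp (enc_nat (k + 1))) (enc_nat (k + 1)) (2 * k + 3)"
      using mc.yields_const_exp[of "enc_list enc_nat [0..<m]"] mc.yields_const_exp[of "enc_nat (k + 1)"]
      by (simp_all add: faithfulD numeral_3_eq_3)
    note range = mc.computes_range[of n]
    show ?thesis
      unfolding inp'(1)
      by (auto simp: c0 main_exp_def intro!: mc.wp_yields[OF tp] mc.wp_yields[OF tz] mc.wp_yields[OF y1(1)] mc.wp_yields[OF y1(2)]
          range[THEN mc.call_computes_eq] er
          ps[folded p_def, THEN mc.call_computes_real] sz[folded z_def, unfolded rest_def, THEN mc.call_computes_real])
        (simp add: main_cost_def lp)
  qed
  ultimately show ?thesis
    unfolding outputs_in_time_def mc.wp_def mc.prg_def by auto
qed

end

lemma outputs_in_time_mono: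
  assumes "outputs_in_time prg w wbar inp r t" "t \<le> t'"
  shows "outputs_in_time prg w wbar inp r t'"
  using assms unfolding outputs_in_time_def by (auto intro: order_trans)

theorem theorem1:
  fixes k :: nat
  shows "domain_liftable UFO2 (bounded_treewidth_evidence k)"
  unfolding domain_liftable_def
proof (intro allI impI)
  fix V f and w wbar :: "nat \<Rightarrow> real"
  assume "f \<in> UFO2 \<and> wf_fm V f"
  then obtain x y \<psi> where f: "f = Forall x (Forall y \<psi>)" and "x \<noteq> y" "quantifier_free \<psi>" "free_vars \<psi> \<subseteq> {x, y}" "wf_fm V \<psi>"
    by (auto simp: UFO2_def)
  then have d: "decomposition V \<psi> x y" by unfold_locales
  \<comment> \<open>Program and cost have to be fixed before the evidence is known, and they do not
    depend on it; empty evidence serves as a placeholder. Correctness is afterwards taken for the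
    actual evidence.\<close>
  interpret d: decomposition V \<psi> x y w wbar "Open_World {}" "Open_World {}" by (rule d)
  obtain tz where tz: "machine.yields (d.main k) w wbar d.zeros_exp (enc_list d.zero_val d.zeros) tz"
    using d.zeros_yield(1) by auto
  obtain tp where tp: "machine.yields (d.main k) w wbar d.powers_exp (enc_list (enc_pair enc_nat enc_real) d.powers) tp"
    using d.zeros_yield(2) by auto
  obtain q where q: "d.main_cost k n (tz + tp) \<le> poly q n" for n
    using d.poly_bounded_main_cost[of k "tz + tp"] unfolding poly_bounded_def by blast
  have "outputs_in_time (d.main k # lib) w wbar inp (wfomc V {..<n} w wbar f E) (poly q n)"
    if E: "E \<in> bounded_treewidth_evidence k V n" and inp: "encodes_input inp n E" for n E inp
  proof -
    obtain U B where UB: "E = (U, B)" "unary_evidence V {..<n} U" "binary_evidence V {..<n} B"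
      "treewidth {..<n} (gaifman_edges B) \<le> k"
      using E by (auto simp: bounded_treewidth_evidence_def)
    have "outputs_in_time (d.main k # lib) w wbar inp (wfomc V {..<n} w wbar (Forall x (Forall y \<psi>)) (U, B)) (d.main_cost k n (tz + tp))"
      by (rule decomposition.main_correct[OF d UB(2-4) inp[unfolded UB(1)] tz tp])
    then show ?thesis
      unfolding f UB(1) by (rule outputs_in_time_mono) (rule q)
  qed
  then show "\<exists>prg q. \<forall>n. \<forall>E\<in>bounded_treewidth_evidence k V n. \<forall>inp. encodes_input inp n E \<longrightarrow>
      outputs_in_time prg w wbar inp (wfomc V {..<n} w wbar f E) (poly q n)"
    by (intro exI[of _ "d.main k # lib"] exI[of _ q] allI ballI impI)
qed

end
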